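(* For $d\ge2$, $p\in[2,\infty)$ and $s\in\mathbb{R}$ consider the estimate $$(\ast)_{d,p,s}\qquad \|U(t)u_0\|_{L^p_xL^\infty_{y,t\in[0,1]}}\le C\|u_0\|_{H^s(\mathbb{R}^d)}\quad\text{for all }u_0\in\mathcal{S}(\mathbb{R}^d),$$ with a constant $C$ independent of $u_0$. (1) If $d=3$, then $(\ast)_{3,p,s}$ holds whenever $p\ge2$ and $s>\frac32-\frac1p$. Moreover this is sharp up to the endpoint: for $p\ge 2$ and $s<\frac32-\frac1p$, $(\ast)_{3,p,s}$ fails. (2) If $d=2$, then $(\ast)_{2,p,s}$ holds whenever either $p\ge4$ and $s>1-\frac1p$, or $p\in[2,4)$ and $s>\frac34$. Moreover this is sharp up to the endpoint when $p\in[4,\infty)$ and when $p=2$: for $p\in[4,\infty)$ and $s<1-\frac1p$, $(\ast)_{2,p,s}$ fails; and for $p=2$ and $s<\frac34$, $(\ast)_{2,2,s}$ fails.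
   Context: Points of $\mathbb{R}^d$ are written $(x,y)$ with $x\in\mathbb{R}$, $y\in\mathbb{R}^{d-1}$, and frequencies $(\xi,\eta)$ with $\xi\in\mathbb{R}$, $\eta\in\mathbb{R}^{d-1}$. $\{U(t)\}_{t\in\mathbb{R}}$ is the unitary group of the linear equation $\partial_tu+\partial_x\Delta u=0$ on $\mathbb{R}^d\times\mathbb{R}$, given by $\widehat{U(t)u_0}(\xi,\eta)=e^{it\xi(\xi^2+|\eta|^2)}\widehat{u_0}(\xi,\eta)$, the Fourier transform being in the space variables. $H^s(\mathbb{R}^d)$ is the inhomogeneous $L^2$-based Sobolev space. Mixed norm: $\|F\|_{L^p_xL^\infty_{y,t\in[0,1]}}=\big(\int_{\mathbb{R}}\sup_{y\in\mathbb{R}^{d-1},\,t\in[0,1]}|F(x,y,t)|^p\,dx\big)^{1/p}$. *)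

theory Defs
  imports "HOL-Analysis.Analysis"
begin

text \<open>
  Space and frequency variables live in \<open>real \<times> 'y\<close>, with \<open>'y\<close> a Euclidean space
  of dimension \<open>d - 1\<close>, so that \<open>d = DIM(real \<times> 'y)\<close>.
\<close>

fun iter_deriv :: "'a::euclidean_space list \<Rightarrow> ('a \<Rightarrow> complex) \<Rightarrow> 'a \<Rightarrow> complex" where
  "iter_deriv [] f = f"
| "iter_deriv (b # bs) f = (\<lambda>x. frechet_derivative (iter_deriv bs f) (at x) b)"

text \<open>
  A list of basis vectors plays the role of a multi-index. Differentiability of all iterated
  partial derivatives is smoothness, and it also keeps \<^const>\<open>frechet_derivative\<close> meaningful
  at each stage of the iteration.
\<close>

definition schwartz :: "('a::euclidean_space \<Rightarrow> complex) \<Rightarrow> bool" where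
  "schwartz f \<longleftrightarrow>
     (\<forall>bs. set bs \<subseteq> Basis \<longrightarrow>
        (\<forall>x. iter_deriv bs f differentiable (at x)) \<and>
        (\<forall>k::nat. \<exists>B::real. \<forall>x. (1 + norm x) ^ k * norm (iter_deriv bs f x) \<le> B))"

text \<open>Fourier transform in the unitary normalisation; it is only applied to integrable functions.\<close>

definition fourier :: "('a::euclidean_space \<Rightarrow> complex) \<Rightarrow> 'a \<Rightarrow> complex" where
  "fourier f \<zeta> =
     complex_of_real ((2 * pi) powr (- real DIM('a) / 2)) *
     (LINT z|lborel. cis (- (z \<bullet> \<zeta>)) * f z)"

definition inv_fourier :: "('a::euclidean_space \<Rightarrow> complex) \<Rightarrow> 'a \<Rightarrow> complex" where
  "inv_fourier g z =
     complex_of_real ((2 * pi) powr (- real DIM('a) / 2)) *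
     (LINT \<zeta>|lborel. cis (z \<bullet> \<zeta>) * g \<zeta>)"

definition dispersion :: "real \<times> 'y::euclidean_space \<Rightarrow> real" where
  "dispersion = (\<lambda>(\<xi>, \<eta>). \<xi> * (\<xi>\<^sup>2 + (norm \<eta>)\<^sup>2))"

text \<open>The group \<open>U(t)\<close> acting on Schwartz data.\<close>

definition propagator ::
    "real \<Rightarrow> (real \<times> 'y::euclidean_space \<Rightarrow> complex) \<Rightarrow> real \<times> 'y \<Rightarrow> complex" where
  "propagator t u = inv_fourier (\<lambda>\<zeta>. cis (t * dispersion \<zeta>) * fourier u \<zeta>)"

text \<open>
  Norms take values in \<^typ>\<open>ennreal\<close>, so that an infinite integral makes the norm infinite.
\<close>

definition ennreal_root :: "real \<Rightarrow> ennreal \<Rightarrow> ennreal" where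
  "ennreal_root p a = (if a = \<infinity> then \<infinity> else ennreal (enn2real a powr (1 / p)))"

definition sobolev_norm :: "real \<Rightarrow> ('a::euclidean_space \<Rightarrow> complex) \<Rightarrow> ennreal" where
  "sobolev_norm s u =
     ennreal_root 2 (\<integral>\<^sup>+ \<zeta>. ennreal ((1 + (norm \<zeta>)\<^sup>2) powr s * (norm (fourier u \<zeta>))\<^sup>2) \<partial>lborel)"

definition mixed_norm :: "real \<Rightarrow> (real \<Rightarrow> 'y::euclidean_space \<Rightarrow> real \<Rightarrow> complex) \<Rightarrow> ennreal" where
  "mixed_norm p F =
     ennreal_root p
       (\<integral>\<^sup>+ x. (SUP (y, t) \<in> UNIV \<times> {0..1}. ennreal (norm (F x y t) powr p)) \<partial>lborel)"

definition maximal_estimate :: "'y::euclidean_space itself \<Rightarrow> real \<Rightarrow> real \<Rightarrow> bool" where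
  "maximal_estimate (_ :: 'y itself) p s \<longleftrightarrow>
     (\<exists>C::real. C > 0 \<and>
        (\<forall>u :: real \<times> 'y \<Rightarrow> complex. schwartz u \<longrightarrow>
           mixed_norm p (\<lambda>x y t. propagator t u (x, y)) \<le> ennreal C * sobolev_norm s u))"

end

theory Submission
  imports Defs "HOL-Probability.Probability"
begin

text \<open>
  Sufficiency. Linearise the supremum by measurable functions \<open>y(x)\<close>, \<open>t(x)\<close> and dualise. By the
  \<open>TT*\<close> argument the estimate follows from a sum of weights \<open>w\<^sub>k\<close> dominating
  \<open>(1 + |\<zeta>|\<^sup>2)\<^sup>-\<^sup>s\<close>, whose convolution kernels are dominated, uniformly in \<open>y\<close> and \<open>|t| \<le> 1\<close>, by
  functions of \<open>x\<close> in \<open>L\<^sup>p\<^sup>/\<^sup>2\<close> with summable norms. Dilating one weight at unit frequency by \<open>2\<^sup>k\<close>,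
  everything reduces to the kernel \<open>K(x,y,T)\<close> of that weight: it is \<open>O(x\<^sup>-\<^sup>2)\<close> for \<open>|x| \<ge> C|T|\<close>
  (no stationary point), and otherwise \<open>O(|T|\<^sup>-\<^sup>\<theta>)\<close>. For \<open>d = 3\<close> two quadratic oscillatory integrals in
  \<open>\<eta>\<close> give every \<open>\<theta> < 1\<close>. For \<open>d = 2\<close> a linear change of variables turns the symbol into
  \<open>4(p\<^sup>3 + q\<^sup>3)\<close>, so that the kernel is a product of two Airy type integrals; away from the origin one
  of them decays like \<open>|T|\<^sup>-\<^sup>1\<^sup>/\<^sup>2\<close>, the other like \<open>|T|\<^sup>-\<^sup>1\<^sup>/\<^sup>3\<close>, and \<open>\<theta> = 5/6\<close>.

  Necessity. A Gaussian concentrated at scale \<open>1/L\<close>, at time \<open>0\<close>, forces \<open>s \<ge> d/2 - 1/p\<close>. For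
  \<open>d = p = 2\<close> a wave packet of frequency \<open>L\<close> and width \<open>L\<^sup>-\<^sup>1\<^sup>/\<^sup>2\<close> in \<open>q\<close>, and of width \<open>1\<close> in \<open>p\<close>, travels a
  distance of order \<open>L\<^sup>2\<close> without dispersing, which forces \<open>s \<ge> 3/4\<close>.
\<close>

subsection \<open>One-dimensional oscillatory integrals\<close>

text \<open>One count produces all the exponents. Dilating frequencies by \<open>2^k\<close>
  multiplies the kernel by \<open>2^(dk)\<close> and the time by \<open>2^(3k)\<close>. A kernel
  bounded by \<open>|x|^(-\<theta>)\<close> up to \<open>|x| \<le> C 2^(3k)\<close> then has
  \<open>L^(p/2)\<close> norm of order \<open>2^(k(d + 4/p - 3\<theta>))\<close>, against the gain
  \<open>2^(-2sk)\<close> of the Sobolev weight. The geometric series asks for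
  \<open>2s > d + 4/p - 3\<theta>\<close>, integrability at \<open>x = 0\<close> for
  \<open>\<theta> < 2/p\<close>. Letting \<open>\<theta>\<close> tend to \<open>2/p\<close> gives
  \<open>s > d/2 - 1/p\<close>; for \<open>d = 2\<close> the decay stops at \<open>5/6\<close>,
  which at \<open>p = 2\<close> gives \<open>3/4\<close>. Giving up the endpoint is what makes
  Young's inequality sufficient. The obstacle for \<open>d = 2\<close> is the frequency origin: both
  Airy factors degenerate there and the decay drops to \<open>2/3\<close>. Hence a separate
  low-frequency weight, used only for rescaled times \<open>|T| \<le> 1\<close>, where a trivial
  bound suffices. The cutoffs are squares of quadratic polynomials: they vanish to second order at
  both ends, just enough for the two integrations by parts behind \<open>x^(-2)\<close>.\<close>

lemma DERIV_at_continuous_on: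
  fixes f :: "real \<Rightarrow> real"
  assumes "\<And>v. v \<in> S \<Longrightarrow> (f has_real_derivative f' v) (at v)"
  shows "continuous_on S f"
  using assms DERIV_isCont continuous_at_imp_continuous_on by blast

lemma has_vector_derivative_cis_comp:
  assumes "(f has_real_derivative a) (at x within s)"
  shows "((\<lambda>v. cis (f v)) has_vector_derivative (\<i> * of_real a * cis (f x))) (at x within s)"
proof -
  have "((\<lambda>v. cos (f v)) has_real_derivative - sin (f x) * a) (at x within s)"
    "((\<lambda>v. sin (f v)) has_real_derivative cos (f x) * a) (at x within s)"
    using assms by (auto intro!: derivative_eq_intros)
  then show ?thesis
    by (subst has_vector_derivative_complex_iff)
       (simp add: has_real_derivative_iff_has_vector_derivative mult.commute)
qed

text \<open>Since \<open>\<phi>' * cis \<phi>\<close> is \<open>-\<i>\<close> times the derivative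
  of \<open>cis \<phi>\<close>, an amplitude of the form \<open>\<phi>' * h\<close> integrates by
  parts. Passing \<open>h\<close> explicitly leaves the division by \<open>\<phi>'\<close> to the
  caller and lets the step be repeated with \<open>h'\<close> as the new amplitude.\<close>

lemma oscillatory_by_parts:
  fixes \<phi> \<phi>' g h h' :: "real \<Rightarrow> real"
  assumes "c \<le> d"
    and \<phi>: "\<And>v. v \<in> {c..d} \<Longrightarrow> (\<phi> has_real_derivative \<phi>' v) (at v)"
    and h: "\<And>v. v \<in> {c..d} \<Longrightarrow> (h has_real_derivative h' v) (at v)"
    and g: "\<And>v. v \<in> {c..d} \<Longrightarrow> g v = \<phi>' v * h v"
    and cont: "continuous_on {c..d} \<phi>'" "continuous_on {c..d} h'"
  shows "integral {c..d} (\<lambda>v. cis (\<phi> v) * of_real (g v)) =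
     \<i> * integral {c..d} (\<lambda>v. cis (\<phi> v) * of_real (h' v))
     - \<i> * (cis (\<phi> d) * of_real (h d) - cis (\<phi> c) * of_real (h c))"
proof -
  have c\<phi>: "continuous_on {c..d} \<phi>" and ch: "continuous_on {c..d} h"
    by (rule DERIV_at_continuous_on, erule \<phi> h)+
  have cg: "continuous_on {c..d} g"
    using continuous_on_mult[OF cont(1) ch] by (rule continuous_on_eq) (simp add: g)
  have ccis: "continuous_on {c..d} (\<lambda>v. cis (\<phi> v))"
    by (intro continuous_intros c\<phi>)
  have "((\<lambda>v. \<i> * of_real (\<phi>' v) * cis (\<phi> v) * of_real (h v) + cis (\<phi> v) * of_real (h' v)) has_integral
      (cis (\<phi> d) * of_real (h d) - cis (\<phi> c) * of_real (h c))) {c..d}"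
  proof (rule fundamental_theorem_of_calculus[OF \<open>c \<le> d\<close>])
    fix v assume v: "v \<in> {c..d}"
    have "((\<lambda>v. cis (\<phi> v)) has_vector_derivative (\<i> * of_real (\<phi>' v) * cis (\<phi> v))) (at v within {c..d})"
      by (rule has_vector_derivative_cis_comp[OF has_field_derivative_at_within[OF \<phi>[OF v]]])
    moreover have "((\<lambda>v. complex_of_real (h v)) has_vector_derivative of_real (h' v)) (at v within {c..d})"
      by (rule has_vector_derivative_of_real[OF has_field_derivative_at_within[OF h[OF v]]])
    ultimately show "((\<lambda>v. cis (\<phi> v) * of_real (h v)) has_vector_derivative
      (\<i> * of_real (\<phi>' v) * cis (\<phi> v) * of_real (h v) + cis (\<phi> v) * of_real (h' v))) (at v within {c..d})"
      by (rule has_vector_derivative_eq_rhs[OF has_vector_derivative_mult]) (simp add: algebra_simps)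
  qed
  then have 1: "integral {c..d} (\<lambda>v. \<i> * (cis (\<phi> v) * of_real (g v)) + cis (\<phi> v) * of_real (h' v)) =
      cis (\<phi> d) * of_real (h d) - cis (\<phi> c) * of_real (h c)"
    by (intro integral_unique) (rule has_integral_eq[rotated], assumption, simp add: g algebra_simps)
  have i1: "(\<lambda>v. cis (\<phi> v) * of_real (g v)) integrable_on {c..d}"
    and i2: "(\<lambda>v. cis (\<phi> v) * of_real (h' v)) integrable_on {c..d}"
    by (intro integrable_continuous_real continuous_intros ccis cg cont)+
  have "\<i> * integral {c..d} (\<lambda>v. cis (\<phi> v) * of_real (g v)) +
      integral {c..d} (\<lambda>v. cis (\<phi> v) * of_real (h' v)) =
      cis (\<phi> d) * of_real (h d) - cis (\<phi> c) * of_real (h c)"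
    using 1 i1 i2 by (subst (asm) integral_add) (auto simp: integrable_on_cmult_left)
  then have "\<i> * integral {c..d} (\<lambda>v. cis (\<phi> v) * of_real (g v)) =
      cis (\<phi> d) * of_real (h d) - cis (\<phi> c) * of_real (h c)
      - integral {c..d} (\<lambda>v. cis (\<phi> v) * of_real (h' v))"
    by (simp add: eq_diff_eq)
  then have "- \<i> * (\<i> * integral {c..d} (\<lambda>v. cis (\<phi> v) * of_real (g v))) =
      - \<i> * (cis (\<phi> d) * of_real (h d) - cis (\<phi> c) * of_real (h c)
      - integral {c..d} (\<lambda>v. cis (\<phi> v) * of_real (h' v)))" by simp
  then show ?thesis
    by (simp add: right_diff_distrib)
qed

text \<open>First-derivative test. With \<open>h = \<psi> / \<phi>'\<close> the boundary terms cost
  \<open>2P / \<mu>\<close>. In \<open>h'\<close> the part with \<open>\<psi>'\<close> costs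
  \<open>P' (d - c) / \<mu>\<close> and the part with \<open>\<phi>''\<close> another
  \<open>2P / \<mu>\<close>, since monotonicity of \<open>\<phi>'\<close> makes the variation of
  \<open>1 / \<phi>'\<close> telescope.\<close>

lemma van_der_Corput_monotone:
  fixes \<phi> \<phi>' \<phi>'' \<psi> \<psi>' :: "real \<Rightarrow> real"
  assumes "c \<le> d" "\<mu> > 0"
    and \<phi>: "\<And>v. v \<in> {c..d} \<Longrightarrow> (\<phi> has_real_derivative \<phi>' v) (at v)"
    and \<phi>': "\<And>v. v \<in> {c..d} \<Longrightarrow> (\<phi>' has_real_derivative \<phi>'' v) (at v)"
    and \<psi>: "\<And>v. v \<in> {c..d} \<Longrightarrow> (\<psi> has_real_derivative \<psi>' v) (at v)"
    and cont: "continuous_on {c..d} \<phi>''" "continuous_on {c..d} \<psi>'"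
    and pos: "\<And>v. v \<in> {c..d} \<Longrightarrow> 0 \<le> \<phi>'' v" "\<And>v. v \<in> {c..d} \<Longrightarrow> \<mu> \<le> \<bar>\<phi>' v\<bar>"
    and P: "\<And>v. v \<in> {c..d} \<Longrightarrow> \<bar>\<psi> v\<bar> \<le> P" "\<And>v. v \<in> {c..d} \<Longrightarrow> \<bar>\<psi>' v\<bar> \<le> P'"
  shows "norm (integral {c..d} (\<lambda>v. cis (\<phi> v) * of_real (\<psi> v))) \<le> (4 * P + P' * (d - c)) / \<mu>"
proof -
  let ?h = "\<lambda>v. \<psi> v / \<phi>' v"
  let ?h' = "\<lambda>v. \<psi>' v / \<phi>' v - \<psi> v * \<phi>'' v / (\<phi>' v)\<^sup>2"
  have nz: "\<phi>' v \<noteq> 0" if "v \<in> {c..d}" for v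
    using pos(2)[OF that] \<open>\<mu> > 0\<close> by auto
  have P0: "P \<ge> 0" "P' \<ge> 0"
    using P[of c] \<open>c \<le> d\<close> by auto
  have cc: "continuous_on {c..d} \<phi>'" "continuous_on {c..d} \<psi>" "continuous_on {c..d} \<phi>"
    by (rule DERIV_at_continuous_on, erule \<phi> \<phi>' \<psi>)+
  have ch': "continuous_on {c..d} ?h'"
    by (intro continuous_intros cont cc) (auto simp: nz)
  have eq: "integral {c..d} (\<lambda>v. cis (\<phi> v) * of_real (\<psi> v)) =
     \<i> * integral {c..d} (\<lambda>v. cis (\<phi> v) * of_real (?h' v))
     - \<i> * (cis (\<phi> d) * of_real (?h d) - cis (\<phi> c) * of_real (?h c))"
  proof (rule oscillatory_by_parts[OF \<open>c \<le> d\<close> \<phi>])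
    show "(?h has_real_derivative ?h' v) (at v)" if "v \<in> {c..d}" for v
      using nz[OF that] \<phi>'[OF that] \<psi>[OF that]
      by (auto intro!: derivative_eq_intros simp: field_simps power2_eq_square)
  qed (use cc ch' nz in auto)
  have bd: "\<bar>?h v\<bar> \<le> P / \<mu>" if "v \<in> {c..d}" for v
    using P(1)[OF that] pos(2)[OF that] \<open>\<mu> > 0\<close> by (auto intro!: frac_le)
  have FTC: "((\<lambda>v. \<phi>'' v / (\<phi>' v)\<^sup>2) has_integral (- 1 / \<phi>' d - (- 1 / \<phi>' c))) {c..d}"
  proof (rule fundamental_theorem_of_calculus[OF \<open>c \<le> d\<close>])
    fix v assume v: "v \<in> {c..d}"
    have "((\<lambda>v. - 1 / \<phi>' v) has_real_derivative \<phi>'' v / (\<phi>' v)\<^sup>2) (at v)"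
      using nz[OF v] \<phi>'[OF v] by (auto intro!: derivative_eq_intros simp: field_simps power2_eq_square)
    then show "((\<lambda>v. - 1 / \<phi>' v) has_vector_derivative \<phi>'' v / (\<phi>' v)\<^sup>2) (at v within {c..d})"
      unfolding has_real_derivative_iff_has_vector_derivative
      by (rule has_vector_derivative_at_within)
  qed
  have "norm (integral {c..d} (\<lambda>v. cis (\<phi> v) * of_real (?h' v))) \<le>
      integral {c..d} (\<lambda>v. P' / \<mu> + P * (\<phi>'' v / (\<phi>' v)\<^sup>2))"
  proof (rule integral_norm_bound_integral)
    show "(\<lambda>v. cis (\<phi> v) * of_real (?h' v)) integrable_on {c..d}"
      by (intro integrable_continuous_real continuous_on_mult continuous_on_of_real ch' continuous_on_cis cc)
    show "(\<lambda>v. P' / \<mu> + P * (\<phi>'' v / (\<phi>' v)\<^sup>2)) integrable_on {c..d}"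
      by (intro integrable_continuous_real continuous_intros cc cont) (auto simp: nz)
    fix v assume v: "v \<in> {c..d}"
    have "\<bar>?h' v\<bar> \<le> \<bar>\<psi>' v / \<phi>' v\<bar> + \<bar>\<psi> v * \<phi>'' v / (\<phi>' v)\<^sup>2\<bar>" by (rule abs_triangle_ineq4)
    also have "\<bar>\<psi>' v / \<phi>' v\<bar> \<le> P' / \<mu>"
      using P(2)[OF v] pos(2)[OF v] \<open>\<mu> > 0\<close> by (auto intro!: frac_le)
    also have "\<bar>\<psi> v * \<phi>'' v / (\<phi>' v)\<^sup>2\<bar> = \<bar>\<psi> v\<bar> * (\<phi>'' v / (\<phi>' v)\<^sup>2)"
      using pos(1)[OF v] by (simp add: abs_mult)
    also have "\<dots> \<le> P * (\<phi>'' v / (\<phi>' v)\<^sup>2)"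
      using P(1)[OF v] pos(1)[OF v] by (intro mult_right_mono) auto
    finally show "norm (cis (\<phi> v) * of_real (?h' v)) \<le> P' / \<mu> + P * (\<phi>'' v / (\<phi>' v)\<^sup>2)"
      by (simp add: norm_mult del: of_real_diff of_real_divide of_real_mult of_real_power)
  qed
  also have "\<dots> = P' / \<mu> * (d - c) + P * (- 1 / \<phi>' d + 1 / \<phi>' c)"
    using has_integral_add[OF has_integral_const_real[of "P' / \<mu>" c d] has_integral_mult_right[OF FTC, of P]]
      \<open>c \<le> d\<close>
    by (intro integral_unique) (simp add: mult.commute)
  also have "\<dots> \<le> P' / \<mu> * (d - c) + P * (2 / \<mu>)"
  proof -
    have "\<bar>1 / \<phi>' v\<bar> \<le> 1 / \<mu>" if "v \<in> {c..d}" for v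
      using pos(2)[OF that] \<open>\<mu> > 0\<close> by (auto intro!: frac_le)
    from this[of c] this[of d] have "- 1 / \<phi>' d + 1 / \<phi>' c \<le> 2 / \<mu>"
      using \<open>c \<le> d\<close> by (simp add: abs_le_iff del: abs_divide)
    then show ?thesis using P0 by (intro add_left_mono mult_left_mono) auto
  qed
  finally have 1: "norm (integral {c..d} (\<lambda>v. cis (\<phi> v) * of_real (?h' v))) \<le> P' / \<mu> * (d - c) + P * (2 / \<mu>)" .
  have "norm (integral {c..d} (\<lambda>v. cis (\<phi> v) * of_real (\<psi> v))) \<le>
     norm (integral {c..d} (\<lambda>v. cis (\<phi> v) * of_real (?h' v))) + (\<bar>?h d\<bar> + \<bar>?h c\<bar>)"
    unfolding eq
    by (rule order.trans[OF norm_triangle_ineq4] add_left_mono)+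
       (auto simp: norm_mult norm_divide intro!: order.trans[OF norm_triangle_ineq4])
  also have "\<dots> \<le> P' / \<mu> * (d - c) + P * (2 / \<mu>) + (P / \<mu> + P / \<mu>)"
    by (intro add_mono 1 bd) (use \<open>c \<le> d\<close> in auto)
  also have "\<dots> = (4 * P + P' * (d - c)) / \<mu>"
    using \<open>\<mu> > 0\<close> by (simp add: field_simps)
  finally show ?thesis .
qed

lemma norm_oscillatory_le:
  fixes \<phi> \<psi> :: "real \<Rightarrow> real"
  assumes "c \<le> d" "continuous_on {c..d} \<phi>" "continuous_on {c..d} \<psi>"
    and "\<And>v. v \<in> {c..d} \<Longrightarrow> \<bar>\<psi> v\<bar> \<le> P"
  shows "norm (integral {c..d} (\<lambda>v. cis (\<phi> v) * of_real (\<psi> v))) \<le> P * (d - c)"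
proof (rule integral_bound)
  show "continuous_on {c..d} (\<lambda>v. cis (\<phi> v) * complex_of_real (\<psi> v))"
    by (intro continuous_on_mult continuous_on_of_real continuous_on_cis assms)
qed (use assms in \<open>auto simp: norm_mult\<close>)

text \<open>By the mean value theorem \<open>\<phi>'\<close> grows at rate at least
  \<open>\<Lambda>\<close>, so a zero of \<open>\<phi>'\<close> can be taken as \<open>v0\<close>.
  If \<open>\<phi>'\<close> starts nonnegative or ends nonpositive, that end of the interval serves
  instead.\<close>

lemma convex_phase_center:
  fixes \<phi>' \<phi>'' :: "real \<Rightarrow> real"
  assumes "c \<le> d"
    and \<phi>': "\<And>v. v \<in> {c..d} \<Longrightarrow> (\<phi>' has_real_derivative \<phi>'' v) (at v)"
    and pos: "\<And>v. v \<in> {c..d} \<Longrightarrow> \<Lambda> \<le> \<phi>'' v"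
  shows "\<exists>v0\<in>{c..d}. \<forall>v\<in>{c..d}. \<Lambda> * \<bar>v - v0\<bar> \<le> \<bar>\<phi>' v\<bar>"
proof -
  have mono: "\<Lambda> * (w - v) \<le> \<phi>' w - \<phi>' v" if "v \<in> {c..d}" "w \<in> {c..d}" "v \<le> w" for v w
  proof (cases "v = w")
    case False
    then have "v < w" using that by simp
    moreover have "(\<phi>' has_real_derivative \<phi>'' x) (at x)" if "v \<le> x" "x \<le> w" for x
      using that \<open>v \<in> {c..d}\<close> \<open>w \<in> {c..d}\<close> by (intro \<phi>') auto
    ultimately obtain z where "z > v" "z < w" "\<phi>' w - \<phi>' v = (w - v) * \<phi>'' z"
      using MVT2[of v w \<phi>' \<phi>''] by blast
    moreover have "\<Lambda> \<le> \<phi>'' z" using pos[of z] calculation that by auto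
    ultimately show ?thesis using \<open>v < w\<close> by (simp add: mult.commute)
  qed auto
  consider "\<phi>' c \<ge> 0" | "\<phi>' d \<le> 0" | "\<phi>' c < 0" "\<phi>' d > 0" by linarith
  then show ?thesis
  proof cases
    case 1
    show ?thesis
    proof (intro bexI[of _ c] ballI)
      fix v assume "v \<in> {c..d}"
      then show "\<Lambda> * \<bar>v - c\<bar> \<le> \<bar>\<phi>' v\<bar>" using mono[of c v] 1 by auto
    qed (use assms in auto)
  next
    case 2
    show ?thesis
    proof (intro bexI[of _ d] ballI)
      fix v assume "v \<in> {c..d}"
      then show "\<Lambda> * \<bar>v - d\<bar> \<le> \<bar>\<phi>' v\<bar>" using mono[of v d] 2 by auto
    qed (use assms in auto)
  next
    case 3
    have "continuous_on {c..d} \<phi>'"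
      by (rule DERIV_at_continuous_on, erule \<phi>')
    then obtain v0 where v0: "v0 \<in> {c..d}" "\<phi>' v0 = 0"
      using IVT'[of \<phi>' c 0 d] 3 \<open>c \<le> d\<close> by auto
    show ?thesis
    proof (intro bexI[of _ v0] ballI)
      fix v assume v: "v \<in> {c..d}"
      show "\<Lambda> * \<bar>v - v0\<bar> \<le> \<bar>\<phi>' v\<bar>"
        using mono[of v v0] mono[of v0 v] v0 v by (cases "v \<le> v0") auto
    qed (use v0 in auto)
  qed
qed

text \<open>Second-derivative test. Within \<open>\<delta> = \<Lambda>^(-1/2)\<close> of the centre
  the trivial bound gives \<open>2P \<delta>\<close>; outside,
  \<open>|\<phi>'| \<ge> \<Lambda> \<delta> = sqrt \<Lambda>\<close> and the first-derivative test
  applies on each side. This \<open>\<delta>\<close> balances the two. The bound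
  \<open>d - c \<le> 2\<close> turns \<open>P' (d - c)\<close> into \<open>2P'\<close>.\<close>

lemma van_der_Corput:
  fixes \<phi> \<phi>' \<phi>'' \<psi> \<psi>' :: "real \<Rightarrow> real"
  assumes "c \<le> d" "d - c \<le> 2" "\<Lambda> > 0"
    and \<phi>: "\<And>v. v \<in> {c..d} \<Longrightarrow> (\<phi> has_real_derivative \<phi>' v) (at v)"
    and \<phi>': "\<And>v. v \<in> {c..d} \<Longrightarrow> (\<phi>' has_real_derivative \<phi>'' v) (at v)"
    and \<psi>: "\<And>v. v \<in> {c..d} \<Longrightarrow> (\<psi> has_real_derivative \<psi>' v) (at v)"
    and cont: "continuous_on {c..d} \<phi>''" "continuous_on {c..d} \<psi>'"
    and pos: "\<And>v. v \<in> {c..d} \<Longrightarrow> \<Lambda> \<le> \<phi>'' v"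
    and P: "\<And>v. v \<in> {c..d} \<Longrightarrow> \<bar>\<psi> v\<bar> \<le> P" "\<And>v. v \<in> {c..d} \<Longrightarrow> \<bar>\<psi>' v\<bar> \<le> P'"
  shows "norm (integral {c..d} (\<lambda>v. cis (\<phi> v) * of_real (\<psi> v))) \<le> (10 * P + 4 * P') / sqrt \<Lambda>"
proof -
  obtain v0 where v0: "v0 \<in> {c..d}" "\<And>v. v \<in> {c..d} \<Longrightarrow> \<Lambda> * \<bar>v - v0\<bar> \<le> \<bar>\<phi>' v\<bar>"
    using convex_phase_center[OF \<open>c \<le> d\<close> \<phi>' pos] by blast
  define \<delta> where "\<delta> = 1 / sqrt \<Lambda>"
  have \<delta>: "\<delta> > 0" "\<Lambda> * \<delta> = sqrt \<Lambda>"
    using \<open>\<Lambda> > 0\<close> by (auto simp: \<delta>_def real_div_sqrt)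
  define l r where "l = max c (v0 - \<delta>)" and "r = min d (v0 + \<delta>)"
  have lr: "c \<le> l" "l \<le> r" "r \<le> d" using v0(1) \<delta> by (auto simp: l_def r_def)
  have P0: "P \<ge> 0" "P' \<ge> 0"
    using P[of c] \<open>c \<le> d\<close> by auto
  have cc: "continuous_on {c..d} \<psi>" "continuous_on {c..d} \<phi>"
    by (rule DERIV_at_continuous_on, erule \<phi> \<psi>)+
  let ?f = "\<lambda>v. cis (\<phi> v) * complex_of_real (\<psi> v)"
  have int: "?f integrable_on {c..d}"
    by (intro integrable_continuous_real continuous_on_mult continuous_on_of_real continuous_on_cis cc)
  \<comment> \<open>The alternative \<open>a = b\<close> is there because truncation to
    \<open>[c, d]\<close> may leave a degenerate side piece, whose single point can be close to
    \<open>v0\<close>.\<close>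
  have side: "norm (integral {a..b} ?f) \<le> (4 * P + P' * 2) / sqrt \<Lambda>"
    if ab: "a \<le> b" "c \<le> a" "b \<le> d" and far: "a = b \<or> (\<forall>v\<in>{a..b}. \<delta> \<le> \<bar>v - v0\<bar>)" for a b
  proof (cases "a = b")
    case True
    then show ?thesis using P0 \<open>\<Lambda> > 0\<close> by simp
  next
    case False
    have "norm (integral {a..b} ?f) \<le> (4 * P + P' * (b - a)) / sqrt \<Lambda>"
    proof (rule van_der_Corput_monotone[where \<phi>'=\<phi>' and \<phi>''=\<phi>'' and \<psi>'=\<psi>'])
      fix v assume v: "v \<in> {a..b}"
      then have v': "v \<in> {c..d}" using ab by auto
      show "0 \<le> \<phi>'' v" using pos[OF v'] \<open>\<Lambda> > 0\<close> by simp
      have "sqrt \<Lambda> \<le> \<Lambda> * \<bar>v - v0\<bar>"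
        unfolding \<delta>(2)[symmetric] using far False v \<open>\<Lambda> > 0\<close> by (intro mult_left_mono) auto
      then show "sqrt \<Lambda> \<le> \<bar>\<phi>' v\<bar>" using v0(2)[OF v'] by simp
    qed (use ab \<open>\<Lambda> > 0\<close> \<phi> \<phi>' \<psi> P in \<open>auto intro: continuous_on_subset[OF cont(1)] continuous_on_subset[OF cont(2)]\<close>)
    also have "\<dots> \<le> (4 * P + P' * 2) / sqrt \<Lambda>"
      using ab assms(2) P0 \<open>\<Lambda> > 0\<close> by (intro divide_right_mono add_left_mono mult_left_mono) auto
    finally show ?thesis .
  qed
  have "integral {c..d} ?f = integral {c..l} ?f + integral {l..d} ?f"
    using lr int by (intro Henstock_Kurzweil_Integration.integral_combine[symmetric]) auto
  also have "integral {l..d} ?f = integral {l..r} ?f + integral {r..d} ?f"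
    using lr integrable_subinterval_real[OF int, of l d]
    by (intro Henstock_Kurzweil_Integration.integral_combine[symmetric]) auto
  finally have "norm (integral {c..d} ?f) \<le>
      norm (integral {c..l} ?f) + (norm (integral {l..r} ?f) + norm (integral {r..d} ?f))"
    using norm_triangle_ineq[of "integral {c..l} ?f" "integral {l..r} ?f + integral {r..d} ?f"]
      norm_triangle_ineq[of "integral {l..r} ?f" "integral {r..d} ?f"] by simp
  also have "\<dots> \<le> (4 * P + P' * 2) / sqrt \<Lambda> + (P * (2 * \<delta>) + (4 * P + P' * 2) / sqrt \<Lambda>)"
  proof (intro add_mono side)
    show "c = l \<or> (\<forall>v\<in>{c..l}. \<delta> \<le> \<bar>v - v0\<bar>)" "r = d \<or> (\<forall>v\<in>{r..d}. \<delta> \<le> \<bar>v - v0\<bar>)"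
      by (auto simp: l_def r_def max_def min_def)
    have "norm (integral {l..r} ?f) \<le> P * (r - l)"
      using lr P by (intro norm_oscillatory_le) (auto intro: continuous_on_subset[OF cc(1)] continuous_on_subset[OF cc(2)])
    also have "\<dots> \<le> P * (2 * \<delta>)"
      using P0 by (intro mult_left_mono) (auto simp: l_def r_def)
    finally show "norm (integral {l..r} ?f) \<le> P * (2 * \<delta>)" .
  qed (use lr in auto)
  also have "\<dots> = (10 * P + 4 * P') / sqrt \<Lambda>"
    by (simp add: \<delta>_def add_divide_distrib)
  finally show ?thesis .
qed

section \<open>Polynomial cutoffs and the oscillatory integrals built from them\<close>

text \<open>The polynomial vanishes to second order at \<open>a\<close> and \<open>b\<close>, so two
  integrations by parts on \<open>[a, b]\<close> produce no boundary terms, and inside the interval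
  all derivatives are explicit.\<close>

definition bump :: "real \<Rightarrow> real \<Rightarrow> real \<Rightarrow> real" where
  "bump a b v = (if a \<le> v \<and> v \<le> b then ((v - a) * (b - v))\<^sup>2 else 0)"

lemma bump_nonneg [simp]: "0 \<le> bump a b v"
  by (simp add: bump_def)

lemma bump_eq_indicator: "bump a b v = indicator {a..b} v * ((v - a) * (b - v))\<^sup>2"
  by (auto simp: bump_def)

lemma borel_measurable_bump [measurable]: "bump a b \<in> borel_measurable borel"
  unfolding bump_eq_indicator[abs_def] by measurable

lemma bump_factor_le:
  assumes "-1 \<le> a" "b \<le> 1" "a \<le> v" "v \<le> (b::real)"
  shows "\<bar>(v - a) * (b - v)\<bar> \<le> 4"
proof -
  have "(v - a) * (b - v) \<le> 2 * 2" using assms by (intro mult_mono) auto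
  then show ?thesis using assms by (simp add: abs_mult)
qed

lemma bump_le:
  assumes "-1 \<le> a" "b \<le> 1"
  shows "bump a b v \<le> 16"
proof (cases "a \<le> v \<and> v \<le> b")
  case True
  then have "((v - a) * (b - v))\<^sup>2 \<le> 4\<^sup>2"
    using bump_factor_le[of a b v] assms by (subst abs_le_square_iff[symmetric]) auto
  then show ?thesis using True by (simp add: bump_def)
qed (auto simp: bump_def)

lemma integrable_cts_bump:
  fixes f :: "real \<Rightarrow> complex"
  assumes "continuous_on UNIV f"
  shows "integrable lborel (\<lambda>v. f v * of_real (bump a b v))"
    and "(LINT v|lborel. f v * of_real (bump a b v)) =
         integral {a..b} (\<lambda>v. f v * of_real (((v - a) * (b - v))\<^sup>2))"
proof -
  let ?g = "\<lambda>v. f v * of_real (((v - a) * (b - v))\<^sup>2)"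
  have "continuous_on {a..b} ?g"
    by (intro continuous_intros continuous_on_subset[OF assms]) auto
  then have i: "set_integrable lborel {a..b} ?g"
    by (rule borel_integrable_atLeastAtMost')
  have eq: "(\<lambda>v. f v * of_real (bump a b v)) = (\<lambda>v. indicator {a..b} v *\<^sub>R ?g v)"
    by (auto simp: bump_def indicator_def)
  show "integrable lborel (\<lambda>v. f v * of_real (bump a b v))"
    using i unfolding eq set_integrable_def .
  show "(LINT v|lborel. f v * of_real (bump a b v)) = integral {a..b} ?g"
    using set_borel_integral_eq_integral(2)[OF i] unfolding eq set_lebesgue_integral_def .
qed

lemma integrable_bump: "integrable lborel (bump a b)"
proof -
  have "integrable lborel (\<lambda>v. Re (1 * of_real (bump a b v)))"
    by (intro integrable_Re integrable_cts_bump continuous_intros)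
  then show ?thesis by (simp add: eta_contract_eq)
qed

text \<open>A truncated Airy integral; \<open>X\<close> plays the role of position and
  \<open>T\<close> that of time.\<close>

definition osc :: "real \<Rightarrow> real \<Rightarrow> real \<Rightarrow> real \<Rightarrow> complex" where
  "osc a b X T = (LINT v|lborel. cis (X * v + T * v ^ 3) * of_real (bump a b v))"

lemma osc_eq_integral:
  "osc a b X T = integral {a..b} (\<lambda>v. cis (X * v + T * v ^ 3) * of_real (((v - a) * (b - v))\<^sup>2))"
  unfolding osc_def by (rule integrable_cts_bump) (intro continuous_intros)

lemma norm_LINT_cis_bump_le:
  assumes "-1 \<le> a" "a \<le> b" "b \<le> 1" "continuous_on UNIV \<phi>"
  shows "norm (LINT v|lborel. cis (\<phi> v) * of_real (bump a b v)) \<le> 32"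
proof -
  have "norm (integral {a..b} (\<lambda>v. cis (\<phi> v) * of_real (((v - a) * (b - v))\<^sup>2))) \<le> 16 * (b - a)"
  proof (rule norm_oscillatory_le)
    fix v assume "v \<in> {a..b}"
    then show "\<bar>((v - a) * (b - v))\<^sup>2\<bar> \<le> 16"
      using bump_le[of a b v] assms by (simp add: bump_def)
  qed (use assms in \<open>auto intro!: continuous_intros continuous_on_subset[OF assms(4)]\<close>)
  also have "\<dots> \<le> 32" using assms by auto
  finally show ?thesis
    by (subst integrable_cts_bump) (auto intro!: continuous_intros continuous_on_subset[OF assms(4)])
qed

lemma norm_osc_le:
  assumes "-1 \<le> a" "a \<le> b" "b \<le> 1"
  shows "norm (osc a b X T) \<le> 32"
  unfolding osc_def by (intro norm_LINT_cis_bump_le assms continuous_intros)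

lemma LINT_cis_uminus_bump:
  "(LINT v|lborel. cis (- \<phi> v) * of_real (bump a b v)) =
   cnj (LINT v|lborel. cis (\<phi> v) * of_real (bump a b v))"
  by (simp add: cis_cnj flip: Bochner_Integration.integral_cnj)

lemma osc_reflect: "osc (- b) (- a) X T = osc a b (- X) (- T)"
proof -
  have "osc (- b) (- a) X T =
    (LINT v|lborel. cis (X * (0 + -1 * v) + T * (0 + -1 * v) ^ 3) * of_real (bump (- b) (- a) (0 + -1 * v)))"
    unfolding osc_def by (subst lborel_integral_real_affine[where c="-1" and t=0]) auto
  also have "\<dots> = osc a b (- X) (- T)"
    unfolding osc_def by (rule Bochner_Integration.integral_cong) (auto simp: bump_def algebra_simps)
  finally show ?thesis .
qed

lemma DERIV_bump_poly:
  "((\<lambda>v. ((v - a) * (b - v))\<^sup>2) has_real_derivative 2 * ((v - a) * (b - v)) * (a + b - 2 * v)) (at v)"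
  by (auto intro!: derivative_eq_intros simp: algebra_simps)

lemma DERIV_bump_poly2:
  "((\<lambda>v. 2 * ((v - a) * (b - v)) * (a + b - 2 * v)) has_real_derivative
     2 * (a + b - 2 * v)\<^sup>2 - 4 * ((v - a) * (b - v))) (at v)"
  by (auto intro!: derivative_eq_intros simp: algebra_simps power2_eq_square)

lemma bump_poly_bounds:
  assumes "-1 \<le> a" "b \<le> 1" "a \<le> v" "v \<le> (b::real)"
  shows "\<bar>((v - a) * (b - v))\<^sup>2\<bar> \<le> 16" "\<bar>2 * ((v - a) * (b - v)) * (a + b - 2 * v)\<bar> \<le> 32"
    "\<bar>2 * (a + b - 2 * v)\<^sup>2 - 4 * ((v - a) * (b - v))\<bar> \<le> 48"
proof -
  have 1: "\<bar>(v - a) * (b - v)\<bar> \<le> 4" by (rule bump_factor_le[OF assms])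
  have 2: "\<bar>a + b - 2 * v\<bar> \<le> 4" using assms by auto
  show "\<bar>((v - a) * (b - v))\<^sup>2\<bar> \<le> 16" using bump_le[of a b v] assms by (simp add: bump_def)
  have "\<bar>(v - a) * (b - v)\<bar> * \<bar>a + b - 2 * v\<bar> \<le> 4 * 4" using 1 2 by (intro mult_mono) auto
  moreover have "\<bar>2 * A * B\<bar> = 2 * (\<bar>A\<bar> * \<bar>B\<bar>)" for A B :: real by (simp add: abs_mult)
  ultimately show "\<bar>2 * ((v - a) * (b - v)) * (a + b - 2 * v)\<bar> \<le> 32" by simp
  have "(a + b - 2 * v)\<^sup>2 \<le> 4\<^sup>2" using 2 by (subst abs_le_square_iff[symmetric]) auto
  then have sq: "(a + b - 2 * v)\<^sup>2 \<le> 16" by simp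
  have "\<bar>2 * S - 4 * A\<bar> \<le> 48" if "0 \<le> S" "S \<le> 16" "\<bar>A\<bar> \<le> 4" for S A :: real
    using that by (simp add: abs_le_iff)
  from this[OF zero_le_power2 sq 1] show "\<bar>2 * (a + b - 2 * v)\<^sup>2 - 4 * ((v - a) * (b - v))\<bar> \<le> 48" .
qed

text \<open>Conjugation reduces concave phases to the convex ones of
  \<open>van_der_Corput\<close>.\<close>

lemma norm_integral_cnj_phase:
  fixes \<phi> \<psi> :: "real \<Rightarrow> real"
  assumes "continuous_on {c..d} \<phi>" "continuous_on {c..d} \<psi>"
  shows "norm (integral {c..d} (\<lambda>v. cis (- \<phi> v) * of_real (\<psi> v))) =
         norm (integral {c..d} (\<lambda>v. cis (\<phi> v) * of_real (\<psi> v)))"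
proof -
  have "(\<lambda>v. cis (\<phi> v) * of_real (\<psi> v)) integrable_on {c..d}"
    by (intro integrable_continuous_real continuous_on_mult continuous_on_of_real continuous_on_cis assms)
  from integral_linear[OF this bounded_linear_cnj]
  have "integral {c..d} (\<lambda>v. cis (- \<phi> v) * of_real (\<psi> v)) =
      cnj (integral {c..d} (\<lambda>v. cis (\<phi> v) * of_real (\<psi> v)))"
    by (simp add: o_def cis_cnj)
  then show ?thesis by simp
qed

text \<open>The second derivative of the phase is \<open>6Tv\<close>, so
  \<open>van_der_Corput\<close> applies wherever it keeps a sign. The cutoff belongs to the larger
  interval \<open>[a, b]\<close>, so that the bound can be used on pieces of one \<open>osc\<close>.
  The constant is \<open>288 = 10 * 16 + 4 * 32\<close>, from the bounds for the cutoff and its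
  derivative.\<close>

lemma cubic_piece:
  assumes ab: "-1 \<le> a" "b \<le> 1" and cd: "c \<le> d" "a \<le> c" "d \<le> b" and "\<Lambda> > 0"
    and big: "(\<forall>v\<in>{c..d}. \<Lambda> \<le> 6 * T * v) \<or> (\<forall>v\<in>{c..d}. \<Lambda> \<le> - (6 * T * v))"
  shows "norm (integral {c..d} (\<lambda>v. cis (X * v + T * v ^ 3) * of_real (((v - a) * (b - v))\<^sup>2)))
     \<le> 288 / sqrt \<Lambda>"
proof -
  have *: "norm (integral {c..d} (\<lambda>v. cis (X * v + T * v ^ 3) * of_real (((v - a) * (b - v))\<^sup>2)))
     \<le> 288 / sqrt \<Lambda>" if "\<forall>v\<in>{c..d}. \<Lambda> \<le> 6 * T * v" for X T
  proof -
    have "norm (integral {c..d} (\<lambda>v. cis (X * v + T * v ^ 3) * of_real (((v - a) * (b - v))\<^sup>2)))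
     \<le> (10 * 16 + 4 * 32) / sqrt \<Lambda>"
    proof (rule van_der_Corput[where \<phi>'="\<lambda>v. X + 3 * T * v\<^sup>2" and \<phi>''="\<lambda>v. 6 * T * v"
          and \<psi>'="\<lambda>v. 2 * ((v - a) * (b - v)) * (a + b - 2 * v)"])
      fix v assume v: "v \<in> {c..d}"
      show "((\<lambda>v. X * v + T * v ^ 3) has_real_derivative X + 3 * T * v\<^sup>2) (at v)"
        by (auto intro!: derivative_eq_intros)
      show "((\<lambda>v. X + 3 * T * v\<^sup>2) has_real_derivative 6 * T * v) (at v)"
        by (auto intro!: derivative_eq_intros)
      show "\<Lambda> \<le> 6 * T * v" using that v by auto
      show "\<bar>((v - a) * (b - v))\<^sup>2\<bar> \<le> 16" "\<bar>2 * ((v - a) * (b - v)) * (a + b - 2 * v)\<bar> \<le> 32"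
        using v cd by (intro bump_poly_bounds ab; simp)+
    qed (use assms in \<open>auto intro!: continuous_intros DERIV_bump_poly\<close>)
    then show ?thesis by simp
  qed
  from big show ?thesis
  proof
    assume "\<forall>v\<in>{c..d}. \<Lambda> \<le> - (6 * T * v)"
    then have "norm (integral {c..d} (\<lambda>v. cis (- X * v + - T * v ^ 3) * of_real (((v - a) * (b - v))\<^sup>2)))
     \<le> 288 / sqrt \<Lambda>" by (intro *) auto
    also have "(\<lambda>v. cis (- X * v + - T * v ^ 3) * complex_of_real (((v - a) * (b - v))\<^sup>2)) =
      (\<lambda>v. cis (- (X * v + T * v ^ 3)) * complex_of_real (((v - a) * (b - v))\<^sup>2))" by simp
    finally show ?thesis
      by (subst (asm) norm_integral_cnj_phase) (auto intro!: continuous_intros)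
  qed (rule *)
qed

lemma quadratic_decay:
  assumes "-1 \<le> a" "a \<le> b" "b \<le> 1" "T \<noteq> 0"
  shows "norm (LINT v|lborel. cis (X * v + T * v\<^sup>2) * of_real (bump a b v)) \<le> 288 / sqrt \<bar>T\<bar>"
proof -
  have *: "norm (LINT v|lborel. cis (X * v + T * v\<^sup>2) * of_real (bump a b v)) \<le> 288 / sqrt T"
    if "T > 0" for X T
  proof -
    have "norm (integral {a..b} (\<lambda>v. cis (X * v + T * v\<^sup>2) * of_real (((v - a) * (b - v))\<^sup>2)))
     \<le> (10 * 16 + 4 * 32) / sqrt T"
    proof (rule van_der_Corput[where \<phi>'="\<lambda>v. X + 2 * T * v" and \<phi>''="\<lambda>v. 2 * T"
          and \<psi>'="\<lambda>v. 2 * ((v - a) * (b - v)) * (a + b - 2 * v)"])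
      fix v assume v: "v \<in> {a..b}"
      show "((\<lambda>v. X * v + T * v\<^sup>2) has_real_derivative X + 2 * T * v) (at v)"
        by (auto intro!: derivative_eq_intros)
      show "((\<lambda>v. X + 2 * T * v) has_real_derivative 2 * T) (at v)"
        by (auto intro!: derivative_eq_intros)
      show "\<bar>((v - a) * (b - v))\<^sup>2\<bar> \<le> 16" "\<bar>2 * ((v - a) * (b - v)) * (a + b - 2 * v)\<bar> \<le> 32"
        using v by (intro bump_poly_bounds assms; simp)+
    qed (use assms that in \<open>auto intro!: continuous_intros DERIV_bump_poly\<close>)
    also have "\<dots> = 288 / sqrt T" by simp
    finally show ?thesis
      by (subst integrable_cts_bump) (auto intro!: continuous_intros)
  qed
  show ?thesis
  proof (cases "T > 0")
    case False
    have "norm (LINT v|lborel. cis (- X * v + - T * v\<^sup>2) * of_real (bump a b v)) \<le> 288 / sqrt (- T)"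
      by (rule *) (use False assms in auto)
    also have "(LINT v|lborel. cis (- X * v + - T * v\<^sup>2) * complex_of_real (bump a b v)) =
      cnj (LINT v|lborel. cis (X * v + T * v\<^sup>2) * complex_of_real (bump a b v))"
      using LINT_cis_uminus_bump[of "\<lambda>v. X * v + T * v\<^sup>2" a b] by simp
    finally show ?thesis using False by simp
  qed (use * in auto)
qed

text \<open>For \<open>v \<ge> 1/16\<close> the second derivative has size at least
  \<open>6|T|/16\<close>, hence at least \<open>|T|/4\<close>; the square root of \<open>1/4\<close>
  doubles the constant 288.\<close>

lemma osc_decay_half:
  assumes "1/16 \<le> a" "a \<le> b" "b \<le> 1" "T \<noteq> 0"
  shows "norm (osc a b X T) \<le> 576 / sqrt \<bar>T\<bar>"
proof -
  have "norm (osc a b X T) \<le> 288 / sqrt (\<bar>T\<bar> / 4)"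
    unfolding osc_eq_integral
  proof (rule cubic_piece)
    show "(\<forall>v\<in>{a..b}. \<bar>T\<bar> / 4 \<le> 6 * T * v) \<or> (\<forall>v\<in>{a..b}. \<bar>T\<bar> / 4 \<le> - (6 * T * v))"
    proof (cases "T > 0")
      case True
      have "T * (1/16) \<le> T * v" if "v \<in> {a..b}" for v
        using that assms True by (intro mult_left_mono) auto
      then show ?thesis using True by (intro disjI1) fastforce
    next
      case False
      have "T * v \<le> T * (1/16)" if "v \<in> {a..b}" for v
        using that assms False by (intro mult_left_mono_neg) auto
      then show ?thesis using False by (intro disjI2) fastforce
    qed
  qed (use assms in auto)
  also have "sqrt (\<bar>T\<bar> / 4) = sqrt \<bar>T\<bar> / 2" by (simp add: real_sqrt_divide)
  finally show ?thesis by simp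
qed

text \<open>The second derivative \<open>6Tv\<close> degenerates at \<open>v = 0\<close>. The part
  \<open>|v| \<le> \<delta>\<close> costs \<open>32 \<delta>\<close>, and on each side the bound is
  \<open>288 / sqrt (6|T| \<delta>)\<close>. Both have size \<open>\<delta>\<close> when
  \<open>|T| \<delta>^3 = 1\<close>, and \<open>608 = 288 + 32 + 288\<close>.\<close>

lemma osc_decay_full:
  assumes "T \<noteq> 0"
  shows "norm (osc (-1) 1 X T) \<le> 608 * \<bar>T\<bar> powr (- (1/3))"
proof (cases "\<bar>T\<bar> \<le> 1")
  case True
  have "norm (osc (-1) 1 X T) \<le> 608 * 1" using norm_osc_le[of "-1" 1 X T] by simp
  also have "1 \<le> \<bar>T\<bar> powr (- (1/3))"
    using True assms powr_mono2'[of "-(1/3)" "\<bar>T\<bar>" 1] by simp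
  finally show ?thesis by simp
next
  case False
  define \<delta> where "\<delta> = \<bar>T\<bar> powr (- (1/3))"
  have \<delta>: "\<delta> > 0" "\<delta> \<le> 1" using False assms powr_mono2'[of "-(1/3)" 1 "\<bar>T\<bar>"] by (auto simp: \<delta>_def)
  have T\<delta>: "\<bar>T\<bar> * \<delta> * \<delta>\<^sup>2 = 1"
  proof -
    have "\<delta> * \<delta>\<^sup>2 = \<delta> powr 3" using \<delta> by (simp add: power2_eq_square power3_eq_cube powr_numeral)
    also have "\<dots> = \<bar>T\<bar> powr (-1)" by (simp add: \<delta>_def powr_powr)
    finally show ?thesis using assms by (simp add: powr_minus mult.assoc)
  qed
  define f where "f = (\<lambda>v. cis (X * v + T * v ^ 3) * complex_of_real (((v - -1) * (1 - v))\<^sup>2))"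
  have int: "f integrable_on {-1..1}"
    unfolding f_def by (intro integrable_continuous_real continuous_intros)
  have sq: "sqrt (6 * \<bar>T\<bar> * \<delta>) \<ge> 1 / \<delta>"
  proof (rule real_le_rsqrt)
    have "(1 / \<delta>)\<^sup>2 = \<bar>T\<bar> * \<delta>" using T\<delta> \<delta> by (simp add: field_simps)
    then show "(1 / \<delta>)\<^sup>2 \<le> 6 * \<bar>T\<bar> * \<delta>" using \<delta> by (simp add: mult_nonneg_nonneg)
  qed
  have "288 / sqrt (6 * \<bar>T\<bar> * \<delta>) \<le> 288 / (1 / \<delta>)"
    using sq \<delta> assms by (intro divide_left_mono mult_pos_pos) (auto intro: less_le_trans[OF _ sq])
  then have sq': "288 / sqrt (6 * \<bar>T\<bar> * \<delta>) \<le> 288 * \<delta>" by simp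
  have R: "norm (integral {\<delta>..1} f) \<le> 288 * \<delta>"
  proof (rule order.trans[OF _ sq'], unfold f_def, rule cubic_piece)
    have "\<bar>T\<bar> * \<delta> \<le> \<bar>T\<bar> * v" if "v \<in> {\<delta>..1}" for v
      using that by (intro mult_left_mono) auto
    then show "(\<forall>v\<in>{\<delta>..1}. 6 * \<bar>T\<bar> * \<delta> \<le> 6 * T * v) \<or> (\<forall>v\<in>{\<delta>..1}. 6 * \<bar>T\<bar> * \<delta> \<le> - (6 * T * v))"
      by (cases "T > 0") auto
  qed (use \<delta> assms in auto)
  have L: "norm (integral {-1..-\<delta>} f) \<le> 288 * \<delta>"
  proof (rule order.trans[OF _ sq'], unfold f_def, rule cubic_piece)
    have "6 * \<bar>T\<bar> * \<delta> \<le> - (6 * \<bar>T\<bar> * v)" if "v \<in> {-1..-\<delta>}" for v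
    proof -
      have "6 * \<bar>T\<bar> * \<delta> \<le> 6 * \<bar>T\<bar> * (- v)"
        using that by (intro mult_left_mono) auto
      then show ?thesis by simp
    qed
    then show "(\<forall>v\<in>{-1..-\<delta>}. 6 * \<bar>T\<bar> * \<delta> \<le> 6 * T * v) \<or> (\<forall>v\<in>{-1..-\<delta>}. 6 * \<bar>T\<bar> * \<delta> \<le> - (6 * T * v))"
      by (cases "T > 0") (rule disjI2, simp, rule disjI1, simp)
  qed (use \<delta> assms in auto)
  have M: "norm (integral {-\<delta>..\<delta>} f) \<le> 16 * (\<delta> - - \<delta>)"
    unfolding f_def
  proof (rule norm_oscillatory_le)
    fix v assume "v \<in> {-\<delta>..\<delta>}"
    then show "\<bar>((v - -1) * (1 - v))\<^sup>2\<bar> \<le> 16" using \<delta> by (intro bump_poly_bounds) auto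
  qed (use \<delta> in \<open>auto intro!: continuous_intros\<close>)
  have "osc (-1) 1 X T = integral {-1..1} f" unfolding osc_eq_integral f_def by simp
  also have "\<dots> = integral {-1..-\<delta>} f + integral {-\<delta>..1} f"
    using \<delta> int by (intro Henstock_Kurzweil_Integration.integral_combine[symmetric]) auto
  also have "integral {-\<delta>..1} f = integral {-\<delta>..\<delta>} f + integral {\<delta>..1} f"
    using \<delta> integrable_subinterval_real[OF int, of "-\<delta>" 1]
    by (intro Henstock_Kurzweil_Integration.integral_combine[symmetric]) auto
  finally have "norm (osc (-1) 1 X T) \<le> norm (integral {-1..-\<delta>} f) +
      (norm (integral {-\<delta>..\<delta>} f) + norm (integral {\<delta>..1} f))"
    using norm_triangle_ineq[of "integral {-1..-\<delta>} f" "integral {-\<delta>..\<delta>} f + integral {\<delta>..1} f"]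
      norm_triangle_ineq[of "integral {-\<delta>..\<delta>} f" "integral {\<delta>..1} f"] by simp
  also have "\<dots> \<le> 608 * \<delta>" using L M R by simp
  finally show ?thesis unfolding \<delta>_def .
qed

text \<open>If \<open>|X| \<ge> 6|T|\<close>, the derivative \<open>D\<close> of the phase satisfies
  \<open>|D| \<ge> |X|/2\<close> on \<open>[-1, 1]\<close>. There is no stationary point, and each
  of two integrations by parts gains a factor of order \<open>1 / |X|\<close>.\<close>

lemma osc_tail:
  assumes ab: "-1 \<le> a" "a \<le> b" "b \<le> 1" and X: "6 * \<bar>T\<bar> \<le> \<bar>X\<bar>" "X \<noteq> 0"
  shows "norm (osc a b X T) \<le> 20000 / X\<^sup>2"
proof -
  define D where "D = (\<lambda>v. X + 3 * T * v\<^sup>2)"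
  define B where "B = (\<lambda>v. ((v - a) * (b - v))\<^sup>2)"
  define B1 where "B1 = (\<lambda>v. 2 * ((v - a) * (b - v)) * (a + b - 2 * v))"
  define B2 where "B2 = (\<lambda>v. 2 * (a + b - 2 * v)\<^sup>2 - 4 * ((v - a) * (b - v)))"
  have dD: "(D has_real_derivative 6 * T * v) (at v)" for v
    unfolding D_def by (auto intro!: derivative_eq_intros)
  have dB: "(B has_real_derivative B1 v) (at v)" "(B1 has_real_derivative B2 v) (at v)" for v
    unfolding B_def B1_def B2_def by (rule DERIV_bump_poly DERIV_bump_poly2)+
  have v2: "v\<^sup>2 \<le> 1" if "v \<in> {a..b}" for v
    using that ab by (auto simp: abs_square_le_1 abs_le_iff)
  have D: "\<bar>X\<bar> / 2 \<le> \<bar>D v\<bar>" "3 * \<bar>T\<bar> \<le> \<bar>D v\<bar>" "D v \<noteq> 0" if "v \<in> {a..b}" for v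
  proof -
    have "\<bar>T * v\<^sup>2\<bar> \<le> \<bar>T\<bar> * 1" unfolding abs_mult using v2[OF that] by (intro mult_left_mono) auto
    then have "\<bar>3 * T * v\<^sup>2\<bar> \<le> \<bar>X\<bar> / 2" using X(1) by (simp add: abs_mult)
    then show "\<bar>X\<bar> / 2 \<le> \<bar>D v\<bar>" unfolding D_def by linarith
    then show "3 * \<bar>T\<bar> \<le> \<bar>D v\<bar>" "D v \<noteq> 0" using X by auto
  qed
  define \<phi> where "\<phi> = (\<lambda>v. X * v + T * v ^ 3)"
  have d\<phi>: "(\<phi> has_real_derivative D v) (at v)" for v
    unfolding \<phi>_def D_def by (auto intro!: derivative_eq_intros)
  \<comment> \<open>\<open>g = (B / D)'\<close> and \<open>h = (g / D)'\<close> are the amplitudes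
    after one and after two integrations by parts.\<close>
  define g where "g = (\<lambda>v. B1 v / D v - 6 * T * v * B v / (D v)\<^sup>2)"
  define h where "h = (\<lambda>v. B2 v / (D v)\<^sup>2 - 18 * T * v * B1 v / (D v)^3 - 6 * T * B v / (D v)^3 + 108 * T\<^sup>2 * v\<^sup>2 * B v / (D v)^4)"
  have cD: "continuous_on {a..b} D" unfolding D_def by (intro continuous_intros)
  have c\<phi>: "continuous_on {a..b} \<phi>" unfolding \<phi>_def by (intro continuous_intros)
  have cB: "continuous_on {a..b} B" "continuous_on {a..b} B1" "continuous_on {a..b} B2"
    unfolding B_def B1_def B2_def by (intro continuous_intros)+
  have cg: "continuous_on {a..b} g" "continuous_on {a..b} h"
    unfolding g_def h_def by (intro continuous_intros cD cB; use D(3) in auto)+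
  have zero: "B a = 0" "B b = 0" "B1 a = 0" "B1 b = 0" by (auto simp: B_def B1_def)
  have "integral {a..b} (\<lambda>v. cis (\<phi> v) * of_real (B v)) =
     \<i> * integral {a..b} (\<lambda>v. cis (\<phi> v) * of_real (g v))
     - \<i> * (cis (\<phi> b) * of_real (B b / D b) - cis (\<phi> a) * of_real (B a / D a))"
  proof (rule oscillatory_by_parts[OF ab(2) d\<phi>])
    fix v assume v: "v \<in> {a..b}"
    show "((\<lambda>v. B v / D v) has_real_derivative g v) (at v)"
      unfolding g_def using D(3)[OF v]
      by (auto intro!: derivative_eq_intros dD dB simp: field_simps power2_eq_square)
    show "B v = D v * (B v / D v)" using D(3)[OF v] by simp
  qed (rule cD cg)+
  also have "\<dots> = \<i> * integral {a..b} (\<lambda>v. cis (\<phi> v) * of_real (g v))" by (simp add: zero)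
  also have "integral {a..b} (\<lambda>v. cis (\<phi> v) * of_real (g v)) =
     \<i> * integral {a..b} (\<lambda>v. cis (\<phi> v) * of_real (h v))
     - \<i> * (cis (\<phi> b) * of_real (g b / D b) - cis (\<phi> a) * of_real (g a / D a))"
  proof (rule oscillatory_by_parts[OF ab(2) d\<phi>])
    fix v assume v: "v \<in> {a..b}"
    have nz: "D v \<noteq> 0" "(D v)\<^sup>2 \<noteq> 0" using D(3)[OF v] by auto
    show "((\<lambda>v. g v / D v) has_real_derivative h v) (at v)"
      unfolding g_def h_def
      by (rule derivative_eq_intros dD dB refl nz)+
        (use nz in \<open>simp add: divide_simps\<close>, simp add: algebra_simps eval_nat_numeral)
    show "g v = D v * (g v / D v)" using D(3)[OF v] by simp
  qed (rule cD cg)+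
  also have "\<dots> = \<i> * integral {a..b} (\<lambda>v. cis (\<phi> v) * of_real (h v))" by (simp add: zero g_def)
  finally have eq: "norm (osc a b X T) = norm (integral {a..b} (\<lambda>v. cis (\<phi> v) * of_real (h v)))"
    unfolding osc_eq_integral B_def \<phi>_def by (simp add: norm_mult)
  have hb: "\<bar>h v\<bar> \<le> 10000 / X\<^sup>2" if v: "v \<in> {a..b}" for v
  proof -
    \<comment> \<open>Each power of \<open>T\<close> in \<open>h\<close> comes with an extra factor
      \<open>1 / D\<close>, so \<open>h\<close> is \<open>D^(-2)\<close> times an expression in the
      bounded quantity \<open>T / D\<close>. The terms add up to at most
      \<open>48 + 576 + 96 + 1728 \<le> 2500\<close>.\<close>
    define \<tau> where "\<tau> = T / D v"
    have \<tau>: "\<bar>\<tau>\<bar> \<le> 1" using D(2,3)[OF v] by (simp add: \<tau>_def divide_simps)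
    have v1: "\<bar>v\<bar> \<le> 1" using v ab by auto
    have bb: "\<bar>B v\<bar> \<le> 16" "\<bar>B1 v\<bar> \<le> 32" "\<bar>B2 v\<bar> \<le> 48"
      unfolding B_def B1_def B2_def using v by (intro bump_poly_bounds ab; simp)+
    have hv: "h v = (B2 v - 18 * (\<tau> * v) * B1 v - 6 * \<tau> * B v + 108 * (\<tau> * v)\<^sup>2 * B v) / (D v)\<^sup>2"
      unfolding h_def \<tau>_def using D(3)[OF v]
      by (simp add: divide_simps) (simp add: algebra_simps eval_nat_numeral)
    have tv: "\<bar>\<tau> * v\<bar> \<le> 1" unfolding abs_mult using \<tau> v1 by (intro mult_le_one) auto
    have "\<bar>\<tau> * v * B1 v\<bar> \<le> 1 * 32" unfolding abs_mult[of "\<tau> * v"] using tv bb by (intro mult_mono) auto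
    moreover have "\<bar>\<tau> * B v\<bar> \<le> 1 * 16" unfolding abs_mult using \<tau> bb by (intro mult_mono) auto
    moreover have "\<bar>(\<tau> * v)\<^sup>2 * B v\<bar> \<le> 1 * 16" unfolding abs_mult[of "_^2"]
      using tv bb by (intro mult_mono) (auto simp: abs_square_le_1)
    ultimately have num: "\<bar>B2 v - 18 * (\<tau> * v) * B1 v - 6 * \<tau> * B v + 108 * (\<tau> * v)\<^sup>2 * B v\<bar> \<le> 2500"
      using bb(3) by (simp add: abs_le_iff mult.assoc)
    have den: "X\<^sup>2 / 4 \<le> (D v)\<^sup>2"
      using D(1)[OF v] abs_le_square_iff[of "X/2" "D v"] by (simp add: power_divide)
    have "\<bar>h v\<bar> \<le> 2500 / (X\<^sup>2 / 4)"
      unfolding hv abs_divide using num den X(2) by (intro frac_le) auto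
    then show ?thesis by simp
  qed
  have "norm (integral {a..b} (\<lambda>v. cis (\<phi> v) * of_real (h v))) \<le> 10000 / X\<^sup>2 * (b - a)"
    by (intro norm_oscillatory_le ab c\<phi> cg hb)
  also have "\<dots> \<le> 10000 / X\<^sup>2 * 2" using ab by (intro mult_left_mono) auto
  finally show ?thesis unfolding eq by simp
qed

subsection \<open>The \<open>TT*\<close> argument\<close>

text \<open>Weighted AM-GM, normalised so that integration gives Young's inequality for the trilinear form
  with \<open>N = \<parallel>M\<parallel>\<^sub>p\<^sup>p\<close> and \<open>B = \<parallel>\<kappa>\<parallel>\<^bsub>p/2\<^esub>\<close>.\<close>

lemma young_pointwise:
  fixes p N B c k :: real
  assumes "p \<ge> 2" "N > 0" "B > 0" "c \<ge> 0" "k \<ge> 0"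
  shows "c powr (p - 1) * k \<le> B * N powr (2 - 2/p) *
    ((1 - 2/p) * (c powr p / N\<^sup>2) + (2/p) * (c powr (p/2) * k powr (p/2) / (N * B powr (p/2))))"
proof (cases "c = 0 \<or> k = 0")
  case True
  have "1 - 2/p \<ge> 0" using assms by simp
  then have "0 \<le> B * N powr (2 - 2/p) *
    ((1 - 2/p) * (c powr p / N\<^sup>2) + (2/p) * (c powr (p/2) * k powr (p/2) / (N * B powr (p/2))))"
    using assms by (intro mult_nonneg_nonneg add_nonneg_nonneg divide_nonneg_nonneg) auto
  moreover have "c powr (p - 1) * k = 0" using True by auto
  ultimately show ?thesis by (simp only:)
next
  case False
  then have ck: "c > 0" "k > 0" using assms by auto
  define A where "A = c powr p / N\<^sup>2"
  define S where "S = c powr (p/2) * k powr (p/2) / (N * B powr (p/2))"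
  have pos: "A > 0" "S > 0" using ck assms by (auto simp: A_def S_def)
  have "c powr (p - 1) * k = B * N powr (2 - 2/p) * (A powr (1 - 2/p) * S powr (2/p))"
  proof -
    have A: "A = exp (p * ln c - 2 * ln N)"
      using ck assms by (simp add: A_def exp_diff powr_def exp_double)
    have S: "S = exp (p/2 * ln c + p/2 * ln k - ln N - p/2 * ln B)"
      using ck assms by (simp add: S_def exp_diff powr_def exp_add)
    have "B * N powr (2 - 2/p) * (A powr (1 - 2/p) * S powr (2/p)) =
      exp (ln B + (2 - 2/p) * ln N + (1 - 2/p) * (p * ln c - 2 * ln N)
        + 2/p * (p/2 * ln c + p/2 * ln k - ln N - p/2 * ln B))"
      using assms unfolding A S by (simp add: powr_def exp_add)
    also have "ln B + (2 - 2/p) * ln N + (1 - 2/p) * (p * ln c - 2 * ln N)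
        + 2/p * (p/2 * ln c + p/2 * ln k - ln N - p/2 * ln B) = (p - 1) * ln c + ln k"
      using assms by (simp add: field_simps)
    also have "exp ((p - 1) * ln c + ln k) = c powr (p - 1) * k"
      using ck by (simp add: exp_add powr_def)
    finally show ?thesis by simp
  qed
  also have "A powr (1 - 2/p) * S powr (2/p) \<le> (1 - 2/p) * A + (2/p) * S"
    using assms pos by (intro Youngs_inequality_0) (auto simp: field_simps)
  finally show ?thesis
    using assms unfolding A_def S_def by (simp add: mult_left_mono)
qed

text \<open>AM-GM splits the mixed term \<open>(ab)^(p/2)\<close>, so that each summand containing
  \<open>k\<close> involves only one of \<open>a\<close>, \<open>b\<close>. In the application
  \<open>k\<close> depends on \<open>x - x'\<close>, and such a summand integrates by translation
  invariance.\<close>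

lemma young_pointwise2:
  fixes p N B a b k :: real
  assumes "p \<ge> 2" "N > 0" "B > 0" "a \<ge> 0" "b \<ge> 0" "k \<ge> 0"
  shows "a powr (p - 1) * b powr (p - 1) * k \<le> B * N powr (2 - 2/p) *
    ((1 - 2/p) * (a powr p * b powr p / N\<^sup>2) +
     (1/p) * (a powr p * k powr (p/2) / (N * B powr (p/2)) + b powr p * k powr (p/2) / (N * B powr (p/2))))"
proof -
  have "a powr (p - 1) * b powr (p - 1) * k \<le> B * N powr (2 - 2/p) *
    ((1 - 2/p) * ((a * b) powr p / N\<^sup>2) + (2/p) * ((a * b) powr (p/2) * k powr (p/2) / (N * B powr (p/2))))"
    using young_pointwise[of p N B "a * b" k] assms by (simp add: powr_mult)
  also have "(a * b) powr (p/2) \<le> (a powr p + b powr p) / 2"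
  proof -
    have "(a powr (p/2))\<^sup>2 = a powr p" "(b powr (p/2))\<^sup>2 = b powr p"
      by (simp_all add: power2_eq_square flip: powr_add)
    moreover have "0 \<le> (a powr (p/2) - b powr (p/2))\<^sup>2" by simp
    ultimately show ?thesis using assms by (simp add: powr_mult power2_diff)
  qed
  then have "(2/p) * ((a * b) powr (p/2) * k powr (p/2) / (N * B powr (p/2))) \<le>
     (2/p) * ((a powr p + b powr p) / 2 * k powr (p/2) / (N * B powr (p/2)))"
    using assms by (intro mult_left_mono divide_right_mono mult_right_mono) auto
  also have "\<dots> = (1/p) * (a powr p * k powr (p/2) / (N * B powr (p/2)) + b powr p * k powr (p/2) / (N * B powr (p/2)))"
    using assms by (simp add: field_simps)
  finally show ?thesis using assms by (simp add: mult_left_mono powr_mult)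
qed

text \<open>Young's inequality for two factors \<open>M^(p-1)\<close> in the dual of
  \<open>L^p\<close> and \<open>\<kappa>\<close> in \<open>L^(p/2)\<close>. It follows by
  integrating \<open>young_pointwise2\<close>: each of the three normalised double integrals is at
  most 1, and the weights \<open>1 - 2/p\<close>, \<open>1/p\<close>, \<open>1/p\<close> add up to
  1.\<close>

lemma young_convolution:
  fixes M \<kappa> :: "real \<Rightarrow> real"
  assumes p: "p \<ge> 2" and N: "N > 0" and B: "B > 0"
    and [measurable]: "M \<in> borel_measurable borel" "\<kappa> \<in> borel_measurable borel"
    and nn: "\<And>x. 0 \<le> M x" "\<And>x. 0 \<le> \<kappa> x"
    and MN: "(\<integral>\<^sup>+x. ennreal (M x powr p) \<partial>lborel) = ennreal N"
    and \<kappa>B: "(\<integral>\<^sup>+x. ennreal (\<kappa> x powr (p/2)) \<partial>lborel) \<le> ennreal (B powr (p/2))"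
  shows "(\<integral>\<^sup>+x. \<integral>\<^sup>+x'. ennreal (M x powr (p - 1) * M x' powr (p - 1) * \<kappa> (x - x')) \<partial>lborel \<partial>lborel)
    \<le> ennreal (B * N powr (2 - 2/p))"
proof -
  define Q where "Q = N * B powr (p/2)"
  have Q: "Q > 0" using N B by (simp add: Q_def)
  have \<kappa>sh: "(\<integral>\<^sup>+x'. ennreal (\<kappa> (x - x') powr (p/2)) \<partial>lborel) \<le> ennreal (B powr (p/2))" for x
    using nn_integral_real_affine[of "\<lambda>y. ennreal (\<kappa> y powr (p/2))" "-1" x] \<kappa>B by simp
  have \<kappa>sh': "(\<integral>\<^sup>+x. ennreal (\<kappa> (x - x') powr (p/2)) \<partial>lborel) \<le> ennreal (B powr (p/2))" for x'
    using nn_integral_real_affine[of "\<lambda>y. ennreal (\<kappa> y powr (p/2))" "1" "-x'"] \<kappa>B by (simp add: algebra_simps)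
  have I1: "(\<integral>\<^sup>+x. \<integral>\<^sup>+x'. ennreal (M x powr p * M x' powr p / N\<^sup>2) \<partial>lborel \<partial>lborel) = 1"
  proof -
    have "(\<integral>\<^sup>+x. \<integral>\<^sup>+x'. ennreal (M x powr p * M x' powr p / N\<^sup>2) \<partial>lborel \<partial>lborel) =
      (\<integral>\<^sup>+x. \<integral>\<^sup>+x'. ennreal (M x powr p) * (ennreal (1 / N\<^sup>2) * ennreal (M x' powr p)) \<partial>lborel \<partial>lborel)"
      by (intro nn_integral_cong) (simp flip: ennreal_mult add: field_simps)
    also have "\<dots> = ennreal N * (ennreal (1 / N\<^sup>2) * ennreal N)"
      by (simp add: nn_integral_cmult nn_integral_multc MN)
    also have "\<dots> = 1" using N by (simp flip: ennreal_mult add: power2_eq_square)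
    finally show ?thesis .
  qed
  have I2: "(\<integral>\<^sup>+x. \<integral>\<^sup>+x'. ennreal (M x powr p * \<kappa> (x - x') powr (p/2) / Q) \<partial>lborel \<partial>lborel) \<le> 1"
  proof -
    have "(\<integral>\<^sup>+x. \<integral>\<^sup>+x'. ennreal (M x powr p * \<kappa> (x - x') powr (p/2) / Q) \<partial>lborel \<partial>lborel) =
      (\<integral>\<^sup>+x. \<integral>\<^sup>+x'. ennreal (M x powr p) * (ennreal (1 / Q) * ennreal (\<kappa> (x - x') powr (p/2))) \<partial>lborel \<partial>lborel)"
      using Q by (intro nn_integral_cong) (simp flip: ennreal_mult add: field_simps)
    also have "\<dots> = (\<integral>\<^sup>+x. ennreal (M x powr p) * (ennreal (1 / Q) * (\<integral>\<^sup>+x'. ennreal (\<kappa> (x - x') powr (p/2)) \<partial>lborel)) \<partial>lborel)"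
      by (simp add: nn_integral_cmult)
    also have "\<dots> \<le> (\<integral>\<^sup>+x. ennreal (M x powr p) * (ennreal (1 / Q) * ennreal (B powr (p/2))) \<partial>lborel)"
      by (intro nn_integral_mono mult_left_mono \<kappa>sh) auto
    also have "\<dots> = ennreal N * (ennreal (1 / Q) * ennreal (B powr (p/2)))"
      by (simp add: nn_integral_multc MN)
    also have "\<dots> = 1" using N B by (simp flip: ennreal_mult add: Q_def)
    finally show ?thesis .
  qed
  have I3: "(\<integral>\<^sup>+x. \<integral>\<^sup>+x'. ennreal (M x' powr p * \<kappa> (x - x') powr (p/2) / Q) \<partial>lborel \<partial>lborel) \<le> 1"
  proof -
    have "(\<integral>\<^sup>+x. \<integral>\<^sup>+x'. ennreal (M x' powr p * \<kappa> (x - x') powr (p/2) / Q) \<partial>lborel \<partial>lborel) =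
      (\<integral>\<^sup>+x'. \<integral>\<^sup>+x. ennreal (M x' powr p * \<kappa> (x - x') powr (p/2) / Q) \<partial>lborel \<partial>lborel)"
      by (rule lborel_pair.Fubini') simp
    also have "\<dots> =
      (\<integral>\<^sup>+x'. \<integral>\<^sup>+x. ennreal (M x' powr p) * (ennreal (1 / Q) * ennreal (\<kappa> (x - x') powr (p/2))) \<partial>lborel \<partial>lborel)"
      using Q by (intro nn_integral_cong) (simp flip: ennreal_mult add: field_simps)
    also have "\<dots> = (\<integral>\<^sup>+x'. ennreal (M x' powr p) * (ennreal (1 / Q) * (\<integral>\<^sup>+x. ennreal (\<kappa> (x - x') powr (p/2)) \<partial>lborel)) \<partial>lborel)"
      by (simp add: nn_integral_cmult)
    also have "\<dots> \<le> (\<integral>\<^sup>+x'. ennreal (M x' powr p) * (ennreal (1 / Q) * ennreal (B powr (p/2))) \<partial>lborel)"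
      by (intro nn_integral_mono mult_left_mono \<kappa>sh') auto
    also have "\<dots> = ennreal N * (ennreal (1 / Q) * ennreal (B powr (p/2)))"
      by (simp add: nn_integral_multc MN)
    also have "\<dots> = 1" using N B by (simp flip: ennreal_mult add: Q_def)
    finally show ?thesis .
  qed
  have "(\<integral>\<^sup>+x. \<integral>\<^sup>+x'. ennreal (M x powr (p - 1) * M x' powr (p - 1) * \<kappa> (x - x')) \<partial>lborel \<partial>lborel) \<le>
    (\<integral>\<^sup>+x. \<integral>\<^sup>+x'. ennreal (B * N powr (2 - 2/p)) *
      (ennreal (1 - 2/p) * ennreal (M x powr p * M x' powr p / N\<^sup>2) +
       ennreal (1/p) * (ennreal (M x powr p * \<kappa> (x - x') powr (p/2) / Q) +
         ennreal (M x' powr p * \<kappa> (x - x') powr (p/2) / Q))) \<partial>lborel \<partial>lborel)"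
  proof (intro nn_integral_mono)
    fix x x'
    have dist: "ennreal (K * (u * a + v * (b + c))) =
        ennreal K * (ennreal u * ennreal a + ennreal v * (ennreal b + ennreal c))"
      if "K \<ge> 0" "u \<ge> 0" "a \<ge> 0" "v \<ge> 0" "b \<ge> 0" "c \<ge> 0" for K u a v b c :: real
      using that by (simp add: ennreal_mult ennreal_plus)
    have "ennreal (M x powr (p - 1) * M x' powr (p - 1) * \<kappa> (x - x')) \<le>
      ennreal (B * N powr (2 - 2/p) * ((1 - 2/p) * (M x powr p * M x' powr p / N\<^sup>2) +
       (1/p) * (M x powr p * \<kappa> (x - x') powr (p/2) / Q + M x' powr p * \<kappa> (x - x') powr (p/2) / Q)))"
      unfolding Q_def by (intro ennreal_leI young_pointwise2 p N B nn)
    also have "\<dots> = ennreal (B * N powr (2 - 2/p)) *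
      (ennreal (1 - 2/p) * ennreal (M x powr p * M x' powr p / N\<^sup>2) +
       ennreal (1/p) * (ennreal (M x powr p * \<kappa> (x - x') powr (p/2) / Q) +
         ennreal (M x' powr p * \<kappa> (x - x') powr (p/2) / Q)))"
      using p N B Q by (intro dist) auto
    finally show "ennreal (M x powr (p - 1) * M x' powr (p - 1) * \<kappa> (x - x')) \<le> \<dots>" .
  qed
  also have "\<dots> = ennreal (B * N powr (2 - 2/p)) *
      (ennreal (1 - 2/p) * (\<integral>\<^sup>+x. \<integral>\<^sup>+x'. ennreal (M x powr p * M x' powr p / N\<^sup>2) \<partial>lborel \<partial>lborel) +
       ennreal (1/p) * ((\<integral>\<^sup>+x. \<integral>\<^sup>+x'. ennreal (M x powr p * \<kappa> (x - x') powr (p/2) / Q) \<partial>lborel \<partial>lborel) +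
         (\<integral>\<^sup>+x. \<integral>\<^sup>+x'. ennreal (M x' powr p * \<kappa> (x - x') powr (p/2) / Q) \<partial>lborel \<partial>lborel)))"
    by (simp add: nn_integral_cmult nn_integral_add)
  also have "\<dots> \<le> ennreal (B * N powr (2 - 2/p)) * (ennreal (1 - 2/p) * 1 + ennreal (1/p) * (1 + 1))"
    by (intro mult_left_mono add_mono I2 I3) (auto simp: I1)
  also have "ennreal (1 - 2/p) * 1 + ennreal (1/p) * (1 + 1) = ennreal ((1 - 2/p) + (1/p + 1/p))"
    using p by (simp add: distrib_left del: one_add_one flip: ennreal_plus)
  also have "(1 - 2/p) + (1/p + 1/p) = 1" using p by (simp add: field_simps)
  finally show ?thesis by simp
qed

text \<open>The group acting on a frequency profile, without the Fourier constant. It serves twice: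
  for \<open>fourier u\<close> it is the solution, for a weight it is the convolution kernel of the
  \<open>TT*\<close> argument. Packing \<open>(y, t)\<close> into one argument suits the
  linearisation, where both depend on \<open>x\<close>.\<close>

definition evol :: "(real \<times> 'y::euclidean_space \<Rightarrow> complex) \<Rightarrow> real \<Rightarrow> 'y \<times> real \<Rightarrow> complex" where
  "evol f x z = (LINT \<zeta>|lborel. cis ((x, fst z) \<bullet> \<zeta> + snd z * dispersion \<zeta>) * f \<zeta>)"

lemma dispersion_eq: "dispersion \<zeta> = fst \<zeta> * ((fst \<zeta>)\<^sup>2 + (norm (snd \<zeta>))\<^sup>2)"
  by (simp add: dispersion_def split: prod.split)

lemma continuous_on_dispersion [continuous_intros]:
  "continuous_on S f \<Longrightarrow> continuous_on S (\<lambda>x. dispersion (f x))"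
  unfolding dispersion_eq by (intro continuous_intros)

lemma borel_measurable_dispersion [measurable]: "dispersion \<in> borel_measurable borel"
  by (intro borel_measurable_continuous_onI continuous_on_dispersion continuous_on_id)

lemma borel_measurable_cis [measurable]: "cis \<in> borel_measurable borel"
  by (intro borel_measurable_continuous_onI continuous_intros)

lemma integrable_cis_mult:
  fixes f :: "'a::euclidean_space \<Rightarrow> complex"
  assumes "integrable lborel f" and [measurable]: "\<phi> \<in> borel_measurable borel"
  shows "integrable lborel (\<lambda>\<zeta>. cis (\<phi> \<zeta>) * f \<zeta>)"
  using assms(1) by (rule Bochner_Integration.integrable_bound) (use assms in \<open>auto simp: norm_mult\<close>)

text \<open>Fubini for a kernel of modulus one, where absolute convergence only involves
  \<open>|g| |k|\<close>. It expresses the duality between \<open>evol\<close> along a measurable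
  choice of \<open>(y, t)\<close> and the transposed operator.\<close>

lemma integral_phase_swap:
  fixes g :: "'a::euclidean_space \<Rightarrow> complex" and k :: "'b::euclidean_space \<Rightarrow> complex"
  assumes g: "integrable lborel g" and k: "integrable lborel k"
    and \<phi>[measurable]: "(\<lambda>(x, \<zeta>). \<phi> x \<zeta>) \<in> borel_measurable (borel \<Otimes>\<^sub>M borel)"
  shows "(LINT x|lborel. g x * (LINT \<zeta>|lborel. cis (\<phi> x \<zeta>) * k \<zeta>)) =
    (LINT \<zeta>|lborel. k \<zeta> * (LINT x|lborel. cis (\<phi> x \<zeta>) * g x))"
proof -
  have [measurable]: "g \<in> borel_measurable borel" "k \<in> borel_measurable borel"
    using g k by auto
  have [measurable]: "(\<lambda>\<zeta>. \<phi> x \<zeta>) \<in> borel_measurable borel" for x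
    using measurable_compose_Pair1[OF _ \<phi>, of x] by simp
  have int: "integrable (lborel \<Otimes>\<^sub>M lborel) (\<lambda>(x, \<zeta>). g x * (cis (\<phi> x \<zeta>) * k \<zeta>))"
  proof (rule lborel_pair.Fubini_integrable)
    have "integrable lborel (\<lambda>x. norm (g x) * (LINT \<zeta>|lborel. norm (k \<zeta>)))"
      using g by auto
    then show "integrable lborel (\<lambda>x. LINT \<zeta>|lborel. norm (case (x, \<zeta>) of (x, \<zeta>) \<Rightarrow> g x * (cis (\<phi> x \<zeta>) * k \<zeta>)))"
      by (simp add: norm_mult)
    show "AE x in lborel. integrable lborel (\<lambda>\<zeta>. case (x, \<zeta>) of (x, \<zeta>) \<Rightarrow> g x * (cis (\<phi> x \<zeta>) * k \<zeta>))"
      using k by (auto intro!: AE_I2 integrable_cis_mult)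
  qed simp
  have "(LINT x|lborel. g x * (LINT \<zeta>|lborel. cis (\<phi> x \<zeta>) * k \<zeta>)) =
    (LINT x|lborel. (LINT \<zeta>|lborel. g x * (cis (\<phi> x \<zeta>) * k \<zeta>)))" by simp
  also have "\<dots> = (LINT \<zeta>|lborel. (LINT x|lborel. g x * (cis (\<phi> x \<zeta>) * k \<zeta>)))"
    by (rule lborel_pair.Fubini_integral[OF int, symmetric])
  also have "\<dots> = (LINT \<zeta>|lborel. k \<zeta> * (LINT x|lborel. cis (\<phi> x \<zeta>) * g x))"
    by (simp add: mult_ac flip: integral_mult_right_zero)
  finally show ?thesis .
qed

lemma norm_LINT_le_nn:
  fixes f :: "'a \<Rightarrow> complex"
  shows "ennreal (norm (integral\<^sup>L M f)) \<le> (\<integral>\<^sup>+x. ennreal (norm (f x)) \<partial>M)"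
  by (cases "integrable M f") (auto simp: not_integrable_integral_eq integral_norm_bound_ennreal)

text \<open>Dominated convergence with majorant \<open>|f|\<close>. Continuity in all variables
  makes \<open>evol\<close> measurable along a measurable \<open>\<sigma>\<close> and lets the
  supremum be taken over a countable dense set.\<close>

lemma continuous_evol:
  fixes f :: "real \<times> 'y::euclidean_space \<Rightarrow> complex"
  assumes f: "integrable lborel f"
  shows "continuous_on UNIV (\<lambda>(x, z). evol f x z)"
proof (rule continuous_on_sequentiallyI)
  fix u :: "nat \<Rightarrow> real \<times> 'y \<times> real" and a
  assume u: "u \<longlonglongrightarrow> a"
  have [measurable]: "f \<in> borel_measurable borel" using f by auto
  have "(\<lambda>n. LINT \<zeta>|lborel. cis ((fst (u n), fst (snd (u n))) \<bullet> \<zeta> + snd (snd (u n)) * dispersion \<zeta>) * f \<zeta>)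
    \<longlonglongrightarrow> (LINT \<zeta>|lborel. cis ((fst a, fst (snd a)) \<bullet> \<zeta> + snd (snd a) * dispersion \<zeta>) * f \<zeta>)"
  proof (rule integral_dominated_convergence[where w="\<lambda>\<zeta>. norm (f \<zeta>)"])
    show "AE \<zeta> in lborel. (\<lambda>n. cis ((fst (u n), fst (snd (u n))) \<bullet> \<zeta> + snd (snd (u n)) * dispersion \<zeta>) * f \<zeta>)
      \<longlonglongrightarrow> cis ((fst a, fst (snd a)) \<bullet> \<zeta> + snd (snd a) * dispersion \<zeta>) * f \<zeta>"
    proof (rule AE_I2)
      fix \<zeta> :: "real \<times> 'y"
      have "continuous_on UNIV (\<lambda>a. cis ((fst a, fst (snd a)) \<bullet> \<zeta> + snd (snd a) * dispersion \<zeta>) * f \<zeta>)"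
        by (intro continuous_intros)
      from continuous_on_tendsto_compose[OF this u]
      show "(\<lambda>n. cis ((fst (u n), fst (snd (u n))) \<bullet> \<zeta> + snd (snd (u n)) * dispersion \<zeta>) * f \<zeta>)
        \<longlonglongrightarrow> cis ((fst a, fst (snd a)) \<bullet> \<zeta> + snd (snd a) * dispersion \<zeta>) * f \<zeta>" by simp
    qed
  qed (use f in \<open>auto simp: norm_mult\<close>)
  then show "(\<lambda>n. case u n of (x, z) \<Rightarrow> evol f x z) \<longlonglongrightarrow> (case a of (x, z) \<Rightarrow> evol f x z)"
    by (simp add: evol_def split_beta)
qed

lemma borel_measurable_evol [measurable]:
  fixes f :: "real \<times> 'y::euclidean_space \<Rightarrow> complex"
  assumes f: "integrable lborel f" and [measurable]: "a \<in> borel_measurable M" "\<sigma> \<in> borel_measurable M"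
  shows "(\<lambda>x. evol f (a x) (\<sigma> x)) \<in> borel_measurable M"
proof -
  have [measurable]: "(\<lambda>(x, z). evol f x z) \<in> borel_measurable borel"
    by (rule borel_measurable_continuous_onI[OF continuous_evol[OF f]])
  have "(\<lambda>x. (a x, \<sigma> x)) \<in> measurable M borel" by simp
  from measurable_compose[OF this \<open>(\<lambda>(x, z). evol f x z) \<in> borel_measurable borel\<close>]
  show ?thesis by simp
qed

lemma norm_evol_le: "norm (evol f x z) \<le> (LINT \<zeta>|lborel. norm (f \<zeta>))"
proof -
  have "norm (evol f x z) \<le> (LINT \<zeta>|lborel. norm (cis ((x, fst z) \<bullet> \<zeta> + snd z * dispersion \<zeta>) * f \<zeta>))"
    unfolding evol_def by (rule integral_norm_bound)
  then show ?thesis by (simp add: norm_mult)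
qed

lemma borel_measurable_cnj [measurable]: "cnj \<in> borel_measurable borel"
  by (intro borel_measurable_continuous_onI continuous_intros)

lemma borel_measurable_phase:
  fixes \<sigma> :: "real \<Rightarrow> 'y::euclidean_space \<times> real"
  assumes [measurable]: "\<sigma> \<in> borel_measurable borel"
  shows "(\<lambda>(x, \<zeta>). (x, fst (\<sigma> x)) \<bullet> \<zeta> + snd (\<sigma> x) * dispersion \<zeta>) \<in> borel_measurable (borel \<Otimes>\<^sub>M borel)"
proof -
  let ?\<Phi> = "\<lambda>q :: real \<times> ('y \<times> real) \<times> (real \<times> 'y).
    (fst q, fst (fst (snd q))) \<bullet> snd (snd q) + snd (fst (snd q)) * dispersion (snd (snd q))"
  have "?\<Phi> \<in> borel_measurable borel"
    by (intro borel_measurable_continuous_onI continuous_intros)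
  moreover have "(\<lambda>p :: real \<times> (real \<times> 'y). (fst p, \<sigma> (fst p), snd p)) \<in> measurable (borel \<Otimes>\<^sub>M borel) borel"
    by (intro borel_measurable_Pair) measurable
  ultimately have "(\<lambda>p. ?\<Phi> (fst p, \<sigma> (fst p), snd p)) \<in> borel_measurable (borel \<Otimes>\<^sub>M borel)"
    by (rule measurable_compose[rotated])
  then show ?thesis by (simp add: split_beta)
qed

lemma borel_measurable_phase_integral:
  fixes g :: "'a::euclidean_space \<Rightarrow> complex" and \<phi> :: "'a \<Rightarrow> 'b::euclidean_space \<Rightarrow> real"
  assumes \<phi>: "(\<lambda>(x, \<zeta>). \<phi> x \<zeta>) \<in> borel_measurable (borel \<Otimes>\<^sub>M borel)" and [measurable]: "g \<in> borel_measurable borel"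
  shows "(\<lambda>\<zeta>. LINT x|lborel. cis (\<phi> x \<zeta>) * g x) \<in> borel_measurable borel"
proof (rule lborel.borel_measurable_lebesgue_integral)
  have "(\<lambda>(\<zeta>, x). (\<lambda>(x, \<zeta>). \<phi> x \<zeta>) (x, \<zeta>)) \<in> borel_measurable (borel \<Otimes>\<^sub>M borel)"
    by (rule measurable_pair_swap[OF \<phi>])
  then have [measurable]: "(\<lambda>(\<zeta>, x). \<phi> x \<zeta>) \<in> borel_measurable (borel \<Otimes>\<^sub>M lborel)" by simp
  show "(\<lambda>(\<zeta>, x). cis (\<phi> x \<zeta>) * g x) \<in> borel_measurable (borel \<Otimes>\<^sub>M lborel)"
    by measurable
qed

text \<open>\<open>G\<close> is the transpose of the linearised operator applied to
  \<open>g\<close>. Expanding \<open>|G|^2\<close> turns the left side into a double integral of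
  \<open>g x * cnj (g x')\<close> against the kernel of \<open>w\<close> at
  \<open>(x - x', \<sigma> x - \<sigma> x')\<close>. Both times lie in \<open>[0, 1]\<close>, so
  their difference is at most 1 in size, the range where \<open>ker\<close> bounds the kernel by
  \<open>\<kappa> (x - x')\<close> uniformly in \<open>y\<close>.\<close>

lemma TT_star_kernel:
  fixes w :: "real \<times> 'y::euclidean_space \<Rightarrow> real" and g :: "real \<Rightarrow> complex"
    and \<sigma> :: "real \<Rightarrow> 'y \<times> real"
  assumes w: "integrable lborel w" "\<And>\<zeta>. 0 \<le> w \<zeta>"
    and g: "integrable lborel g" and \<sigma>[measurable]: "\<sigma> \<in> borel_measurable borel"
    and \<sigma>01: "\<And>x. snd (\<sigma> x) \<in> {0..1}"
    and [measurable]: "\<kappa> \<in> borel_measurable borel"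
    and ker: "\<And>x y t. \<bar>t\<bar> \<le> 1 \<Longrightarrow> norm (evol (\<lambda>\<zeta>. of_real (w \<zeta>)) x (y, t)) \<le> \<kappa> x"
  defines "G \<equiv> \<lambda>\<zeta>. LINT x|lborel. cis ((x, fst (\<sigma> x)) \<bullet> \<zeta> + snd (\<sigma> x) * dispersion \<zeta>) * g x"
  shows "(\<integral>\<^sup>+\<zeta>. ennreal (w \<zeta> * (norm (G \<zeta>))\<^sup>2) \<partial>lborel) \<le>
    (\<integral>\<^sup>+x. \<integral>\<^sup>+x'. ennreal (norm (g x) * norm (g x') * \<kappa> (x - x')) \<partial>lborel \<partial>lborel)"
proof -
  define \<phi> where "\<phi> = (\<lambda>x \<zeta>. (x, fst (\<sigma> x)) \<bullet> \<zeta> + snd (\<sigma> x) * dispersion \<zeta>)"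
  have [measurable]: "w \<in> borel_measurable borel" "g \<in> borel_measurable borel"
    using w g by auto
  have \<phi>[measurable]: "(\<lambda>(x, \<zeta>). \<phi> x \<zeta>) \<in> borel_measurable (borel \<Otimes>\<^sub>M borel)"
    unfolding \<phi>_def by (rule borel_measurable_phase[OF \<sigma>])
  have \<phi>1[measurable]: "(\<lambda>\<zeta>. \<phi> x \<zeta>) \<in> borel_measurable borel" for x
    using measurable_compose_Pair1[OF _ \<phi>, of x] by simp
  have \<phi>2[measurable]: "(\<lambda>x. \<phi> x \<zeta>) \<in> borel_measurable borel" for \<zeta>
  proof -
    have "(\<lambda>x. (x, \<zeta>)) \<in> measurable borel (borel \<Otimes>\<^sub>M borel)" by simp
    from measurable_compose[OF this \<phi>] show ?thesis by simp
  qed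
  have G: "G = (\<lambda>\<zeta>. LINT x|lborel. cis (\<phi> x \<zeta>) * g x)"
    by (simp add: G_def \<phi>_def)
  have [measurable]: "G \<in> borel_measurable borel"
    unfolding G by (rule borel_measurable_phase_integral[OF \<phi>]) simp
  define CG where "CG = (LINT x|lborel. norm (g x))"
  have Gb: "norm (G \<zeta>) \<le> CG" for \<zeta>
  proof -
    have "norm (G \<zeta>) \<le> (LINT x|lborel. norm (cis (\<phi> x \<zeta>) * g x))"
      unfolding G by (rule integral_norm_bound)
    then show ?thesis by (simp add: norm_mult CG_def)
  qed
  have wG: "integrable lborel (\<lambda>\<zeta>. of_real (w \<zeta>) * h \<zeta>)"
    if [measurable]: "h \<in> borel_measurable borel" and h: "\<And>\<zeta>. norm (h \<zeta>) \<le> K" for h :: "_ \<Rightarrow> complex" and K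
  proof (rule Bochner_Integration.integrable_bound)
    show "integrable lborel (\<lambda>\<zeta>. K * w \<zeta>)" using w by simp
    have "norm (complex_of_real (w \<zeta>) * h \<zeta>) \<le> norm (K * w \<zeta>)" for \<zeta>
      using h[of \<zeta>] w(2)[of \<zeta>] order_trans[OF norm_ge_zero h[of \<zeta>]]
      by (simp add: norm_mult mult.commute[of K] mult_left_mono)
    then show "AE \<zeta> in lborel. norm (complex_of_real (w \<zeta>) * h \<zeta>) \<le> norm (K * w \<zeta>)" by simp
  qed simp
  have iw2: "integrable lborel (\<lambda>\<zeta>. w \<zeta> * (norm (G \<zeta>))\<^sup>2)"
  proof -
    have "integrable lborel (\<lambda>\<zeta>. Re (of_real (w \<zeta>) * (of_real ((norm (G \<zeta>))\<^sup>2))))"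
      using power_mono[OF Gb, of _ 2] by (intro integrable_Re wG[where K="CG\<^sup>2"]) (auto simp: norm_power)
    then show ?thesis by simp
  qed
  have k1: "integrable lborel (\<lambda>\<zeta>. of_real (w \<zeta>) * cnj (G \<zeta>))"
    by (rule wG[where K=CG]) (use Gb in auto)
  \<comment> \<open>Pairing \<open>g\<close> with \<open>H\<close> gives the quadratic form; a
    second interchange of integrals then writes \<open>H\<close> as an integral of
    \<open>cnj (g x')\<close> against the kernel.\<close>
  define H where "H = (\<lambda>x. LINT \<zeta>|lborel. cis (\<phi> x \<zeta>) * (of_real (w \<zeta>) * cnj (G \<zeta>)))"
  have step1: "complex_of_real (LINT \<zeta>|lborel. w \<zeta> * (norm (G \<zeta>))\<^sup>2) = (LINT x|lborel. g x * H x)"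
  proof -
    have "(LINT x|lborel. g x * H x) =
      (LINT \<zeta>|lborel. (of_real (w \<zeta>) * cnj (G \<zeta>)) * (LINT x|lborel. cis (\<phi> x \<zeta>) * g x))"
      unfolding H_def by (rule integral_phase_swap[OF g k1 \<phi>])
    also have "\<dots> = (LINT \<zeta>|lborel. (of_real (w \<zeta>) * cnj (G \<zeta>)) * G \<zeta>)"
      by (simp only: G)
    also have "\<dots> = (LINT \<zeta>|lborel. complex_of_real (w \<zeta> * (norm (G \<zeta>))\<^sup>2))"
      by (rule Bochner_Integration.integral_cong) (simp_all only: of_real_mult complex_norm_square mult_ac)
    finally show ?thesis by (simp only: integral_complex_of_real)
  qed
  have step2: "H x = (LINT x'|lborel. cnj (g x') * evol (\<lambda>\<zeta>. of_real (w \<zeta>)) (x - x') (\<sigma> x - \<sigma> x'))" for x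
  proof -
    have k2: "integrable lborel (\<lambda>\<zeta>. of_real (w \<zeta>) * cis (\<phi> x \<zeta>))"
      by (rule wG[where K=1]) auto
    have "(LINT x'|lborel. cnj (g x') * (LINT \<zeta>|lborel. cis (- \<phi> x' \<zeta>) * (of_real (w \<zeta>) * cis (\<phi> x \<zeta>)))) =
      (LINT \<zeta>|lborel. of_real (w \<zeta>) * cis (\<phi> x \<zeta>) * (LINT x'|lborel. cis (- \<phi> x' \<zeta>) * cnj (g x')))"
      by (rule integral_phase_swap[OF _ k2]) (use g in auto)
    also have "\<dots> = H x"
      unfolding H_def G by (rule Bochner_Integration.integral_cong)
        (simp_all add: cis_cnj mult_ac flip: Bochner_Integration.integral_cnj)
    finally have e1: "H x = (LINT x'|lborel. cnj (g x') * (LINT \<zeta>|lborel. cis (- \<phi> x' \<zeta>) * (of_real (w \<zeta>) * cis (\<phi> x \<zeta>))))" ..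
    have e2: "(LINT \<zeta>|lborel. cis (- \<phi> x' \<zeta>) * (of_real (w \<zeta>) * cis (\<phi> x \<zeta>))) =
       evol (\<lambda>\<zeta>. of_real (w \<zeta>)) (x - x') (\<sigma> x - \<sigma> x')" for x'
    proof -
      have "cis (- \<phi> x' \<zeta>) * (of_real (w \<zeta>) * cis (\<phi> x \<zeta>)) =
        cis ((x - x', fst (\<sigma> x - \<sigma> x')) \<bullet> \<zeta> + snd (\<sigma> x - \<sigma> x') * dispersion \<zeta>) * of_real (w \<zeta>)" for \<zeta>
      proof -
        have "cis (- \<phi> x' \<zeta>) * (of_real (w \<zeta>) * cis (\<phi> x \<zeta>)) = cis (- \<phi> x' \<zeta> + \<phi> x \<zeta>) * of_real (w \<zeta>)"
          by (simp add: mult_ac cis_mult)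
        also have "- \<phi> x' \<zeta> + \<phi> x \<zeta> = (x - x', fst (\<sigma> x - \<sigma> x')) \<bullet> \<zeta> + snd (\<sigma> x - \<sigma> x') * dispersion \<zeta>"
          by (simp add: \<phi>_def inner_prod_def algebra_simps)
        finally show ?thesis .
      qed
      then show ?thesis unfolding evol_def by (simp only:)
    qed
    show ?thesis using e1 by (simp only: e2)
  qed
  have Hb: "ennreal (norm (H x)) \<le> (\<integral>\<^sup>+x'. ennreal (norm (g x') * \<kappa> (x - x')) \<partial>lborel)" for x
    unfolding step2
  proof (rule order.trans[OF norm_LINT_le_nn nn_integral_mono])
    fix x'
    have "norm (evol (\<lambda>\<zeta>. of_real (w \<zeta>)) (x - x') (\<sigma> x - \<sigma> x')) \<le> \<kappa> (x - x')"
    proof -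
      have "\<bar>snd (\<sigma> x - \<sigma> x')\<bar> \<le> 1" using \<sigma>01[of x] \<sigma>01[of x'] by (auto simp: abs_le_iff)
      from ker[OF this, of "x - x'" "fst (\<sigma> x - \<sigma> x')"] show ?thesis by (simp only: prod.collapse)
    qed
    then show "ennreal (norm (cnj (g x') * evol (\<lambda>\<zeta>. of_real (w \<zeta>)) (x - x') (\<sigma> x - \<sigma> x')))
      \<le> ennreal (norm (g x') * \<kappa> (x - x'))"
      by (auto simp: norm_mult intro!: ennreal_leI mult_left_mono)
  qed
  have "(\<integral>\<^sup>+\<zeta>. ennreal (w \<zeta> * (norm (G \<zeta>))\<^sup>2) \<partial>lborel) = ennreal (LINT \<zeta>|lborel. w \<zeta> * (norm (G \<zeta>))\<^sup>2)"
    by (rule nn_integral_eq_integral[OF iw2]) (simp add: w)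
  also have "\<dots> \<le> ennreal (norm (complex_of_real (LINT \<zeta>|lborel. w \<zeta> * (norm (G \<zeta>))\<^sup>2)))"
    by (simp add: ennreal_leI)
  also have "\<dots> = ennreal (norm (LINT x|lborel. g x * H x))" unfolding step1 ..
  also have "\<dots> \<le> (\<integral>\<^sup>+x. ennreal (norm (g x * H x)) \<partial>lborel)" by (rule norm_LINT_le_nn)
  also have "\<dots> \<le> (\<integral>\<^sup>+x. \<integral>\<^sup>+x'. ennreal (norm (g x) * norm (g x') * \<kappa> (x - x')) \<partial>lborel \<partial>lborel)"
  proof (rule nn_integral_mono)
    fix x
    have "ennreal (norm (g x * H x)) \<le> ennreal (norm (g x)) * (\<integral>\<^sup>+x'. ennreal (norm (g x') * \<kappa> (x - x')) \<partial>lborel)"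
      by (simp add: norm_mult ennreal_mult mult_left_mono Hb)
    also have "\<dots> \<le> (\<integral>\<^sup>+x'. ennreal (norm (g x)) * ennreal (norm (g x') * \<kappa> (x - x')) \<partial>lborel)"
      by (simp add: nn_integral_cmult)
    finally show "ennreal (norm (g x * H x)) \<le> (\<integral>\<^sup>+x'. ennreal (norm (g x) * norm (g x') * \<kappa> (x - x')) \<partial>lborel)"
      by (simp add: ennreal_mult' mult.assoc)
  qed
  finally show ?thesis .
qed

text \<open>Duality with the extremal function: pairing \<open>evol f\<close> along
  \<open>\<sigma>\<close> with a \<open>g\<close> of modulus \<open>M^(p-1)\<close> gives
  \<open>N\<close>, the integral of \<open>M^p\<close>. Cauchy-Schwarz,
  \<open>TT_star_kernel\<close> and \<open>young_convolution\<close> yield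
  \<open>N^2 \<le> A S N^(2 - 2/p)\<close>, and the power of \<open>N\<close> on the right is
  absorbed.\<close>

lemma linearised_maximal_bound:
  fixes f :: "real \<times> 'y::euclidean_space \<Rightarrow> complex" and \<sigma> :: "real \<Rightarrow> 'y \<times> real"
    and w :: "nat \<Rightarrow> real \<times> 'y \<Rightarrow> real" and \<kappa> :: "nat \<Rightarrow> real \<Rightarrow> real" and c B :: "nat \<Rightarrow> real"
  assumes p: "p \<ge> 2"
    and w: "\<And>k. integrable lborel (w k)" "\<And>k \<zeta>. 0 \<le> w k \<zeta>"
    and \<kappa>m[measurable]: "\<And>k. \<kappa> k \<in> borel_measurable borel"
    and ker: "\<And>k x y t. \<bar>t\<bar> \<le> 1 \<Longrightarrow> norm (evol (\<lambda>\<zeta>. of_real (w k \<zeta>)) x (y, t)) \<le> \<kappa> k x"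
    and \<kappa>B: "\<And>k. (\<integral>\<^sup>+x. ennreal (\<kappa> k x powr (p/2)) \<partial>lborel) \<le> ennreal (B k powr (p/2))"
    and B: "\<And>k. B k > 0" and c: "\<And>k. c k \<ge> 0" and sm: "summable (\<lambda>k. c k * B k)"
    and cover: "\<And>\<zeta>. ennreal ((1 + (norm \<zeta>)\<^sup>2) powr (-s)) \<le> (\<Sum>k. ennreal (c k * w k \<zeta>))"
    and f: "integrable lborel f" and \<sigma>[measurable]: "\<sigma> \<in> borel_measurable borel"
    and \<sigma>01: "\<And>x. snd (\<sigma> x) \<in> {0..1}"
    and A: "(\<integral>\<^sup>+\<zeta>. ennreal ((1 + (norm \<zeta>)\<^sup>2) powr s * (norm (f \<zeta>))\<^sup>2) \<partial>lborel) \<le> ennreal A" "A \<ge> 0"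
  shows "(\<integral>\<^sup>+x. ennreal ((norm (evol f x (\<sigma> x)) * indicator {-R..R} x) powr p) \<partial>lborel)
     \<le> ennreal ((A * (\<Sum>k. c k * B k)) powr (p/2))"
proof -
  \<comment> \<open>The cutoff to \<open>[-R, R]\<close> and the boundedness of
    \<open>evol f\<close> make \<open>N\<close> finite, which the final division by a power of
    \<open>N\<close> requires.\<close>
  define M where "M = (\<lambda>x. norm (evol f x (\<sigma> x)) * indicator {-R..R} x)"
  have [measurable]: "(\<lambda>x. evol f x (\<sigma> x)) \<in> borel_measurable borel"
    by (intro borel_measurable_evol f) measurable
  have [measurable]: "M \<in> borel_measurable borel" unfolding M_def by measurable
  have [measurable]: "f \<in> borel_measurable borel" using f by auto
  have [measurable]: "w k \<in> borel_measurable borel" for k using w(1)[of k] by auto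
  define K where "K = (LINT \<zeta>|lborel. norm (f \<zeta>))"
  have K: "K \<ge> 0" by (simp add: K_def)
  have M0: "M x \<ge> 0" for x by (simp add: M_def)
  have MK: "M x \<le> K" for x
    using norm_evol_le[of f x "\<sigma> x"] K by (auto simp: M_def K_def indicator_def)
  have Msupp: "M x = 0" if "x \<notin> {-R..R}" for x using that by (simp add: M_def)
  have Mr: "integrable lborel (\<lambda>x. M x powr r)" if "r > 0" for r
  proof (rule Bochner_Integration.integrable_bound)
    show "integrable lborel (\<lambda>x. K powr r * indicator {-R..R} x)"
      by (intro integrable_mult_right integrable_real_indicator) (auto simp: emeasure_lborel_Icc_eq)
    have "norm (M x powr r) \<le> norm (K powr r * indicator {-R..R} x :: real)" for x
      using Msupp[of x] M0[of x] MK[of x] that by (cases "x \<in> {-R..R}") (auto intro!: powr_mono2)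
    then show "AE x in lborel. norm (M x powr r) \<le> norm (K powr r * indicator {-R..R} x :: real)" by simp
  qed simp
  define N where "N = (LINT x|lborel. M x powr p)"
  have MN: "(\<integral>\<^sup>+x. ennreal (M x powr p) \<partial>lborel) = ennreal N"
    unfolding N_def using p by (intro nn_integral_eq_integral Mr) auto
  have N0: "N \<ge> 0" by (simp add: N_def)
  define S where "S = (\<Sum>k. c k * B k)"
  have S0: "S \<ge> 0" unfolding S_def by (intro suminf_nonneg sm mult_nonneg_nonneg c less_imp_le[OF B])
  have "N \<le> (A * S) powr (p/2)"
  proof (cases "N = 0")
    case False
    then have N: "N > 0" using N0 by simp
    define g where "g = (\<lambda>x. complex_of_real (M x powr (p - 1)) * cnj (sgn (evol f x (\<sigma> x))))"
    have ng: "norm (g x) = M x powr (p - 1)" for x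
      by (auto simp: g_def norm_mult norm_sgn M_def)
    have gM: "g x * evol f x (\<sigma> x) = of_real (M x powr p)" for x
    proof (cases "M x = 0")
      case True
      then show ?thesis by (simp add: g_def)
    next
      case False
      then have x: "x \<in> {-R..R}" using Msupp by blast
      have "cnj (sgn z) * z = of_real (norm z)" for z :: complex
        by (cases "z = 0") (simp_all add: sgn_eq complex_norm_square[symmetric] mult.commute power2_eq_square field_simps)
      then have "g x * evol f x (\<sigma> x) = of_real (M x powr (p - 1) * M x)"
        using x by (simp add: g_def M_def mult.assoc)
      also have "M x powr (p - 1) * M x = M x powr p"
        using powr_mult_base[OF M0[of x], of "p - 1"] by (simp add: mult.commute)
      finally show ?thesis .
    qed
    have gm[measurable]: "g \<in> borel_measurable borel" unfolding g_def by measurable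
    have gi: "integrable lborel g"
      by (rule Bochner_Integration.integrable_bound[OF Mr[of "p - 1"]]) (use p in \<open>auto simp: ng\<close>)
    define G where "G = (\<lambda>\<zeta>. LINT x|lborel. cis ((x, fst (\<sigma> x)) \<bullet> \<zeta> + snd (\<sigma> x) * dispersion \<zeta>) * g x)"
    have ph: "(\<lambda>(x, \<zeta>). (x, fst (\<sigma> x)) \<bullet> \<zeta> + snd (\<sigma> x) * dispersion \<zeta>) \<in> borel_measurable (borel \<Otimes>\<^sub>M borel)"
      by (rule borel_measurable_phase) simp
    have [measurable]: "G \<in> borel_measurable borel"
      unfolding G_def by (rule borel_measurable_phase_integral[OF ph gm])
    have "complex_of_real N = (LINT x|lborel. g x * evol f x (\<sigma> x))"
      unfolding gM N_def by simp
    also have "\<dots> = (LINT \<zeta>|lborel. f \<zeta> * G \<zeta>)"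
      unfolding evol_def G_def by (rule integral_phase_swap[OF gi f ph])
    finally have "ennreal N \<le> (\<integral>\<^sup>+\<zeta>. ennreal (norm (f \<zeta> * G \<zeta>)) \<partial>lborel)"
      using norm_LINT_le_nn[of lborel "\<lambda>\<zeta>. f \<zeta> * G \<zeta>"] N by (metis norm_of_real abs_of_pos)
    \<comment> \<open>Inserting \<open>(1 + |\<zeta>|^2)^(s/2)\<close> and its inverse separates the
      Sobolev norm of \<open>f\<close> from a weighted norm of \<open>G\<close>, to which
      \<open>cover\<close> applies.\<close>
    also have "\<dots> = (\<integral>\<^sup>+\<zeta>. ennreal (norm (f \<zeta>) * (1 + (norm \<zeta>)\<^sup>2) powr (s/2)) *
        ennreal (norm (G \<zeta>) * (1 + (norm \<zeta>)\<^sup>2) powr (-s/2)) \<partial>lborel)"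
    proof (intro nn_integral_cong)
      fix \<zeta> :: "real \<times> 'y"
      have "(1 + (norm \<zeta>)\<^sup>2) powr (s/2) * (1 + (norm \<zeta>)\<^sup>2) powr (-s/2) = 1"
        by (simp flip: powr_add) (simp add: add_nonneg_eq_0_iff)
      then have "norm (f \<zeta>) * norm (G \<zeta>) = norm (f \<zeta>) * (1 + (norm \<zeta>)\<^sup>2) powr (s/2) * (norm (G \<zeta>) * (1 + (norm \<zeta>)\<^sup>2) powr (-s/2))"
        by (simp add: mult_ac)
      then show "ennreal (norm (f \<zeta> * G \<zeta>)) = ennreal (norm (f \<zeta>) * (1 + (norm \<zeta>)\<^sup>2) powr (s/2)) *
        ennreal (norm (G \<zeta>) * (1 + (norm \<zeta>)\<^sup>2) powr (-s/2))"
        by (simp add: norm_mult flip: ennreal_mult)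
    qed
    finally have "(ennreal N)\<^sup>2 \<le> (\<integral>\<^sup>+\<zeta>. ennreal (norm (f \<zeta>) * (1 + (norm \<zeta>)\<^sup>2) powr (s/2)) *
        ennreal (norm (G \<zeta>) * (1 + (norm \<zeta>)\<^sup>2) powr (-s/2)) \<partial>lborel)\<^sup>2"
      by (rule power_mono) simp
    also have "\<dots> \<le> (\<integral>\<^sup>+\<zeta>. (ennreal (norm (f \<zeta>) * (1 + (norm \<zeta>)\<^sup>2) powr (s/2)))\<^sup>2 \<partial>lborel) *
        (\<integral>\<^sup>+\<zeta>. (ennreal (norm (G \<zeta>) * (1 + (norm \<zeta>)\<^sup>2) powr (-s/2)))\<^sup>2 \<partial>lborel)"
      by (rule Cauchy_Schwarz_nn_integral) measurable
    finally have h1: "(ennreal N)\<^sup>2 \<le> (\<integral>\<^sup>+\<zeta>. (ennreal (norm (f \<zeta>) * (1 + (norm \<zeta>)\<^sup>2) powr (s/2)))\<^sup>2 \<partial>lborel) *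
        (\<integral>\<^sup>+\<zeta>. (ennreal (norm (G \<zeta>) * (1 + (norm \<zeta>)\<^sup>2) powr (-s/2)))\<^sup>2 \<partial>lborel)" .
    have h2: "(\<integral>\<^sup>+\<zeta>. (ennreal (norm (f \<zeta>) * (1 + (norm \<zeta>)\<^sup>2) powr (s/2)))\<^sup>2 \<partial>lborel) =
       (\<integral>\<^sup>+\<zeta>. ennreal ((1 + (norm \<zeta>)\<^sup>2) powr s * (norm (f \<zeta>))\<^sup>2) \<partial>lborel)"
    proof (intro nn_integral_cong)
      fix \<zeta> :: "real \<times> 'y"
      have "((1 + (norm \<zeta>)\<^sup>2) powr (s/2))\<^sup>2 = (1 + (norm \<zeta>)\<^sup>2) powr s"
        by (simp add: power2_eq_square flip: powr_add)
      then show "(ennreal (norm (f \<zeta>) * (1 + (norm \<zeta>)\<^sup>2) powr (s/2)))\<^sup>2 =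
         ennreal ((1 + (norm \<zeta>)\<^sup>2) powr s * (norm (f \<zeta>))\<^sup>2)"
        by (simp add: ennreal_power power_mult_distrib mult.commute)
    qed
    have h3: "(\<integral>\<^sup>+\<zeta>. (ennreal (norm (G \<zeta>) * (1 + (norm \<zeta>)\<^sup>2) powr (-s/2)))\<^sup>2 \<partial>lborel) \<le> ennreal (S * N powr (2 - 2/p))"
    proof -
      have "(\<integral>\<^sup>+\<zeta>. (ennreal (norm (G \<zeta>) * (1 + (norm \<zeta>)\<^sup>2) powr (-s/2)))\<^sup>2 \<partial>lborel) =
         (\<integral>\<^sup>+\<zeta>. ennreal ((norm (G \<zeta>))\<^sup>2) * ennreal ((1 + (norm \<zeta>)\<^sup>2) powr (-s)) \<partial>lborel)"
      proof (intro nn_integral_cong)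
        fix \<zeta> :: "real \<times> 'y"
        have "((1 + (norm \<zeta>)\<^sup>2) powr (-s/2))\<^sup>2 = (1 + (norm \<zeta>)\<^sup>2) powr (-s)"
          by (simp add: power2_eq_square flip: powr_add)
        then show "(ennreal (norm (G \<zeta>) * (1 + (norm \<zeta>)\<^sup>2) powr (-s/2)))\<^sup>2 =
           ennreal ((norm (G \<zeta>))\<^sup>2) * ennreal ((1 + (norm \<zeta>)\<^sup>2) powr (-s))"
          by (simp add: ennreal_power power_mult_distrib ennreal_mult)
      qed
      also have "\<dots> \<le> (\<integral>\<^sup>+\<zeta>. ennreal ((norm (G \<zeta>))\<^sup>2) * (\<Sum>k. ennreal (c k * w k \<zeta>)) \<partial>lborel)"
        by (intro nn_integral_mono mult_left_mono cover) simp
      also have "\<dots> = (\<integral>\<^sup>+\<zeta>. (\<Sum>k. ennreal (c k) * ennreal (w k \<zeta> * (norm (G \<zeta>))\<^sup>2)) \<partial>lborel)"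
        by (intro nn_integral_cong)
           (simp add: ennreal_suminf_cmult[symmetric] ennreal_mult c w mult_ac)
      also have "\<dots> = (\<Sum>k. ennreal (c k) * (\<integral>\<^sup>+\<zeta>. ennreal (w k \<zeta> * (norm (G \<zeta>))\<^sup>2) \<partial>lborel))"
        by (subst nn_integral_suminf) (simp_all add: nn_integral_cmult)
      also have "\<dots> \<le> (\<Sum>k. ennreal (c k * B k * N powr (2 - 2/p)))"
      proof (intro suminf_le summableI)
        fix k
        have \<kappa>0: "\<kappa> k x \<ge> 0" for x
          using order.trans[OF norm_ge_zero ker[where t=0 and x=x and k=k and y=0]] by simp
        have "(\<integral>\<^sup>+\<zeta>. ennreal (w k \<zeta> * (norm (G \<zeta>))\<^sup>2) \<partial>lborel) \<le>
          (\<integral>\<^sup>+x. \<integral>\<^sup>+x'. ennreal (norm (g x) * norm (g x') * \<kappa> k (x - x')) \<partial>lborel \<partial>lborel)"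
          unfolding G_def by (intro TT_star_kernel w gi \<sigma> \<sigma>01 \<kappa>m ker)
        also have "\<dots> \<le> ennreal (B k * N powr (2 - 2/p))"
          unfolding ng by (rule young_convolution[OF p N B _ _ M0 \<kappa>0 MN \<kappa>B]) auto
        finally show "ennreal (c k) * (\<integral>\<^sup>+\<zeta>. ennreal (w k \<zeta> * (norm (G \<zeta>))\<^sup>2) \<partial>lborel) \<le> ennreal (c k * B k * N powr (2 - 2/p))"
          using c[of k] B[of k] by (simp add: ennreal_mult' mult.assoc mult_left_mono)
      qed
      also have "\<dots> = ennreal (S * N powr (2 - 2/p))"
        unfolding S_def by (subst suminf_ennreal2)
          (auto intro!: mult_nonneg_nonneg c less_imp_le[OF B] summable_mult2 sm simp: suminf_mult2[OF sm])
      finally show ?thesis .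
    qed
    have "(ennreal N)\<^sup>2 \<le> ennreal A * ennreal (S * N powr (2 - 2/p))"
      using A(1) unfolding h2[symmetric] by (intro order.trans[OF h1] mult_mono h3) auto
    then have "ennreal (N\<^sup>2) \<le> ennreal (A * (S * N powr (2 - 2/p)))"
      using N A S0 by (simp add: ennreal_power ennreal_mult)
    then have "N\<^sup>2 \<le> A * (S * N powr (2 - 2/p))"
      using A S0 by (subst (asm) ennreal_le_iff) auto
    moreover have "N\<^sup>2 = N powr (2/p) * N powr (2 - 2/p)"
      using N by (simp flip: powr_add)
    ultimately have "N powr (2/p) \<le> A * S" using N by (simp add: mult.assoc[symmetric])
    then have "(N powr (2/p)) powr (p/2) \<le> (A * S) powr (p/2)"
      using p by (intro powr_mono2) auto
    then show ?thesis using p N by (simp add: powr_powr)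
  qed simp
  then show ?thesis
    using MN unfolding M_def S_def by (simp add: ennreal_leI)
qed

section \<open>Passing to Schwartz data, and from selectors to the supremum\<close>

lemma schwartz_borel_measurable:
  fixes u :: "'a::euclidean_space \<Rightarrow> complex"
  assumes "schwartz u"
  shows "u \<in> borel_measurable borel"
proof -
  have "u differentiable (at x)" for x
    using assms unfolding schwartz_def by (metis empty_subsetI iter_deriv.simps(1) list.set(1))
  then have "continuous_on UNIV u"
    by (simp add: continuous_at_imp_continuous_on differentiable_imp_continuous_within)
  then show ?thesis by (rule borel_measurable_continuous_onI)
qed

lemma borel_measurable_fourier:
  fixes u :: "'a::euclidean_space \<Rightarrow> complex"
  assumes "u \<in> borel_measurable borel"
  shows "fourier u \<in> borel_measurable borel"
proof -
  have "(\<lambda>(x :: 'a, \<zeta>). - (x \<bullet> \<zeta>)) \<in> borel_measurable (borel \<Otimes>\<^sub>M borel)"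
    unfolding borel_prod split_beta by (intro borel_measurable_continuous_onI continuous_intros)
  from borel_measurable_phase_integral[OF this assms]
  show ?thesis unfolding fourier_def[abs_def] by simp
qed

lemma propagator_eq_evol:
  fixes u :: "real \<times> 'y::euclidean_space \<Rightarrow> complex"
  shows "propagator t u (x, y) =
    of_real ((2 * pi) powr (- real DIM(real \<times> 'y) / 2)) * evol (fourier u) x (y, t)"
  unfolding propagator_def inv_fourier_def evol_def
  by (simp add: mult.assoc flip: cis_mult)

text \<open>The Bochner integral of a non-integrable function is \<open>0\<close>, so the estimate is trivial unless
  \<^const>\<open>fourier\<close> \<open>u\<close> is integrable, and no decay of the Fourier transform has to be proved.\<close>

lemma evol_not_integrable:
  fixes f :: "real \<times> 'y::euclidean_space \<Rightarrow> complex"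
  assumes "\<not> integrable lborel f"
  shows "evol f x z = 0"
proof -
  let ?\<phi> = "\<lambda>\<zeta>. (x, fst z) \<bullet> \<zeta> + snd z * dispersion \<zeta>"
  have "\<not> integrable lborel (\<lambda>\<zeta>. cis (?\<phi> \<zeta>) * f \<zeta>)"
  proof
    assume "integrable lborel (\<lambda>\<zeta>. cis (?\<phi> \<zeta>) * f \<zeta>)"
    then have "integrable lborel (\<lambda>\<zeta>. cis (- ?\<phi> \<zeta>) * (cis (?\<phi> \<zeta>) * f \<zeta>))"
      by (rule integrable_cis_mult) measurable
    then show False using assms by (simp add: cis_mult flip: mult.assoc)
  qed
  then show ?thesis unfolding evol_def by (rule not_integrable_integral_eq)
qed

lemma ennreal_root_mono_real:
  assumes "a \<le> ennreal z" "z \<ge> 0" "p > 0"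
  shows "ennreal_root p a \<le> ennreal (z powr (1/p))"
proof -
  have "a \<noteq> \<infinity>" using assms by (auto simp: top_unique)
  then have "enn2real a \<le> z" using assms by (simp add: enn2real_leI)
  then show ?thesis using assms \<open>a \<noteq> \<infinity>\<close> unfolding ennreal_root_def
    by (auto intro!: ennreal_leI powr_mono2)
qed

text \<open>Records the maximising point instead of the maximum, since that point is the selector
  \<open>\<sigma>\<close>. Each stage takes finitely many values, on sets cut out by inequalities
  between measurable functions, and so is measurable.\<close>

fun running_argmax :: "(nat \<Rightarrow> 'z) \<Rightarrow> ('z \<Rightarrow> 'x \<Rightarrow> real) \<Rightarrow> nat \<Rightarrow> 'x \<Rightarrow> 'z" where
  "running_argmax d F 0 x = d 0"
| "running_argmax d F (Suc n) x =
     (if F (running_argmax d F n x) x < F (d (Suc n)) x then d (Suc n) else running_argmax d F n x)"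

lemma running_argmax_in_range: "running_argmax d F n x \<in> range d"
  by (induction n) auto

lemma running_argmax_mono: "n \<le> m \<Longrightarrow> F (running_argmax d F n x) x \<le> F (running_argmax d F m x) x"
  by (induction m rule: dec_induct) auto

lemma running_argmax_ge: "F (d n) x \<le> F (running_argmax d F n x) x"
  by (cases n) auto

text \<open>By continuity the supremum may be taken over a countable dense set of
  \<open>(y, t)\<close>. The running maximisers over its first points are admissible selectors whose
  values increase to that supremum, so monotone convergence carries over a bound that is uniform in
  \<open>\<sigma>\<close> and \<open>R\<close>.\<close>

lemma sup_linearisation:
  fixes f :: "real \<times> 'y::euclidean_space \<Rightarrow> complex"
  assumes f: "integrable lborel f" and p: "p > 0"
    and bound: "\<And>R \<sigma>. \<sigma> \<in> borel_measurable borel \<Longrightarrow> (\<And>x. snd (\<sigma> x) \<in> {0..1}) \<Longrightarrow>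
      (\<integral>\<^sup>+x. ennreal ((norm (evol f x (\<sigma> x)) * indicator {-R..R} x) powr p) \<partial>lborel) \<le> K"
  shows "(\<integral>\<^sup>+x. (SUP (y, t) \<in> UNIV \<times> {0..1}. ennreal (norm (evol f x (y, t)) powr p)) \<partial>lborel) \<le> K"
proof -
  define D where "D = (UNIV :: 'y set) \<times> {0..1::real}"
  obtain T where T: "countable T" "T \<subseteq> D" "D \<subseteq> closure T"
    using separable by blast
  have "T \<noteq> {}" using T(3) by (auto simp: D_def)
  define d where "d = from_nat_into T"
  have d: "range d = T" unfolding d_def using T(1) \<open>T \<noteq> {}\<close> by (simp add: range_from_nat_into)
  define F where "F = (\<lambda>z x. norm (evol f x z))"
  have Fm: "(\<lambda>x. F (r x) x) \<in> borel_measurable borel" if "r \<in> borel_measurable borel" for r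
  proof -
    have [measurable]: "(\<lambda>x. evol f x (r x)) \<in> borel_measurable borel"
      by (rule borel_measurable_evol[OF f, where a="\<lambda>x. x"]) (use that in auto)
    show ?thesis unfolding F_def by measurable
  qed
  define \<sigma> where "\<sigma> = running_argmax d F"
  have \<sigma>T: "\<sigma> n x \<in> T" for n x using running_argmax_in_range d by (metis \<sigma>_def)
  have \<sigma>m[measurable]: "\<sigma> n \<in> borel_measurable borel" for n
  proof (induction n)
    case (Suc n)
    note [measurable] = Suc
    have [measurable]: "(\<lambda>x. F (\<sigma> n x) x) \<in> borel_measurable borel" "(\<lambda>x. F (d (Suc n)) x) \<in> borel_measurable borel"
      by (rule Fm, measurable)+
    have "\<sigma> (Suc n) = (\<lambda>x. if F (\<sigma> n x) x < F (d (Suc n)) x then d (Suc n) else \<sigma> n x)"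
      by (simp add: \<sigma>_def fun_eq_iff)
    then show ?case by simp
  qed (simp add: \<sigma>_def)
  \<comment> \<open>The window grows with \<open>n\<close>: the sequence stays increasing, and every
    \<open>x\<close> is eventually inside.\<close>
  define g where "g = (\<lambda>n x. ennreal ((F (\<sigma> n x) x * indicator {- real n..real n} x) powr p))"
  have g_inc: "incseq g"
  proof (intro incseq_SucI le_funI)
    fix n x
    have "F (\<sigma> n x) x \<le> F (\<sigma> (Suc n) x) x" unfolding \<sigma>_def by (rule running_argmax_mono) simp
    moreover have "indicator {- real n..real n} x \<le> (indicator {- real (Suc n)..real (Suc n)} x :: real)"
      by (auto simp: indicator_def)
    ultimately have "F (\<sigma> n x) x * indicator {- real n..real n} x \<le> F (\<sigma> (Suc n) x) x * indicator {- real (Suc n)..real (Suc n)} x"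
      by (intro mult_mono) (auto simp: F_def)
    then show "g n x \<le> g (Suc n) x"
      unfolding g_def using p by (intro ennreal_leI powr_mono2) (auto simp: F_def)
  qed
  have sup: "(SUP (y, t) \<in> UNIV \<times> {0..1}. ennreal (norm (evol f x (y, t)) powr p)) \<le> (SUP n. g n x)" for x
  proof (rule SUP_least, clarify)
    fix y :: 'y and t :: real assume "t \<in> {0..1}"
    have cont: "continuous_on UNIV (\<lambda>z. ennreal (norm (evol f x z) powr p))"
    proof (intro continuous_on_ennreal continuous_on_powr' continuous_intros)
      show "continuous_on UNIV (evol f x)"
        using continuous_on_compose2[OF continuous_evol[OF f], of UNIV "\<lambda>z. (x, z)"] by (simp add: continuous_intros)
    qed (use p in auto)
    have "T \<subseteq> {z. ennreal (norm (evol f x z) powr p) \<le> (SUP n. g n x)}"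
    proof
      fix z assume "z \<in> T"
      then obtain m where m: "z = d m" using d by auto
      define n where "n = max m (nat \<lceil>\<bar>x\<bar>\<rceil>)"
      have "x \<in> {- real n..real n}" unfolding n_def by (auto simp: abs_le_iff; linarith)
      moreover have "F z x \<le> F (\<sigma> n x) x"
        unfolding m \<sigma>_def by (rule order.trans[OF running_argmax_ge running_argmax_mono]) (simp add: n_def)
      ultimately have "ennreal (F z x powr p) \<le> g n x"
        unfolding g_def using p by (intro ennreal_leI powr_mono2) (auto simp: F_def)
      also have "\<dots> \<le> (SUP n. g n x)" by (rule SUP_upper) simp
      finally show "z \<in> {z. ennreal (norm (evol f x z) powr p) \<le> (SUP n. g n x)}"
        by (simp add: F_def)
    qed
    moreover have "closed {z. ennreal (norm (evol f x z) powr p) \<le> (SUP n. g n x)}"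
      by (intro closed_Collect_le cont continuous_on_const)
    ultimately have "closure T \<subseteq> {z. ennreal (norm (evol f x z) powr p) \<le> (SUP n. g n x)}"
      by (rule closure_minimal)
    moreover have "(y, t) \<in> closure T" using T(3) \<open>t \<in> {0..1}\<close> by (auto simp: D_def)
    ultimately show "ennreal (norm (evol f x (y, t)) powr p) \<le> (SUP n. g n x)" by blast
  qed
  have gm: "g n \<in> borel_measurable lborel" for n
  proof -
    have [measurable]: "(\<lambda>x. F (\<sigma> n x) x) \<in> borel_measurable borel"
      by (rule Fm, measurable)
    show ?thesis unfolding g_def by measurable
  qed
  have "(\<integral>\<^sup>+x. (SUP (y, t) \<in> UNIV \<times> {0..1}. ennreal (norm (evol f x (y, t)) powr p)) \<partial>lborel) \<le>
    (\<integral>\<^sup>+x. (SUP n. g n x) \<partial>lborel)" by (intro nn_integral_mono sup)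
  also have "\<dots> = (SUP n. \<integral>\<^sup>+x. g n x \<partial>lborel)"
    by (rule nn_integral_monotone_convergence_SUP[OF g_inc gm])
  also have "\<dots> \<le> K"
  proof (rule SUP_least)
    fix n
    have "snd (\<sigma> n x) \<in> {0..1}" for x using \<sigma>T[of n x] T(2) by (auto simp: D_def)
    then show "(\<integral>\<^sup>+x. g n x \<partial>lborel) \<le> K"
      unfolding g_def F_def by (intro bound \<sigma>m)
  qed
  finally show ?thesis .
qed

theorem maximal_estimate_of_kernels:
  fixes w :: "nat \<Rightarrow> real \<times> 'y::euclidean_space \<Rightarrow> real" and \<kappa> :: "nat \<Rightarrow> real \<Rightarrow> real" and c B :: "nat \<Rightarrow> real"
  assumes p: "p \<ge> 2"
    and w: "\<And>k. integrable lborel (w k)" "\<And>k \<zeta>. 0 \<le> w k \<zeta>"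
    and \<kappa>m: "\<And>k. \<kappa> k \<in> borel_measurable borel"
    and ker: "\<And>k x y t. \<bar>t\<bar> \<le> 1 \<Longrightarrow> norm (evol (\<lambda>\<zeta>. of_real (w k \<zeta>)) x (y, t)) \<le> \<kappa> k x"
    and \<kappa>B: "\<And>k. (\<integral>\<^sup>+x. ennreal (\<kappa> k x powr (p/2)) \<partial>lborel) \<le> ennreal (B k powr (p/2))"
    and B: "\<And>k. B k > 0" and c: "\<And>k. c k \<ge> 0" and sm: "summable (\<lambda>k. c k * B k)"
    and cover: "\<And>\<zeta>. ennreal ((1 + (norm \<zeta>)\<^sup>2) powr (-s)) \<le> (\<Sum>k. ennreal (c k * w k \<zeta>))"
  shows "maximal_estimate TYPE('y) p s"
proof -
  define S where "S = (\<Sum>k. c k * B k)"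
  have S0: "S \<ge> 0" unfolding S_def by (intro suminf_nonneg sm mult_nonneg_nonneg c less_imp_le[OF B])
  define C0 where "C0 = (2 * pi) powr (- real DIM(real \<times> 'y) / 2)"
  have C0: "C0 > 0" by (simp add: C0_def)
  define C where "C = C0 * sqrt S + 1"
  have C: "C > 0" using C0 S0 by (simp add: C_def add_nonneg_pos)
  show ?thesis
    unfolding maximal_estimate_def
  proof (intro exI[of _ C] conjI allI impI C)
    fix u :: "real \<times> 'y \<Rightarrow> complex" assume "schwartz u"
    define f where "f = (\<lambda>\<zeta>. of_real C0 * fourier u \<zeta>)"
    have fm[measurable]: "fourier u \<in> borel_measurable borel"
      by (intro borel_measurable_fourier schwartz_borel_measurable \<open>schwartz u\<close>)
    have evol_f: "evol f x z = of_real C0 * evol (fourier u) x z" for x z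
      unfolding evol_def f_def by (simp add: mult.left_commute[of _ "of_real C0"])
    have mixed: "mixed_norm p (\<lambda>x y t. propagator t u (x, y)) =
      ennreal_root p (\<integral>\<^sup>+x. (SUP (y, t) \<in> UNIV \<times> {0..1}. ennreal (norm (evol f x (y, t)) powr p)) \<partial>lborel)"
      unfolding mixed_norm_def propagator_eq_evol evol_f C0_def ..
    define A' where "A' = (\<integral>\<^sup>+\<zeta>. ennreal ((1 + (norm \<zeta>)\<^sup>2) powr s * (norm (fourier u \<zeta>))\<^sup>2) \<partial>lborel)"
    have sob: "sobolev_norm s u = ennreal_root 2 A'"
      unfolding sobolev_norm_def A'_def ..
    consider "\<not> integrable lborel f" | "A' = \<infinity>" | "integrable lborel f" "A' \<noteq> \<infinity>" by blast
    then show "mixed_norm p (\<lambda>x y t. propagator t u (x, y)) \<le> ennreal C * sobolev_norm s u"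
    proof cases
      case 1
      have "(SUP (y, t) \<in> UNIV \<times> {0..1}. ennreal (norm (evol f x (y, t)) powr p)) = 0" for x
        by (simp add: evol_not_integrable[OF 1])
      then show ?thesis unfolding mixed by (simp add: ennreal_root_def)
    next
      case 2
      then show ?thesis unfolding sob using C by (simp add: ennreal_root_def ennreal_mult_top)
    next
      case 3
      define A where "A = enn2real A'"
      have A: "A' = ennreal A" "A \<ge> 0" using 3(2) by (auto simp: A_def less_top)
      have "(\<integral>\<^sup>+x. (SUP (y, t) \<in> UNIV \<times> {0..1}. ennreal (norm (evol f x (y, t)) powr p)) \<partial>lborel)
          \<le> ennreal ((C0\<^sup>2 * A * S) powr (p/2))"
      proof (rule sup_linearisation[OF 3(1)])
        fix R :: real and \<sigma> :: "real \<Rightarrow> 'y \<times> real"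
        assume \<sigma>: "\<sigma> \<in> borel_measurable borel" "\<And>x. snd (\<sigma> x) \<in> {0..1}"
        have "(\<integral>\<^sup>+\<zeta>. ennreal ((1 + (norm \<zeta>)\<^sup>2) powr s * (norm (f \<zeta>))\<^sup>2) \<partial>lborel) =
          (\<integral>\<^sup>+\<zeta>. ennreal (C0\<^sup>2) * ennreal ((1 + (norm \<zeta>)\<^sup>2) powr s * (norm (fourier u \<zeta>))\<^sup>2) \<partial>lborel)"
          by (intro nn_integral_cong)
            (simp add: f_def norm_mult power_mult_distrib mult_ac flip: ennreal_mult)
        also have "\<dots> = ennreal (C0\<^sup>2 * A)"
          using A(2) by (subst nn_integral_cmult, measurable)
            (simp only: A'_def[symmetric] A(1), simp add: ennreal_mult)
        finally have A'': "(\<integral>\<^sup>+\<zeta>. ennreal ((1 + (norm \<zeta>)\<^sup>2) powr s * (norm (f \<zeta>))\<^sup>2) \<partial>lborel) \<le> ennreal (C0\<^sup>2 * A)"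
          by simp
        have A2: "C0\<^sup>2 * A \<ge> 0" using A(2) by simp
        show "(\<integral>\<^sup>+x. ennreal ((norm (evol f x (\<sigma> x)) * indicator {-R..R} x) powr p) \<partial>lborel)
            \<le> ennreal ((C0\<^sup>2 * A * S) powr (p/2))"
          unfolding S_def
          by (rule linearised_maximal_bound[OF p w \<kappa>m ker \<kappa>B B c sm cover 3(1) \<sigma> A'' A2])
      qed (use p in auto)
      then have "mixed_norm p (\<lambda>x y t. propagator t u (x, y)) \<le> ennreal (((C0\<^sup>2 * A * S) powr (p/2)) powr (1/p))"
        unfolding mixed using p by (intro ennreal_root_mono_real) auto
      also have "((C0\<^sup>2 * A * S) powr (p/2)) powr (1/p) = C0 * sqrt S * A powr (1/2)"
        using p C0 S0 A(2) by (simp add: powr_powr powr_half_sqrt real_sqrt_mult)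
      also have "ennreal (C0 * sqrt S * A powr (1/2)) \<le> ennreal (C * A powr (1/2))"
        by (intro ennreal_leI mult_right_mono) (auto simp: C_def)
      also have "\<dots> = ennreal C * sobolev_norm s u"
        unfolding sob A(1) ennreal_root_def using C A(2) by (simp add: ennreal_mult)
      finally show ?thesis .
    qed
  qed
qed

subsection \<open>Reduction to a kernel at unit frequency\<close>

text \<open>The symbol is homogeneous of degree 3, so dilating frequencies by \<open>l\<close>
  dilates space by \<open>l\<close> and time by \<open>l^3\<close>, at the price of the
  Jacobian.\<close>

lemma evol_scale:
  fixes v :: "real \<times> 'y::euclidean_space \<Rightarrow> complex"
  assumes "l > 0" and [measurable]: "v \<in> borel_measurable borel"
  shows "evol (\<lambda>\<zeta>. v (\<zeta> /\<^sub>R l)) x (y, t) =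
    of_real (l ^ DIM(real \<times> 'y)) * evol v (l * x) (l *\<^sub>R y, l ^ 3 * t)"
proof -
  have disp: "dispersion (l *\<^sub>R \<zeta>) = l ^ 3 * dispersion \<zeta>" for \<zeta> :: "real \<times> 'y"
    using assms by (simp add: dispersion_eq power2_eq_square power3_eq_cube algebra_simps)
  let ?f = "\<lambda>\<zeta>. cis ((x, y) \<bullet> \<zeta> + t * dispersion \<zeta>) * v (\<zeta> /\<^sub>R l)"
  have "evol (\<lambda>\<zeta>. v (\<zeta> /\<^sub>R l)) x (y, t) =
    integral\<^sup>L (density (distr lborel borel (\<lambda>\<zeta>. 0 + l *\<^sub>R \<zeta>)) (\<lambda>_. ennreal (\<bar>l\<bar> ^ DIM(real \<times> 'y)))) ?f"
    unfolding evol_def using assms by (subst lborel_affine[of l 0]) auto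
  also have "\<dots> = (LINT \<zeta>|lborel. \<bar>l\<bar> ^ DIM(real \<times> 'y) *\<^sub>R ?f (0 + l *\<^sub>R \<zeta>))"
    by (subst integral_density) (simp_all add: integral_distr)
  also have "\<dots> = of_real (l ^ DIM(real \<times> 'y)) * (LINT \<zeta>|lborel. ?f (l *\<^sub>R \<zeta>))"
    using assms by (simp add: scaleR_conv_of_real)
  also have "(LINT \<zeta>|lborel. ?f (l *\<^sub>R \<zeta>)) = evol v (l * x) (l *\<^sub>R y, l ^ 3 * t)"
    unfolding evol_def using assms by (simp add: disp inner_prod_def algebra_simps)
  finally show ?thesis .
qed

lemma nn_integral_even_le:
  fixes f :: "real \<Rightarrow> ennreal"
  assumes [measurable]: "f \<in> borel_measurable borel" and even: "\<And>x. f (- x) = f x"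
  shows "(\<integral>\<^sup>+x. f x \<partial>lborel) \<le> 2 * (\<integral>\<^sup>+x. f x * indicator {0..} x \<partial>lborel)"
proof -
  have "(\<integral>\<^sup>+x. f x \<partial>lborel) \<le> (\<integral>\<^sup>+x. f x * indicator {0..} x + f x * indicator {..0} x \<partial>lborel)"
    by (intro nn_integral_mono) (auto simp: indicator_def)
  also have "\<dots> = (\<integral>\<^sup>+x. f x * indicator {0..} x \<partial>lborel) + (\<integral>\<^sup>+x. f x * indicator {..0} x \<partial>lborel)"
    by (rule nn_integral_add) auto
  also have "(\<integral>\<^sup>+x. f x * indicator {..0} x \<partial>lborel) = (\<integral>\<^sup>+x. f x * indicator {0..} x \<partial>lborel)"
    by (subst nn_integral_real_affine[where c="-1" and t=0])
      (auto simp: even intro!: nn_integral_cong split: split_indicator)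
  finally show ?thesis by (simp add: mult_2)
qed

lemma nn_integral_powr_symmetric:
  assumes "a > -1" "R \<ge> 0"
  shows "(\<integral>\<^sup>+x. ennreal (\<bar>x\<bar> powr a * indicator {-R..R} x) \<partial>lborel) \<le> ennreal (2 * (R powr (a + 1) / (a + 1)))"
proof -
  have "((\<lambda>x. indicator {0..R} x *\<^sub>R x powr a) has_integral (R powr (a + 1) / (a + 1))) UNIV"
  proof -
    have "((\<lambda>x. if x \<in> {0..R} then x powr a else 0) has_integral (R powr (a + 1) / (a + 1))) UNIV"
      using has_integral_powr_from_0[OF assms] by (simp only: has_integral_restrict_UNIV)
    moreover have "(\<lambda>x. if x \<in> {0..R} then x powr a else 0) = (\<lambda>x. indicator {0..R} x *\<^sub>R x powr a)"
      by auto
    ultimately show ?thesis by simp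
  qed
  then have "(\<integral>\<^sup>+x. ennreal (indicator {0..R} x *\<^sub>R x powr a) \<partial>lborel) = ennreal (R powr (a + 1) / (a + 1))"
    by (intro nn_integral_has_integral_lborel) auto
  also have "(\<integral>\<^sup>+x. ennreal (indicator {0..R} x *\<^sub>R x powr a) \<partial>lborel) =
    (\<integral>\<^sup>+x. ennreal (\<bar>x\<bar> powr a * indicator {-R..R} x) * indicator {0..} x \<partial>lborel)"
    using assms by (intro nn_integral_cong) (auto split: split_indicator)
  finally have "2 * (\<integral>\<^sup>+x. ennreal (\<bar>x\<bar> powr a * indicator {-R..R} x) * indicator {0..} x \<partial>lborel) =
    2 * ennreal (R powr (a + 1) / (a + 1))" by simp
  moreover have "2 * ennreal (R powr (a + 1) / (a + 1)) = ennreal (2 * (R powr (a + 1) / (a + 1)))"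
    using assms by (subst ennreal_mult) auto
  moreover have "(\<integral>\<^sup>+x. ennreal (\<bar>x\<bar> powr a * indicator {-R..R} x) \<partial>lborel) \<le>
    2 * (\<integral>\<^sup>+x. ennreal (\<bar>x\<bar> powr a * indicator {-R..R} x) * indicator {0..} x \<partial>lborel)"
    by (rule nn_integral_even_le) (auto split: split_indicator)
  ultimately show ?thesis by simp
qed

lemma nn_integral_inverse_1_plus_square:
  "(\<integral>\<^sup>+x. ennreal (inverse (1 + x\<^sup>2)) \<partial>lborel) = ennreal pi"
proof -
  have "integrable lborel (\<lambda>x::real. inverse (1 + x\<^sup>2))" "(LINT x|lborel. inverse (1 + x\<^sup>2)) = pi"
    using integrable_inverse_1_plus_square LBINT_inverse_1_plus_square
    by (simp_all add: set_integrable_def interval_lebesgue_integral_def set_lebesgue_integral_def)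
  then show ?thesis by (subst nn_integral_eq_integral) auto
qed

lemma powr_add_le:
  fixes a b q :: real
  assumes "a \<ge> 0" "b \<ge> 0" "q \<ge> 0"
  shows "(a + b) powr q \<le> 2 powr q * (a powr q + b powr q)"
proof -
  have "(a + b) powr q \<le> (2 * max a b) powr q"
    using assms by (intro powr_mono2) auto
  also have "\<dots> = 2 powr q * max a b powr q" using assms by (simp add: powr_mult)
  also have "max a b powr q \<le> a powr q + b powr q" by (cases "a \<le> b") (auto simp: max_def)
  finally show ?thesis by simp
qed

lemma ennreal_lincomb:
  "K \<ge> 0 \<Longrightarrow> a \<ge> 0 \<Longrightarrow> b \<ge> 0 \<Longrightarrow> c \<ge> 0 \<Longrightarrow> d \<ge> 0 \<Longrightarrow>
    ennreal (K * (a * b + c * d)) = ennreal K * (ennreal a * ennreal b + ennreal c * ennreal d)"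
  by (simp add: ennreal_mult ennreal_plus)

text \<open>The first summand covers bounded \<open>X\<close> and the \<open>X^(-2)\<close> tail at
  once. The second carries the dispersive decay, converted from \<open>T\<close> to
  \<open>X\<close>, on the region \<open>|X| \<le> R\<close> where a stationary point can
  occur.\<close>

definition majorant :: "real \<Rightarrow> real \<Rightarrow> real \<Rightarrow> real \<Rightarrow> real \<Rightarrow> real" where
  "majorant C D R \<theta> X = 2 * C * inverse (1 + X\<^sup>2) + D * (\<bar>X\<bar> powr (- \<theta>) * indicator {-R..R} X)"

lemma borel_measurable_majorant [measurable]: "majorant C D R \<theta> \<in> borel_measurable borel"
  unfolding majorant_def by measurable

text \<open>As \<open>q \<ge> 1\<close>, the \<open>q\<close>-th power of
  \<open>1 / (1 + X^2)\<close> is dominated by the function itself; \<open>\<theta> * q < 1\<close>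
  makes the singularity at 0 integrable.\<close>

lemma nn_integral_majorant:
  assumes "C \<ge> 0" "D \<ge> 0" "R \<ge> 0" "q \<ge> 1" "\<theta> * q < 1"
  shows "(\<integral>\<^sup>+X. ennreal (majorant C D R \<theta> X powr q) \<partial>lborel) \<le>
    ennreal (2 powr q * ((2 * C) powr q * pi + D powr q * (2 * (R powr (1 - \<theta> * q) / (1 - \<theta> * q)))))"
proof -
  have pw: "majorant C D R \<theta> X powr q \<le>
     2 powr q * ((2 * C) powr q * inverse (1 + X\<^sup>2) + D powr q * (\<bar>X\<bar> powr (- (\<theta> * q)) * indicator {-R..R} X))" for X
  proof -
    have "majorant C D R \<theta> X powr q \<le>
      2 powr q * ((2 * C * inverse (1 + X\<^sup>2)) powr q + (D * (\<bar>X\<bar> powr (- \<theta>) * indicator {-R..R} X)) powr q)"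
      unfolding majorant_def using assms by (intro powr_add_le) auto
    also have "(2 * C * inverse (1 + X\<^sup>2)) powr q = (2 * C) powr q * inverse (1 + X\<^sup>2) powr q"
      using assms by (simp add: powr_mult)
    also have "inverse (1 + X\<^sup>2) powr q \<le> inverse (1 + X\<^sup>2) powr 1"
    proof -
      have "0 < inverse (1 + X\<^sup>2)" "inverse (1 + X\<^sup>2) \<le> 1" by (auto simp: add_pos_nonneg inverse_le_1_iff)
      then show ?thesis using assms by (intro powr_mono') auto
    qed
    also have "inverse (1 + X\<^sup>2) powr 1 = inverse (1 + X\<^sup>2)" by simp
    also have "(D * (\<bar>X\<bar> powr (- \<theta>) * indicator {-R..R} X)) powr q = D powr q * (\<bar>X\<bar> powr (- (\<theta> * q)) * indicator {-R..R} X)"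
      using assms by (auto simp: powr_mult powr_powr split: split_indicator)
    finally show ?thesis by (simp add: mult_left_mono)
  qed
  have "(\<integral>\<^sup>+X. ennreal (majorant C D R \<theta> X powr q) \<partial>lborel) \<le>
    (\<integral>\<^sup>+X. ennreal (2 powr q) * (ennreal ((2 * C) powr q) * ennreal (inverse (1 + X\<^sup>2)) +
       ennreal (D powr q) * ennreal (\<bar>X\<bar> powr (- (\<theta> * q)) * indicator {-R..R} X)) \<partial>lborel)"
  proof (intro nn_integral_mono)
    fix X :: real
    from ennreal_lincomb[of "2 powr q" "(2 * C) powr q" "inverse (1 + X\<^sup>2)" "D powr q" "\<bar>X\<bar> powr (- (\<theta> * q)) * indicator {-R..R} X"]
    show "ennreal (majorant C D R \<theta> X powr q) \<le> ennreal (2 powr q) * (ennreal ((2 * C) powr q) * ennreal (inverse (1 + X\<^sup>2)) +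
       ennreal (D powr q) * ennreal (\<bar>X\<bar> powr (- (\<theta> * q)) * indicator {-R..R} X))"
      using ennreal_leI[OF pw[of X]] by (simp add: add_nonneg_nonneg)
  qed
  also have "\<dots> = ennreal (2 powr q) * (ennreal ((2 * C) powr q) * (\<integral>\<^sup>+X. ennreal (inverse (1 + X\<^sup>2)) \<partial>lborel) +
       ennreal (D powr q) * (\<integral>\<^sup>+X. ennreal (\<bar>X\<bar> powr (- (\<theta> * q)) * indicator {-R..R} X) \<partial>lborel))"
    by (simp add: nn_integral_cmult nn_integral_add)
  also have "\<dots> \<le> ennreal (2 powr q) * (ennreal ((2 * C) powr q) * ennreal pi +
       ennreal (D powr q) * ennreal (2 * (R powr (- (\<theta> * q) + 1) / (- (\<theta> * q) + 1))))"
    unfolding nn_integral_inverse_1_plus_square using assms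
    by (intro mult_left_mono add_left_mono nn_integral_powr_symmetric) auto
  also have "\<dots> = ennreal (2 powr q * ((2 * C) powr q * pi + D powr q * (2 * (R powr (1 - \<theta> * q) / (1 - \<theta> * q)))))"
    using assms by (subst ennreal_lincomb) (auto simp: add.commute)
  finally show ?thesis .
qed

lemma exists_dyadic:
  fixes r :: real
  assumes "r > 1"
  obtains k :: nat where "k \<ge> 1" "2 ^ k / 2 < r" "r \<le> 2 ^ k"
proof -
  obtain n :: nat where n: "r \<le> 2 ^ n"
    using real_arch_pow[of 2 r] by (auto intro: less_imp_le)
  define k where "k = (LEAST k. r \<le> (2::real) ^ k)"
  have k: "r \<le> 2 ^ k" unfolding k_def by (rule LeastI[of _ n]) (rule n)
  have "k \<noteq> 0" using k assms by (intro notI) simp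
  then have "\<not> r \<le> 2 ^ (k - 1)" unfolding k_def by (intro not_less_Least) (simp flip: k_def)
  then show thesis using that[of k] k \<open>k \<noteq> 0\<close> by (cases k) auto
qed

text \<open>The weight \<open>w (\<zeta> / 2^k)\<close> has the kernel of \<open>w\<close> at
  \<open>X = 2^k x\<close>, \<open>T = 2^(3k) t\<close>, times \<open>2^(dk)\<close>. Where
  \<open>|X| < C0 |T|\<close>, the decay \<open>|T|^(-\<theta>)\<close> is at most a multiple of
  \<open>|X|^(-\<theta>)\<close>, so the time disappears and \<open>majorant\<close> bounds the
  kernel. Its \<open>L^(p/2)\<close> norm grows at most like \<open>2^(Ek)\<close>, while covering
  \<open>(1 + |\<zeta>|^2)^(-s)\<close> takes only coefficients of order
  \<open>2^(-2sk)\<close>.\<close>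

theorem maximal_estimate_of_unit_kernel:
  fixes w0 w :: "real \<times> 'y::euclidean_space \<Rightarrow> real" and p s \<theta> C C0 c0 :: real
  assumes p: "p \<ge> 2" and s: "s \<ge> 0" and \<theta>: "0 < \<theta>" "\<theta> * (p/2) < 1"
    and exponents: "2 * s > real DIM(real \<times> 'y) + 4/p - 3 * \<theta>"
    and pos: "C > 0" "C0 \<ge> 1" "c0 > 0"
    and w0: "integrable lborel w0" "\<And>\<zeta>. 0 \<le> w0 \<zeta>"
    and w: "integrable lborel w" "\<And>\<zeta>. 0 \<le> w \<zeta>"
    and bnd0: "\<And>x y T. norm (evol (\<lambda>\<zeta>. of_real (w0 \<zeta>)) x (y, T)) \<le> C"
    and bnd: "\<And>x y T. norm (evol (\<lambda>\<zeta>. of_real (w \<zeta>)) x (y, T)) \<le> C"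
    and tail0: "\<And>x y T. C0 * \<bar>T\<bar> \<le> \<bar>x\<bar> \<Longrightarrow> x \<noteq> 0 \<Longrightarrow> norm (evol (\<lambda>\<zeta>. of_real (w0 \<zeta>)) x (y, T)) \<le> C / x\<^sup>2"
    and tail: "\<And>x y T. C0 * \<bar>T\<bar> \<le> \<bar>x\<bar> \<Longrightarrow> x \<noteq> 0 \<Longrightarrow> norm (evol (\<lambda>\<zeta>. of_real (w \<zeta>)) x (y, T)) \<le> C / x\<^sup>2"
    and decay: "\<And>x y T. T \<noteq> 0 \<Longrightarrow> norm (evol (\<lambda>\<zeta>. of_real (w \<zeta>)) x (y, T)) \<le> C * \<bar>T\<bar> powr (- \<theta>)"
    and cover0: "\<And>\<zeta>. norm \<zeta> \<le> 1/2 \<Longrightarrow> c0 \<le> w0 \<zeta>"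
    and cover: "\<And>\<zeta>. 1/4 \<le> norm \<zeta> \<Longrightarrow> norm \<zeta> \<le> 1/2 \<Longrightarrow> c0 \<le> w \<zeta>"
  shows "maximal_estimate TYPE('y) p s"
proof -
  define d where "d = DIM(real \<times> 'y)"
  define l where "l = (\<lambda>k::nat. 2 ^ k :: real)"
  have l: "l k > 0" "l k \<ge> 1" for k by (auto simp: l_def)
  define v where "v = (\<lambda>k::nat. if k = 0 then w0 else w)"
  define D where "D = C * C0 powr \<theta>"
  have D: "D > 0" using pos by (simp add: D_def)
  define wk where "wk = (\<lambda>k \<zeta>. v k (\<zeta> /\<^sub>R l k))"
  define \<kappa> where "\<kappa> = (\<lambda>k x. l k ^ d * majorant C D (C0 * l k ^ 3) \<theta> (l k * x))"
  define q where "q = p / 2"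
  have q: "q \<ge> 1" "\<theta> * q < 1" "q > 0" using p \<theta> by (auto simp: q_def)
  \<comment> \<open>Exponent count with \<open>q = p/2\<close>: \<open>d\<close> from the prefactor,
    \<open>-1/q\<close> from rescaling \<open>x\<close>, and \<open>3 (1 - \<theta> q) / q\<close>
    from integrating \<open>|X|^(-\<theta> q)\<close> up to \<open>C0 * 2^(3k)\<close>.\<close>
  define E where "E = real d + 4/p - 3 * \<theta>"
  define C1 where "C1 = 2 powr q * ((2 * C) powr q * pi + D powr q * (2 * (C0 powr (1 - \<theta> * q) / (1 - \<theta> * q))))"
  have C1: "C1 > 0" unfolding C1_def using pos D q
    by (intro mult_pos_pos add_pos_nonneg mult_nonneg_nonneg divide_nonneg_nonneg) auto
  define B where "B = (\<lambda>k. C1 powr (1/q) * l k powr E)"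
  \<comment> \<open>The factor \<open>4 powr (2 * s)\<close> compensates that
    \<open>|\<zeta>|\<close> may come down to \<open>2^k / 4\<close> in the annulus of index
    \<open>k\<close>.\<close>
  define c1 where "c1 = 4 powr (2 * s) / c0"
  have c1: "c1 > 0" using pos by (simp add: c1_def)
  define c where "c = (\<lambda>k. c1 * l k powr (- 2 * s))"
  have v: "integrable lborel (v k)" "0 \<le> v k \<zeta>" for k \<zeta> using w w0 by (auto simp: v_def)
  have maj0: "majorant C D R \<theta> X \<ge> 0" for R X
    using pos D unfolding majorant_def by (intro add_nonneg_nonneg mult_nonneg_nonneg) auto
  show ?thesis
  proof (rule maximal_estimate_of_kernels[OF p, where w=wk and \<kappa>=\<kappa> and B=B and c=c])
    fix k
    have [measurable]: "v k \<in> borel_measurable borel" using v by auto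
    show "integrable lborel (wk k)"
    proof -
      have "integrable (density (distr lborel borel (\<lambda>\<zeta>. 0 + l k *\<^sub>R \<zeta>)) (\<lambda>_. ennreal (\<bar>l k\<bar> ^ DIM(real \<times> 'y)))) (wk k)"
        unfolding wk_def using l[of k] v(1)[of k]
        by (subst integrable_density) (simp_all add: integrable_distr_eq)
      then show ?thesis using lborel_affine[of "l k" "0 :: real \<times> 'y"] l[of k] by simp
    qed
    show "0 \<le> wk k \<zeta>" for \<zeta> by (simp add: wk_def v)
    show "\<kappa> k \<in> borel_measurable borel" unfolding \<kappa>_def by measurable
    show "B k > 0" using C1 l[of k] by (simp add: B_def)
    show "c k \<ge> 0" using c1 l[of k] by (simp add: c_def)
    show "norm (evol (\<lambda>\<zeta>. of_real (wk k \<zeta>)) x (y, t)) \<le> \<kappa> k x" if t: "\<bar>t\<bar> \<le> 1" for x y t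
    proof -
      define X T where "X = l k * x" and "T = l k ^ 3 * t"
      have T: "\<bar>T\<bar> \<le> l k ^ 3" using t l[of k] by (simp add: T_def abs_mult mult_left_le)
      let ?K = "evol (\<lambda>\<zeta>. of_real (v k \<zeta>)) X (l k *\<^sub>R y, T)"
      have KC: "norm ?K \<le> C" using bnd0 bnd by (simp add: v_def)
      have "norm ?K \<le> majorant C D (C0 * l k ^ 3) \<theta> X"
      proof -
        have m1: "2 * C * inverse (1 + X\<^sup>2) \<le> majorant C D (C0 * l k ^ 3) \<theta> X"
          unfolding majorant_def using D by simp
        consider "X = 0" | "X \<noteq> 0" "C0 * \<bar>T\<bar> \<le> \<bar>X\<bar>" | "X \<noteq> 0" "\<bar>X\<bar> < C0 * \<bar>T\<bar>" by linarith
        then show ?thesis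
        proof cases
          case 1
          then show ?thesis using KC m1 pos by simp
        next
          case 2
          have "norm ?K \<le> C / X\<^sup>2" using tail0 tail 2 by (simp add: v_def)
          then have "norm ?K * X\<^sup>2 \<le> C" using 2 by (simp add: field_simps)
          with KC have "norm ?K * (1 + X\<^sup>2) \<le> 2 * C" by (simp add: distrib_left)
          then have "norm ?K \<le> 2 * C * inverse (1 + X\<^sup>2)"
            by (simp add: field_simps add_pos_nonneg)
          then show ?thesis using m1 by linarith
        next
          case 3
          then have T0: "T \<noteq> 0" by auto
          have "\<bar>X\<bar> \<le> C0 * l k ^ 3"
            using 3 T pos by (meson less_imp_le mult_left_mono order_trans less_le_trans zero_less_one)
          then have "X \<in> {- (C0 * l k ^ 3)..C0 * l k ^ 3}" by (auto simp: abs_le_iff)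
          then have m2: "D * \<bar>X\<bar> powr (- \<theta>) \<le> majorant C D (C0 * l k ^ 3) \<theta> X"
            unfolding majorant_def using pos by simp
          have "norm ?K \<le> C * \<bar>T\<bar> powr (- \<theta>)"
          \<comment> \<open>For \<open>k = 0\<close> the weight is \<open>w0\<close>, which comes
            without a decay hypothesis. But then \<open>|T| \<le> 1\<close>, so
            \<open>|T| powr (- \<theta>) \<ge> 1\<close> and the uniform bound \<open>C\<close> is
            enough.\<close>
          proof (cases "k = 0")
            case True
            then have "\<bar>T\<bar> \<le> 1" using T by (simp add: l_def)
            then have "1 \<le> \<bar>T\<bar> powr (- \<theta>)" using powr_mono2'[of "- \<theta>" "\<bar>T\<bar>" 1] T0 \<theta> by simp
            then show ?thesis using KC pos mult_left_mono[of 1 "\<bar>T\<bar> powr (- \<theta>)" C] by linarith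
          next
            case False
            then show ?thesis using decay[OF T0] by (simp add: v_def)
          qed
          also have "\<bar>T\<bar> powr (- \<theta>) \<le> (\<bar>X\<bar> / C0) powr (- \<theta>)"
            using 3 pos \<theta> by (intro powr_mono2') (auto simp: field_simps)
          also have "C * (\<bar>X\<bar> / C0) powr (- \<theta>) = D * \<bar>X\<bar> powr (- \<theta>)"
            using pos by (simp add: D_def powr_divide powr_minus field_simps)
          finally show ?thesis using m2 pos by (simp add: mult_left_mono)
        qed
      qed
      moreover have "evol (\<lambda>\<zeta>. of_real (wk k \<zeta>)) x (y, t) = of_real (l k ^ d) * ?K"
        using evol_scale[OF l(1)[of k], where v="\<lambda>\<zeta>. of_real (v k \<zeta>)" and x=x and y=y and t=t]
        by (simp add: wk_def d_def X_def T_def)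
      ultimately show ?thesis
        using l[of k] by (simp add: \<kappa>_def norm_mult norm_power X_def mult_left_mono)
    qed
    show "(\<integral>\<^sup>+x. ennreal (\<kappa> k x powr (p/2)) \<partial>lborel) \<le> ennreal (B k powr (p/2))"
    proof -
      let ?g = "\<lambda>X. ennreal (majorant C D (C0 * l k ^ 3) \<theta> X powr q)"
      have sc: "(\<integral>\<^sup>+x. ?g (l k * x) \<partial>lborel) = ennreal (1 / l k) * (\<integral>\<^sup>+X. ?g X \<partial>lborel)"
      proof -
        have "(\<integral>\<^sup>+X. ?g X \<partial>lborel) = ennreal (l k) * (\<integral>\<^sup>+x. ?g (l k * x) \<partial>lborel)"
          using nn_integral_real_affine[of ?g "l k" 0] l[of k] by simp
        then have "ennreal (1 / l k) * (\<integral>\<^sup>+X. ?g X \<partial>lborel) = ennreal (1 / l k * l k) * (\<integral>\<^sup>+x. ?g (l k * x) \<partial>lborel)"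
          using l[of k] by (subst ennreal_mult) (simp_all add: mult.assoc)
        then show ?thesis using l[of k] by simp
      qed
      have "(\<integral>\<^sup>+x. ennreal (\<kappa> k x powr (p/2)) \<partial>lborel) =
        (\<integral>\<^sup>+x. ennreal ((l k ^ d) powr q) * ?g (l k * x) \<partial>lborel)"
        using l[of k] maj0 by (intro nn_integral_cong) (simp add: \<kappa>_def powr_mult ennreal_mult flip: q_def)
      also have "\<dots> = ennreal ((l k ^ d) powr q) * (ennreal (1 / l k) * (\<integral>\<^sup>+X. ?g X \<partial>lborel))"
        by (subst nn_integral_cmult) (auto simp: sc)
      also have "\<dots> \<le> ennreal ((l k ^ d) powr q) * (ennreal (1 / l k) * ennreal (2 powr q * ((2 * C) powr q * pi
          + D powr q * (2 * ((C0 * l k ^ 3) powr (1 - \<theta> * q) / (1 - \<theta> * q))))))"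
        using pos D l[of k] q by (intro mult_left_mono nn_integral_majorant) auto
      also have "\<dots> \<le> ennreal ((l k ^ d) powr q) * (ennreal (1 / l k) * ennreal (C1 * (l k ^ 3) powr (1 - \<theta> * q)))"
      proof (intro mult_left_mono ennreal_leI)
        define L where "L = (l k ^ 3) powr (1 - \<theta> * q)"
        have L: "L \<ge> 1" unfolding L_def using l[of k] q by (intro ge_one_powr_ge_zero) auto
        have "(2 * C) powr q * pi \<le> (2 * C) powr q * pi * L"
          using mult_left_mono[of 1 L "(2 * C) powr q * pi"] L by simp
        then have "2 powr q * ((2 * C) powr q * pi + D powr q * (2 * (C0 powr (1 - \<theta> * q) * L / (1 - \<theta> * q)))) \<le>
          2 powr q * ((2 * C) powr q * pi * L + D powr q * (2 * (C0 powr (1 - \<theta> * q) * L / (1 - \<theta> * q))))"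
          by (intro mult_left_mono add_right_mono) auto
        also have "\<dots> = C1 * L" unfolding C1_def by (simp add: algebra_simps)
        finally show "2 powr q * ((2 * C) powr q * pi + D powr q * (2 * ((C0 * l k ^ 3) powr (1 - \<theta> * q) / (1 - \<theta> * q)))) \<le>
          C1 * (l k ^ 3) powr (1 - \<theta> * q)"
          using pos l[of k] unfolding L_def by (simp add: powr_mult)
      qed auto
      also have "\<dots> = ennreal ((l k ^ d) powr q * (1 / l k * (C1 * (l k ^ 3) powr (1 - \<theta> * q))))"
        using l[of k] C1 by (simp flip: ennreal_mult)
      also have "(l k ^ d) powr q * (1 / l k * (C1 * (l k ^ 3) powr (1 - \<theta> * q))) = B k powr q"
      proof -
        have "B k powr q = C1 * l k powr (E * q)"
          using C1 l[of k] q by (simp add: B_def powr_mult powr_powr)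
        also have "E * q = real d * q + -1 + 3 * (1 - \<theta> * q)"
          unfolding E_def q_def using p by (simp add: field_simps)
        also have "l k powr \<dots> = (l k ^ d) powr q * (1 / l k) * (l k ^ 3) powr (1 - \<theta> * q)"
        proof -
          have "(l k ^ d) powr q = l k powr (real d * q)" "(l k ^ 3) powr (1 - \<theta> * q) = l k powr (3 * (1 - \<theta> * q))"
            using l[of k] powr_powr[of "l k" "real d" q] powr_powr[of "l k" 3 "1 - \<theta> * q"]
            by (simp_all add: powr_realpow powr_numeral)
          moreover have "1 / l k = l k powr (-1)" using l[of k] by (simp add: powr_minus_divide)
          ultimately show ?thesis by (simp only: powr_add)
        qed
        finally show ?thesis by (simp add: mult_ac)
      qed
      finally show ?thesis by (simp add: q_def)
    qed
  next
    define r where "r = 2 powr (E - 2 * s)"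
    have "r < 1" unfolding r_def using exponents by (simp add: E_def d_def powr_less_one)
    have "(\<lambda>k. c k * B k) = (\<lambda>k. c1 * C1 powr (1/q) * r ^ k)"
    proof
      fix k
      have "l k powr (- 2 * s) * l k powr E = l k powr (E - 2 * s)" by (simp flip: powr_add)
      also have "\<dots> = r ^ k"
        unfolding r_def l_def by (simp add: powr_powr mult.commute flip: powr_realpow)
      finally show "c k * B k = c1 * C1 powr (1/q) * r ^ k" by (simp add: c_def B_def)
    qed
    moreover have "summable (\<lambda>k. c1 * C1 powr (1/q) * r ^ k)"
      using \<open>r < 1\<close> by (intro summable_mult summable_geometric) (simp add: r_def)
    ultimately show "summable (\<lambda>k. c k * B k)" by simp
  next
    fix \<zeta> :: "real \<times> 'y"
    \<comment> \<open>A single index does it: 0 if \<open>|\<zeta>| \<le> 1/2\<close>, otherwise the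
      \<open>k \<ge> 1\<close> with \<open>2^k / 4 < |\<zeta>| \<le> 2^k / 2\<close>.\<close>
    have one: "\<exists>k. (1 + (norm \<zeta>)\<^sup>2) powr (- s) \<le> c k * wk k \<zeta>"
    proof (cases "norm \<zeta> \<le> 1/2")
      case True
      have "(1 + (norm \<zeta>)\<^sup>2) powr (- s) \<le> (1 + (norm \<zeta>)\<^sup>2) powr 0"
        using s by (intro powr_mono) auto
      also have "\<dots> = 1" by (simp add: add_nonneg_eq_0_iff)
      also have "1 \<le> 4 powr (2 * s)" using s by (intro ge_one_powr_ge_zero) auto
      also have "\<dots> = c1 * c0" using pos by (simp add: c1_def)
      also have "\<dots> \<le> c1 * w0 \<zeta>" using c1 cover0[OF True] by simp
      also have "\<dots> = c 0 * wk 0 \<zeta>" by (simp add: c_def wk_def v_def l_def)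
      finally show ?thesis by blast
    next
      case False
      then obtain k :: nat where k: "k \<ge> 1" "2 ^ k / 4 < norm \<zeta>" "norm \<zeta> \<le> 2 ^ k / 2"
        using exists_dyadic[of "2 * norm \<zeta>"] by (force simp: field_simps)
      have "(1 + (norm \<zeta>)\<^sup>2) powr (- s) \<le> ((norm \<zeta>)\<^sup>2) powr (- s)"
        using s False by (intro powr_mono2') (auto intro!: zero_less_power)
      also have "\<dots> \<le> ((l k / 4)\<^sup>2) powr (- s)"
        using s k l[of k] by (intro powr_mono2' power_mono) (auto simp: l_def)
      also have "\<dots> = (l k / 4) powr (- 2 * s)"
        using l[of k] by (simp add: powr_powr flip: powr_numeral)
      also have "\<dots> = 4 powr (2 * s) * l k powr (- 2 * s)"
        using l[of k] by (simp add: powr_divide powr_minus field_simps)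
      also have "\<dots> = c k * c0" using pos by (simp add: c_def c1_def)
      also have "\<dots> \<le> c k * wk k \<zeta>"
        using k l[of k] c1 by (intro mult_left_mono) (auto simp: wk_def v_def l_def c_def intro!: cover simp: field_simps)
      finally show ?thesis by blast
    qed
    then obtain k where "(1 + (norm \<zeta>)\<^sup>2) powr (- s) \<le> c k * wk k \<zeta>" by blast
    then have "ennreal ((1 + (norm \<zeta>)\<^sup>2) powr (- s)) \<le> (\<Sum>k\<in>{k}. ennreal (c k * wk k \<zeta>))"
      by (simp add: ennreal_leI)
    also have "\<dots> \<le> (\<Sum>k. ennreal (c k * wk k \<zeta>))"
      by (rule sum_le_suminf) auto
    finally show "ennreal ((1 + (norm \<zeta>)\<^sup>2) powr (- s)) \<le> (\<Sum>k. ennreal (c k * wk k \<zeta>))" .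
  qed
qed

subsection \<open>Product integrals and a linear change of variables\<close>

text \<open>Multiples of the only basis vector identify a one-dimensional Euclidean space with the
  real line; comparing the measures of boxes shows that Lebesgue measure corresponds.\<close>

lemma nn_integral_scaleR_Basis:
  fixes f :: "'y::euclidean_space \<Rightarrow> ennreal"
  assumes b: "Basis = {b :: 'y}" and [measurable]: "f \<in> borel_measurable borel"
  shows "(\<integral>\<^sup>+\<eta>. f \<eta> \<partial>lborel) = (\<integral>\<^sup>+v. f (v *\<^sub>R b) \<partial>lborel)"
proof -
  have [measurable]: "(\<lambda>v. f (v *\<^sub>R b)) \<in> borel_measurable borel" by measurable
  have \<eta>: "(\<eta> \<bullet> b) *\<^sub>R b = \<eta>" for \<eta>
    using euclidean_representation[of \<eta>] by (simp add: b)
  have M: "(lborel :: 'y measure) = distr lborel borel (\<lambda>v. v *\<^sub>R b)"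
  proof (rule lborel_eqI)
    fix l u :: 'y assume "\<And>b. b \<in> Basis \<Longrightarrow> l \<bullet> b \<le> u \<bullet> b"
    then have le: "l \<bullet> b \<le> u \<bullet> b" by (simp add: b)
    have "b \<bullet> b = 1" using inner_Basis[of b b] by (simp add: b)
    then have "(\<lambda>v. v *\<^sub>R b) -` box l u \<inter> space lborel = {l \<bullet> b<..<u \<bullet> b}"
      by (auto simp: box_def b)
    then show "emeasure (distr lborel borel (\<lambda>v. v *\<^sub>R b)) (box l u) = ennreal (\<Prod>b\<in>Basis. (u - l) \<bullet> b)"
      using le by (subst emeasure_distr) (auto simp: b inner_diff_left)
  qed simp
  show ?thesis
    by (subst M) (simp add: nn_integral_distr)
qed

text \<open>Two substitutions in one variable each:
  \<open>v = - \<delta> r / \<gamma> + 2 \<delta> A\<close> for fixed \<open>r\<close>, then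
  \<open>r = \<gamma> A + \<gamma> B\<close> for fixed \<open>A\<close>. Their factors
  \<open>2 \<delta>\<close> and \<open>\<gamma>\<close> give the Jacobian.\<close>

lemma nn_integral_sheared_plane:
  fixes f :: "real \<times> 'y::euclidean_space \<Rightarrow> ennreal"
  assumes b: "Basis = {b :: 'y}" and \<gamma>\<delta>: "\<gamma> > 0" "\<delta> > 0" and [measurable]: "f \<in> borel_measurable borel"
  shows "(\<integral>\<^sup>+\<zeta>. f \<zeta> \<partial>lborel) =
    ennreal (2 * \<gamma> * \<delta>) * (\<integral>\<^sup>+z. f (\<gamma> * (fst z + snd z), (\<delta> * (fst z - snd z)) *\<^sub>R b) \<partial>lborel)"
proof -
  have fm: "f \<in> borel_measurable (borel \<Otimes>\<^sub>M borel)" by (simp add: borel_prod)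
  have [measurable]: "(\<lambda>p. f (g p, h p *\<^sub>R b)) \<in> borel_measurable M"
    if "g \<in> borel_measurable M" "h \<in> borel_measurable M" for g h and M :: "'q measure"
    using that by (intro measurable_compose[OF _ \<open>f \<in> borel_measurable borel\<close>] borel_measurable_Pair) auto
  have "(\<integral>\<^sup>+\<zeta>. f \<zeta> \<partial>lborel) = (\<integral>\<^sup>+r. \<integral>\<^sup>+\<eta>. f (r, \<eta>) \<partial>lborel \<partial>lborel)"
    by (subst lborel.nn_integral_fst) (simp_all add: lborel_prod)
  also have "\<dots> = (\<integral>\<^sup>+r. \<integral>\<^sup>+v. f (r, v *\<^sub>R b) \<partial>lborel \<partial>lborel)"
    by (intro nn_integral_cong nn_integral_scaleR_Basis[OF b]) simp
  also have "\<dots> = (\<integral>\<^sup>+r. ennreal (2 * \<delta>) * (\<integral>\<^sup>+A. f (r, (- (\<delta> * r / \<gamma>) + 2 * \<delta> * A) *\<^sub>R b) \<partial>lborel) \<partial>lborel)"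
  proof (intro nn_integral_cong)
    fix r
    show "(\<integral>\<^sup>+v. f (r, v *\<^sub>R b) \<partial>lborel) =
        ennreal (2 * \<delta>) * (\<integral>\<^sup>+A. f (r, (- (\<delta> * r / \<gamma>) + 2 * \<delta> * A) *\<^sub>R b) \<partial>lborel)"
      using \<gamma>\<delta> by (subst nn_integral_real_affine[where c="2 * \<delta>" and t="- (\<delta> * r / \<gamma>)"]) auto
  qed
  also have "\<dots> = ennreal (2 * \<delta>) * (\<integral>\<^sup>+r. \<integral>\<^sup>+A. f (r, (- (\<delta> * r / \<gamma>) + 2 * \<delta> * A) *\<^sub>R b) \<partial>lborel \<partial>lborel)"
    by (rule nn_integral_cmult) simp
  also have "(\<integral>\<^sup>+r. \<integral>\<^sup>+A. f (r, (- (\<delta> * r / \<gamma>) + 2 * \<delta> * A) *\<^sub>R b) \<partial>lborel \<partial>lborel) =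
    (\<integral>\<^sup>+A. \<integral>\<^sup>+r. f (r, (- (\<delta> * r / \<gamma>) + 2 * \<delta> * A) *\<^sub>R b) \<partial>lborel \<partial>lborel)"
    by (rule lborel_pair.Fubini') simp
  also have "\<dots> = (\<integral>\<^sup>+A. ennreal \<gamma> * (\<integral>\<^sup>+B. f (\<gamma> * A + \<gamma> * B, (- (\<delta> * (\<gamma> * A + \<gamma> * B) / \<gamma>) + 2 * \<delta> * A) *\<^sub>R b) \<partial>lborel) \<partial>lborel)"
  proof (intro nn_integral_cong)
    fix A
    show "(\<integral>\<^sup>+r. f (r, (- (\<delta> * r / \<gamma>) + 2 * \<delta> * A) *\<^sub>R b) \<partial>lborel) =
        ennreal \<gamma> * (\<integral>\<^sup>+B. f (\<gamma> * A + \<gamma> * B, (- (\<delta> * (\<gamma> * A + \<gamma> * B) / \<gamma>) + 2 * \<delta> * A) *\<^sub>R b) \<partial>lborel)"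
      using \<gamma>\<delta> by (subst nn_integral_real_affine[where c="\<gamma>" and t="\<gamma> * A"]) auto
  qed
  also have "\<dots> = ennreal \<gamma> * (\<integral>\<^sup>+A. \<integral>\<^sup>+B. f (\<gamma> * A + \<gamma> * B, (- (\<delta> * (\<gamma> * A + \<gamma> * B) / \<gamma>) + 2 * \<delta> * A) *\<^sub>R b) \<partial>lborel \<partial>lborel)"
    by (rule nn_integral_cmult) simp
  also have "(\<lambda>A B. f (\<gamma> * A + \<gamma> * B, (- (\<delta> * (\<gamma> * A + \<gamma> * B) / \<gamma>) + 2 * \<delta> * A) *\<^sub>R b)) =
    (\<lambda>A B. f (\<gamma> * (A + B), (\<delta> * (A - B)) *\<^sub>R b))"
  proof (intro ext)
    fix A B
    have "- (\<delta> * (\<gamma> * A + \<gamma> * B) / \<gamma>) + 2 * \<delta> * A = \<delta> * (A - B)"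
      using \<gamma>\<delta> by (simp add: field_simps)
    then show "f (\<gamma> * A + \<gamma> * B, (- (\<delta> * (\<gamma> * A + \<gamma> * B) / \<gamma>) + 2 * \<delta> * A) *\<^sub>R b) =
      f (\<gamma> * (A + B), (\<delta> * (A - B)) *\<^sub>R b)" by (simp only: distrib_left)
  qed
  also have "(\<integral>\<^sup>+A. \<integral>\<^sup>+B. f (\<gamma> * (A + B), (\<delta> * (A - B)) *\<^sub>R b) \<partial>lborel \<partial>lborel) =
    (\<integral>\<^sup>+z. f (\<gamma> * (fst z + snd z), (\<delta> * (fst z - snd z)) *\<^sub>R b) \<partial>lborel)"
  proof -
    have L: "(\<lambda>z. (\<gamma> * (fst z + snd z), (\<delta> * (fst z - snd z)) *\<^sub>R b)) \<in> borel_measurable borel"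
      by (intro borel_measurable_continuous_onI continuous_intros)
    have "(\<lambda>z. f (\<gamma> * (fst z + snd z), (\<delta> * (fst z - snd z)) *\<^sub>R b)) \<in> borel_measurable borel"
      by (rule measurable_compose[OF L]) simp
    then show ?thesis
      using lborel.nn_integral_fst[of "\<lambda>z. f (\<gamma> * (fst z + snd z), (\<delta> * (fst z - snd z)) *\<^sub>R b)" lborel]
      by (simp add: lborel_prod)
  qed
  finally show ?thesis using \<gamma>\<delta> by (simp add: ennreal_mult mult_ac)
qed

text \<open>The substitution for indicator functions, restated as an equality of measures, transfers
  to Bochner integrals of complex functions.\<close>

lemma lborel_sheared_plane:
  assumes b: "Basis = {b :: 'y::euclidean_space}" and \<gamma>\<delta>: "\<gamma> > 0" "\<delta> > 0"
  shows "(lborel :: (real \<times> 'y) measure) =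
    density (distr lborel borel (\<lambda>z. (\<gamma> * (fst z + snd z), (\<delta> * (fst z - snd z)) *\<^sub>R b))) (\<lambda>_. ennreal (2 * \<gamma> * \<delta>))"
    (is "_ = density (distr _ _ ?L) _")
proof (rule measure_eqI)
  have [measurable]: "?L \<in> borel_measurable borel"
    by (intro borel_measurable_continuous_onI continuous_intros)
  fix A :: "(real \<times> 'y) set" assume "A \<in> sets lborel"
  then have [measurable]: "A \<in> sets borel" by simp
  have "emeasure lborel A = (\<integral>\<^sup>+\<zeta>. indicator A \<zeta> \<partial>lborel)" by simp
  also have "\<dots> = ennreal (2 * \<gamma> * \<delta>) * (\<integral>\<^sup>+z. indicator A (?L z) \<partial>lborel)"
    by (rule nn_integral_sheared_plane[OF b \<gamma>\<delta>]) simp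
  also have "(\<integral>\<^sup>+z. indicator A (?L z) \<partial>lborel) = (\<integral>\<^sup>+z. indicator A z \<partial>distr lborel borel ?L)"
    by (simp add: nn_integral_distr del: nn_integral_indicator)
  also have "ennreal (2 * \<gamma> * \<delta>) * \<dots> = emeasure (density (distr lborel borel ?L) (\<lambda>_. ennreal (2 * \<gamma> * \<delta>))) A"
    by (simp add: emeasure_density nn_integral_cmult)
  finally show "emeasure lborel A = \<dots>" .
qed simp

lemma integral_sheared_plane:
  fixes f :: "real \<times> 'y::euclidean_space \<Rightarrow> complex"
  assumes b: "Basis = {b :: 'y}" and \<gamma>\<delta>: "\<gamma> > 0" "\<delta> > 0" and [measurable]: "f \<in> borel_measurable borel"
  shows "(LINT \<zeta>|lborel. f \<zeta>) =
      of_real (2 * \<gamma> * \<delta>) * (LINT z|lborel. f (\<gamma> * (fst z + snd z), (\<delta> * (fst z - snd z)) *\<^sub>R b))"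
    and "integrable lborel (\<lambda>z. f (\<gamma> * (fst z + snd z), (\<delta> * (fst z - snd z)) *\<^sub>R b)) \<Longrightarrow> integrable lborel f"
proof -
  let ?L = "\<lambda>z. (\<gamma> * (fst z + snd z), (\<delta> * (fst z - snd z)) *\<^sub>R b)"
  have [measurable]: "?L \<in> borel_measurable borel"
    by (intro borel_measurable_continuous_onI continuous_intros)
  have "(LINT \<zeta>|lborel. f \<zeta>) = (LINT z|lborel. (2 * \<gamma> * \<delta>) *\<^sub>R f (?L z))"
    using \<gamma>\<delta> by (subst lborel_sheared_plane[OF b \<gamma>\<delta>], subst integral_density) (auto simp: integral_distr)
  then show "(LINT \<zeta>|lborel. f \<zeta>) = of_real (2 * \<gamma> * \<delta>) * (LINT z|lborel. f (?L z))"
    by (simp add: scaleR_conv_of_real)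
  assume "integrable lborel (\<lambda>z. f (?L z))"
  then show "integrable lborel f"
    using \<gamma>\<delta> by (subst lborel_sheared_plane[OF b \<gamma>\<delta>], subst integrable_density) (auto simp: integrable_distr_eq)
qed

lemma integral_lborel_prod_Basis:
  fixes f :: "'a::euclidean_space \<Rightarrow> real \<Rightarrow> complex"
  assumes "\<And>b. b \<in> Basis \<Longrightarrow> integrable lborel (f b)"
  shows "(LINT x|lborel. (\<Prod>b\<in>Basis. f b (x \<bullet> b))) = (\<Prod>b\<in>Basis. LINT v|lborel. f b v)"
    and "integrable lborel (\<lambda>x. \<Prod>b\<in>Basis. f b (x \<bullet> b))"
proof -
  interpret product_sigma_finite "\<lambda>_::'a. lborel :: real measure" by standard
  let ?P = "\<Pi>\<^sub>M b\<in>(Basis::'a set). (lborel :: real measure)"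
  have fm[measurable]: "b \<in> Basis \<Longrightarrow> f b \<in> borel_measurable borel" for b using assms by auto
  have eq: "(\<Prod>b\<in>Basis. f b ((\<Sum>b\<in>Basis. z b *\<^sub>R b) \<bullet> b)) = (\<Prod>b\<in>Basis. f b (z b))" for z :: "'a \<Rightarrow> real"
    by (intro prod.cong refl) (simp add: inner_sum_left_Basis)
  have [measurable]: "(\<lambda>x. \<Prod>b\<in>Basis. f b (x \<bullet> b)) \<in> borel_measurable (borel :: 'a measure)" by measurable
  have [measurable]: "(\<lambda>z. \<Sum>b\<in>Basis. z b *\<^sub>R b) \<in> measurable ?P (borel :: 'a measure)" by measurable
  show "(LINT x|lborel. (\<Prod>b\<in>Basis. f b (x \<bullet> b))) = (\<Prod>b\<in>Basis. LINT v|lborel. f b v)"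
    by (subst lborel_eq, subst integral_distr) (simp_all add: eq product_integral_prod assms)
  show "integrable lborel (\<lambda>x. \<Prod>b\<in>Basis. f b (x \<bullet> b))"
    by (subst lborel_eq, subst integrable_distr_eq) (simp_all add: eq product_integrable_prod assms)
qed

lemma integral_prod_real2:
  fixes f g :: "real \<Rightarrow> complex"
  assumes f: "integrable lborel f" and g: "integrable lborel g"
  shows "(LINT z|lborel. f (fst z) * g (snd z)) = (LINT v|lborel. f v) * (LINT v|lborel. g v)"
    and "integrable lborel (\<lambda>z. f (fst z) * g (snd z))"
proof -
  have [measurable]: "f \<in> borel_measurable borel" "g \<in> borel_measurable borel" using f g by auto
  have int: "integrable (lborel \<Otimes>\<^sub>M lborel) (\<lambda>(x, y). f x * g y)"
  proof (rule lborel_pair.Fubini_integrable)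
    have "integrable lborel (\<lambda>x. norm (f x) * (LINT y|lborel. norm (g y)))" using f by auto
    then show "integrable lborel (\<lambda>x. LINT y|lborel. norm (case (x, y) of (x, y) \<Rightarrow> f x * g y))"
      by (simp add: norm_mult)
  qed (use g in auto)
  then show "integrable lborel (\<lambda>z. f (fst z) * g (snd z))"
    by (simp add: lborel_prod case_prod_beta')
  have "integral\<^sup>L (lborel \<Otimes>\<^sub>M lborel) (\<lambda>(x, y). f x * g y) = (LINT x|lborel. LINT y|lborel. f x * g y)"
    by (rule lborel_pair.integral_fst'[symmetric, OF int, unfolded prod.case])
  then show "(LINT z|lborel. f (fst z) * g (snd z)) = (LINT v|lborel. f v) * (LINT v|lborel. g v)"
    by (simp add: lborel_prod case_prod_beta')
qed

subsection \<open>Three space dimensions\<close>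

lemma cis_sum: "finite A \<Longrightarrow> cis (sum f A) = (\<Prod>a\<in>A. cis (f a))"
  by (induction A rule: finite_induct) (simp_all flip: cis_mult)

definition cube_weight :: "real \<times> 'y::euclidean_space \<Rightarrow> real" where
  "cube_weight \<zeta> = bump (-1) 1 (fst \<zeta>) * (\<Prod>b\<in>Basis. bump (-1) 1 (snd \<zeta> \<bullet> b))"

lemma cube_weight_nonneg: "0 \<le> cube_weight \<zeta>"
  by (simp add: cube_weight_def prod_nonneg)

lemma borel_measurable_bump_prod [measurable]:
  "(\<lambda>\<eta>::'y::euclidean_space. \<Prod>b\<in>Basis. bump (-1) 1 (\<eta> \<bullet> b)) \<in> borel_measurable borel"
  by measurable

lemma integrable_bump_prod:
  "integrable lborel (\<lambda>\<eta>::'y::euclidean_space. \<Prod>b\<in>Basis. bump (-1) 1 (\<eta> \<bullet> b))"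
proof -
  have "integrable lborel (\<lambda>\<eta>::'y. Re (\<Prod>b\<in>Basis. (\<lambda>b v. complex_of_real (bump (-1) 1 v)) b (\<eta> \<bullet> b)))"
    by (intro integrable_Re integral_lborel_prod_Basis) (simp add: integrable_bump)
  also have "(\<lambda>\<eta>::'y. Re (\<Prod>b\<in>Basis. (\<lambda>b v. complex_of_real (bump (-1) 1 v)) b (\<eta> \<bullet> b))) =
      (\<lambda>\<eta>. \<Prod>b\<in>Basis. bump (-1) 1 (\<eta> \<bullet> b))"
    by (simp flip: of_real_prod)
  finally show ?thesis .
qed

lemma integrable_cube_weight_pair:
  "integrable (lborel \<Otimes>\<^sub>M lborel) (\<lambda>(\<xi>, \<eta>::'y::euclidean_space). bump (-1) 1 \<xi> * (\<Prod>b\<in>Basis. bump (-1) 1 (\<eta> \<bullet> b)))"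
proof (rule lborel_pair.Fubini_integrable)
  have "integrable lborel (\<lambda>\<xi>. bump (-1) 1 \<xi> * (LINT \<eta>::'y|lborel. norm (\<Prod>b\<in>Basis. bump (-1) 1 (\<eta> \<bullet> b))))"
    by (simp add: integrable_bump)
  then show "integrable lborel (\<lambda>\<xi>. LINT \<eta>::'y|lborel. norm (case (\<xi>, \<eta>) of (\<xi>, \<eta>) \<Rightarrow> bump (-1) 1 \<xi> * (\<Prod>b\<in>Basis. bump (-1) 1 (\<eta> \<bullet> b))))"
    by (simp add: abs_mult)
  show "AE \<xi> in lborel. integrable lborel (\<lambda>\<eta>::'y. case (\<xi>, \<eta>) of (\<xi>, \<eta>) \<Rightarrow> bump (-1) 1 \<xi> * (\<Prod>b\<in>Basis. bump (-1) 1 (\<eta> \<bullet> b)))"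
    by (simp add: integrable_bump_prod)
qed measurable

lemma integrable_cube_weight: "integrable lborel (cube_weight :: real \<times> 'y::euclidean_space \<Rightarrow> real)"
  using integrable_cube_weight_pair[where 'y='y]
  by (simp add: lborel_prod cube_weight_def[abs_def] case_prod_beta')

text \<open>The two orders of integration serve two purposes. With \<open>\<eta>\<close> inside,
  there is one quadratic oscillatory integral with parameter \<open>T \<xi>\<close> per direction of
  \<open>\<eta>\<close>, the source of decay in \<open>T\<close>. With \<open>\<xi>\<close> inside,
  there is an \<open>osc\<close> at the shifted position \<open>x + T|\<eta>|^2\<close>, the source
  of the tail bound.\<close>

lemma evol_cube_weight:
  fixes y :: "'y::euclidean_space"
  shows "evol (\<lambda>\<zeta>. of_real (cube_weight \<zeta>)) x (y, T) =
      (LINT \<xi>|lborel. of_real (bump (-1) 1 \<xi>) * cis (x * \<xi> + T * \<xi> ^ 3) *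
        (\<Prod>b\<in>Basis. LINT v|lborel. cis ((y \<bullet> b) * v + (T * \<xi>) * v\<^sup>2) * of_real (bump (-1) 1 v)))" (is "_ = ?L")
    and "evol (\<lambda>\<zeta>. of_real (cube_weight \<zeta>)) x (y, T) =
      (LINT \<eta>|lborel. cis (y \<bullet> \<eta>) * of_real (\<Prod>b\<in>Basis. bump (-1) 1 (\<eta> \<bullet> b)) *
        osc (-1) 1 (x + T * (norm \<eta>)\<^sup>2) T)" (is "_ = ?R")
proof -
  let ?F = "\<lambda>z :: real \<times> 'y. cis ((x, y) \<bullet> z + T * dispersion z) * complex_of_real (cube_weight z)"
  have "integrable lborel ?F"
    by (rule integrable_cis_mult) (auto intro: integrable_cube_weight)
  then have int: "integrable (lborel \<Otimes>\<^sub>M lborel) ?F" by (simp only: lborel_prod)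
  have ev: "evol (\<lambda>\<zeta>. of_real (cube_weight \<zeta>)) x (y, T) = integral\<^sup>L (lborel \<Otimes>\<^sub>M lborel) ?F"
    by (simp only: evol_def lborel_prod fst_conv snd_conv)
  have 1: "integral\<^sup>L (lborel \<Otimes>\<^sub>M lborel) ?F = (LINT \<xi>|lborel. LINT \<eta>|lborel. ?F (\<xi>, \<eta>))"
    by (rule lborel_pair.integral_fst'[symmetric, OF int])
  have 2: "(LINT \<eta>|lborel. LINT \<xi>|lborel. ?F (\<xi>, \<eta>)) = (LINT \<xi>|lborel. LINT \<eta>|lborel. ?F (\<xi>, \<eta>))"
    by (rule lborel_pair.Fubini_integral) (use int in \<open>simp only: case_prod_beta' prod.collapse\<close>)
  have in1: "(LINT \<eta>|lborel. ?F (\<xi>, \<eta>)) = of_real (bump (-1) 1 \<xi>) * cis (x * \<xi> + T * \<xi> ^ 3) *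
        (\<Prod>b\<in>Basis. LINT v|lborel. cis ((y \<bullet> b) * v + (T * \<xi>) * v\<^sup>2) * of_real (bump (-1) 1 v))" for \<xi>
  proof -
    have "?F (\<xi>, \<eta>) = of_real (bump (-1) 1 \<xi>) * cis (x * \<xi> + T * \<xi> ^ 3) *
        (\<Prod>b\<in>Basis. cis ((y \<bullet> b) * (\<eta> \<bullet> b) + (T * \<xi>) * (\<eta> \<bullet> b)\<^sup>2) * of_real (bump (-1) 1 (\<eta> \<bullet> b)))" for \<eta>
    proof -
      have "(x, y) \<bullet> (\<xi>, \<eta>) + T * dispersion (\<xi>, \<eta>) =
        x * \<xi> + T * \<xi> ^ 3 + (\<Sum>b\<in>Basis. (y \<bullet> b) * (\<eta> \<bullet> b) + (T * \<xi>) * (\<eta> \<bullet> b)\<^sup>2)"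
      proof -
        have "(\<Sum>b\<in>Basis. (y \<bullet> b) * (\<eta> \<bullet> b) + (T * \<xi>) * (\<eta> \<bullet> b)\<^sup>2) = y \<bullet> \<eta> + T * \<xi> * (norm \<eta>)\<^sup>2"
          unfolding sum.distrib sum_distrib_left[symmetric] euclidean_inner[of y \<eta>] power2_norm_eq_inner euclidean_inner[of \<eta> \<eta>]
          by (simp add: power2_eq_square)
        then show ?thesis by (simp add: inner_prod_def dispersion_eq power2_eq_square power3_eq_cube algebra_simps)
      qed
      then have "cis ((x, y) \<bullet> (\<xi>, \<eta>) + T * dispersion (\<xi>, \<eta>)) = cis (x * \<xi> + T * \<xi> ^ 3) *
          (\<Prod>b\<in>Basis. cis ((y \<bullet> b) * (\<eta> \<bullet> b) + (T * \<xi>) * (\<eta> \<bullet> b)\<^sup>2))"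
        unfolding cis_sum[OF finite_Basis, symmetric] by (simp only: cis_mult)
      then show ?thesis by (simp only: cube_weight_def prod.distrib of_real_mult of_real_prod fst_conv snd_conv mult_ac)
    qed
    then have "(LINT \<eta>|lborel. ?F (\<xi>, \<eta>)) = of_real (bump (-1) 1 \<xi>) * cis (x * \<xi> + T * \<xi> ^ 3) *
        (LINT \<eta>|lborel. (\<Prod>b\<in>Basis. (\<lambda>b v. cis ((y \<bullet> b) * v + (T * \<xi>) * v\<^sup>2) * of_real (bump (-1) 1 v)) b (\<eta> \<bullet> b)))"
      by simp
    also have "(LINT \<eta>|lborel. (\<Prod>b\<in>Basis. (\<lambda>b v. cis ((y \<bullet> b) * v + (T * \<xi>) * v\<^sup>2) * of_real (bump (-1) 1 v)) b (\<eta> \<bullet> b)))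
      = (\<Prod>b\<in>Basis. LINT v|lborel. (\<lambda>b v. cis ((y \<bullet> b) * v + (T * \<xi>) * v\<^sup>2) * of_real (bump (-1) 1 v)) b v)"
      by (intro integral_lborel_prod_Basis integrable_cts_bump continuous_intros)
    finally show ?thesis .
  qed
  show "evol (\<lambda>\<zeta>. of_real (cube_weight \<zeta>)) x (y, T) = ?L"
    unfolding ev 1 in1 ..
  have in2: "(LINT \<xi>|lborel. ?F (\<xi>, \<eta>)) = cis (y \<bullet> \<eta>) * of_real (\<Prod>b\<in>Basis. bump (-1) 1 (\<eta> \<bullet> b)) *
        osc (-1) 1 (x + T * (norm \<eta>)\<^sup>2) T" for \<eta>
  proof -
    have "?F (\<xi>, \<eta>) = cis (y \<bullet> \<eta>) * of_real (\<Prod>b\<in>Basis. bump (-1) 1 (\<eta> \<bullet> b)) *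
        (cis ((x + T * (norm \<eta>)\<^sup>2) * \<xi> + T * \<xi> ^ 3) * of_real (bump (-1) 1 \<xi>))" for \<xi>
    proof -
      have "(x, y) \<bullet> (\<xi>, \<eta>) + T * dispersion (\<xi>, \<eta>) = y \<bullet> \<eta> + ((x + T * (norm \<eta>)\<^sup>2) * \<xi> + T * \<xi> ^ 3)"
        by (simp add: inner_prod_def dispersion_eq power2_eq_square power3_eq_cube algebra_simps)
      then have "cis ((x, y) \<bullet> (\<xi>, \<eta>) + T * dispersion (\<xi>, \<eta>)) =
          cis (y \<bullet> \<eta>) * cis ((x + T * (norm \<eta>)\<^sup>2) * \<xi> + T * \<xi> ^ 3)"
        by (simp only: cis_mult)
      then show ?thesis by (simp only: cube_weight_def of_real_mult fst_conv snd_conv mult_ac)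
    qed
    then show ?thesis unfolding osc_def by simp
  qed
  show "evol (\<lambda>\<zeta>. of_real (cube_weight \<zeta>)) x (y, T) = ?R"
    unfolding ev 1 2[symmetric] in2 ..
qed

text \<open>The decay is weakened from \<open>1/2\<close> to \<open>\<theta>/2\<close> on purpose:
  the product over two directions is then \<open>|T \<xi>|^(-\<theta>)\<close>, which for
  \<open>\<theta> < 1\<close> can still be integrated across \<open>\<xi> = 0\<close>.\<close>

lemma quadratic_decay_interp:
  assumes "0 < \<theta>" "\<theta> \<le> 1" "z \<noteq> 0"
  shows "norm (LINT v|lborel. cis (X * v + z * v\<^sup>2) * of_real (bump (-1) 1 v)) \<le> 288 * \<bar>z\<bar> powr (- \<theta> / 2)"
proof (cases "\<bar>z\<bar> \<le> 1")
  case True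
  have "norm (LINT v|lborel. cis (X * v + z * v\<^sup>2) * of_real (bump (-1) 1 v)) \<le> 32"
    by (intro norm_LINT_cis_bump_le continuous_intros) auto
  also have "32 \<le> 288 * (1::real)" by simp
  also have "1 \<le> \<bar>z\<bar> powr (- \<theta> / 2)" using True assms powr_mono2'[of "- \<theta> / 2" "\<bar>z\<bar>" 1] by simp
  finally show ?thesis by simp
next
  case False
  have "norm (LINT v|lborel. cis (X * v + z * v\<^sup>2) * of_real (bump (-1) 1 v)) \<le> 288 / sqrt \<bar>z\<bar>"
    by (rule quadratic_decay) (use assms in auto)
  also have "\<dots> = 288 * \<bar>z\<bar> powr (- 1 / 2)" by (simp add: powr_minus_divide powr_half_sqrt)
  also have "\<bar>z\<bar> powr (- 1 / 2) \<le> \<bar>z\<bar> powr (- \<theta> / 2)" using False assms by (intro powr_mono) auto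
  finally show ?thesis by simp
qed

lemma cube_kernel_decay:
  fixes y :: "'y::euclidean_space"
  assumes dim: "DIM('y) = 2" and \<theta>: "0 < \<theta>" "\<theta> < 1" and T: "T \<noteq> 0"
  shows "norm (evol (\<lambda>\<zeta>. of_real (cube_weight \<zeta>)) x (y, T)) \<le> (16 * 288\<^sup>2 * (2 / (1 - \<theta>))) * \<bar>T\<bar> powr (- \<theta>)"
proof -
  let ?Q = "\<lambda>\<xi> b. LINT v|lborel. cis ((y \<bullet> b) * v + (T * \<xi>) * v\<^sup>2) * of_real (bump (-1) 1 v)"
  have "ennreal (norm (evol (\<lambda>\<zeta>. of_real (cube_weight \<zeta>)) x (y, T))) \<le>
    (\<integral>\<^sup>+\<xi>. ennreal (norm (of_real (bump (-1) 1 \<xi>) * cis (x * \<xi> + T * \<xi> ^ 3) * (\<Prod>b\<in>Basis. ?Q \<xi> b))) \<partial>lborel)"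
    unfolding evol_cube_weight(1) by (rule norm_LINT_le_nn)
  also have "\<dots> \<le> (\<integral>\<^sup>+\<xi>. ennreal (16 * 288\<^sup>2 * \<bar>T\<bar> powr (- \<theta>)) * ennreal (\<bar>\<xi>\<bar> powr (- \<theta>) * indicator {-1..1} \<xi>) \<partial>lborel)"
  \<comment> \<open>The null set \<open>\<xi> = 0\<close> is excluded: there
    \<open>|\<xi>| powr (- \<theta>)\<close> is 0 by convention and cannot serve as a bound.\<close>
  proof (rule nn_integral_mono_AE, rule AE_mp[OF AE_lborel_singleton[of 0]], rule AE_I2, rule impI)
    fix \<xi> :: real assume "\<xi> \<noteq> 0"
    have "norm (\<Prod>b\<in>Basis. ?Q \<xi> b) = (\<Prod>b\<in>Basis. norm (?Q \<xi> b))" by (simp add: prod_norm)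
    also have "\<dots> \<le> (\<Prod>b\<in>(Basis::'y set). 288 * \<bar>T * \<xi>\<bar> powr (- \<theta> / 2))"
      using \<theta> T \<open>\<xi> \<noteq> 0\<close> by (intro prod_mono conjI norm_ge_zero quadratic_decay_interp) auto
    also have "\<dots> = 288\<^sup>2 * (\<bar>T\<bar> powr (- \<theta>) * \<bar>\<xi>\<bar> powr (- \<theta>))"
    proof -
      have "(288 * z powr (- \<theta> / 2))\<^sup>2 = 288\<^sup>2 * z powr (- \<theta>)" for z :: real
        unfolding power_mult_distrib by (simp add: power2_eq_square flip: powr_add)
      then show ?thesis by (simp add: dim abs_mult powr_mult power_mult_distrib)
    qed
    finally have Q: "norm (\<Prod>b\<in>Basis. ?Q \<xi> b) \<le> 288\<^sup>2 * (\<bar>T\<bar> powr (- \<theta>) * \<bar>\<xi>\<bar> powr (- \<theta>))" .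
    have "bump (-1) 1 \<xi> \<le> 16 * indicator {-1..1} \<xi>"
      using bump_le[of "-1" 1 \<xi>] by (auto simp: bump_def indicator_def)
    then have "bump (-1) 1 \<xi> * norm (\<Prod>b\<in>Basis. ?Q \<xi> b) \<le>
       (16 * indicator {-1..1} \<xi>) * (288\<^sup>2 * (\<bar>T\<bar> powr (- \<theta>) * \<bar>\<xi>\<bar> powr (- \<theta>)))"
      using Q by (intro mult_mono) auto
    then show "ennreal (norm (of_real (bump (-1) 1 \<xi>) * cis (x * \<xi> + T * \<xi> ^ 3) * (\<Prod>b\<in>Basis. ?Q \<xi> b))) \<le>
      ennreal (16 * 288\<^sup>2 * \<bar>T\<bar> powr (- \<theta>)) * ennreal (\<bar>\<xi>\<bar> powr (- \<theta>) * indicator {-1..1} \<xi>)"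
      by (subst ennreal_mult[symmetric]) (auto intro!: ennreal_leI simp: norm_mult mult_ac)
  qed
  also have "\<dots> = ennreal (16 * 288\<^sup>2 * \<bar>T\<bar> powr (- \<theta>)) * (\<integral>\<^sup>+\<xi>. ennreal (\<bar>\<xi>\<bar> powr (- \<theta>) * indicator {-1..1} \<xi>) \<partial>lborel)"
    by (rule nn_integral_cmult) measurable
  also have "\<dots> \<le> ennreal (16 * 288\<^sup>2 * \<bar>T\<bar> powr (- \<theta>)) * ennreal (2 * (1 powr (- \<theta> + 1) / (- \<theta> + 1)))"
    using \<theta> by (intro mult_left_mono nn_integral_powr_symmetric) auto
  also have "\<dots> = ennreal ((16 * 288\<^sup>2 * (2 / (1 - \<theta>))) * \<bar>T\<bar> powr (- \<theta>))"
    using \<theta> by (subst ennreal_mult[symmetric]) (auto simp: mult_ac)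
  finally show ?thesis using \<theta> by (subst (asm) ennreal_le_iff) auto
qed

text \<open>On the support \<open>|\<eta>|^2 \<le> 2\<close>, so the shift
  \<open>T|\<eta>|^2\<close> is at most \<open>2|T| \<le> |x|/7\<close>. The shifted position stays
  above \<open>|x|/2\<close> and above \<open>12|T|\<close>, inside the range of
  \<open>osc_tail\<close>; halving \<open>x\<close> turns 20000 into 80000.\<close>

lemma cube_kernel_tail:
  fixes y :: "'y::euclidean_space"
  assumes dim: "DIM('y) = 2" and x: "14 * \<bar>T\<bar> \<le> \<bar>x\<bar>" "x \<noteq> 0"
  shows "norm (evol (\<lambda>\<zeta>. of_real (cube_weight \<zeta>)) x (y, T)) \<le>
    80000 * (LINT \<eta>::'y|lborel. (\<Prod>b\<in>Basis. bump (-1) 1 (\<eta> \<bullet> b))) / x\<^sup>2"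
proof -
  let ?W = "\<lambda>\<eta>::'y. \<Prod>b\<in>Basis. bump (-1) 1 (\<eta> \<bullet> b)"
  have W0: "?W \<eta> \<ge> 0" for \<eta> by (simp add: prod_nonneg)
  have "ennreal (norm (evol (\<lambda>\<zeta>. of_real (cube_weight \<zeta>)) x (y, T))) \<le>
      (\<integral>\<^sup>+\<eta>. ennreal (?W \<eta> * (80000 / x\<^sup>2)) \<partial>lborel)"
    unfolding evol_cube_weight(2)
  proof (rule order.trans[OF norm_LINT_le_nn], rule nn_integral_mono, rule ennreal_leI)
    fix \<eta> :: 'y
    show "norm (cis (y \<bullet> \<eta>) * of_real (?W \<eta>) * osc (-1) 1 (x + T * (norm \<eta>)\<^sup>2) T) \<le> ?W \<eta> * (80000 / x\<^sup>2)"
    proof (cases "?W \<eta> = 0")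
      case False
      then have "\<bar>\<eta> \<bullet> b\<bar> \<le> 1" if "b \<in> Basis" for b
        using that by (auto simp: bump_def abs_le_iff split: if_splits)
      then have "(\<eta> \<bullet> b)\<^sup>2 \<le> 1" if "b \<in> Basis" for b using that by (simp add: abs_square_le_1)
      then have "(\<Sum>b\<in>(Basis::'y set). (\<eta> \<bullet> b)\<^sup>2) \<le> (\<Sum>b\<in>(Basis::'y set). 1)" by (intro sum_mono) auto
      then have "(norm \<eta>)\<^sup>2 \<le> 2"
        unfolding power2_norm_eq_inner euclidean_inner[of \<eta> \<eta>] by (simp add: dim power2_eq_square)
      then have "\<bar>T * (norm \<eta>)\<^sup>2\<bar> \<le> \<bar>T\<bar> * 2" unfolding abs_mult by (intro mult_left_mono) auto
      then have X: "\<bar>x\<bar> / 2 \<le> \<bar>x + T * (norm \<eta>)\<^sup>2\<bar>" "6 * \<bar>T\<bar> \<le> \<bar>x + T * (norm \<eta>)\<^sup>2\<bar>"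
        using x(1) by linarith+
      let ?X = "x + T * (norm \<eta>)\<^sup>2"
      have "?X \<noteq> 0" using X(1) x(2) by auto
      have "norm (osc (-1) 1 ?X T) \<le> 20000 / ?X\<^sup>2"
        using X x by (intro osc_tail) auto
      also have "\<dots> \<le> 20000 / (x / 2)\<^sup>2"
        using X(1) x(2) abs_le_square_iff[of "x / 2" ?X] \<open>?X \<noteq> 0\<close> by (intro divide_left_mono mult_pos_pos) auto
      also have "\<dots> = 80000 / x\<^sup>2" by (simp add: power_divide)
      finally show ?thesis
        unfolding norm_mult norm_cis norm_of_real abs_of_nonneg[OF W0] mult_1_left
        by (intro mult_left_mono W0)
    next
      case True
      show ?thesis by (simp only: True of_real_0 mult_zero_right mult_zero_left norm_zero order.refl)
    qed
  qed
  also have "\<dots> = ennreal (LINT \<eta>|lborel. ?W \<eta> * (80000 / x\<^sup>2))"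
    using W0 by (intro nn_integral_eq_integral integrable_mult_left integrable_bump_prod) auto
  finally have "norm (evol (\<lambda>\<zeta>. of_real (cube_weight \<zeta>)) x (y, T)) \<le> (LINT \<eta>|lborel. ?W \<eta> * (80000 / x\<^sup>2))"
    using W0 by (subst (asm) ennreal_le_iff) (auto intro!: integral_nonneg_AE)
  then show ?thesis by (simp add: mult_ac)
qed

lemma bump_lower:
  assumes "\<bar>v\<bar> \<le> 1/2"
  shows "9/16 \<le> bump (-1) 1 v"
proof -
  have "v\<^sup>2 \<le> (1/2)\<^sup>2" using assms abs_le_square_iff[of v "1/2"] by simp
  then have "3/4 \<le> (v - -1) * (1 - v)" by (simp add: power2_eq_square algebra_simps)
  then have "(3/4)\<^sup>2 \<le> ((v - -1) * (1 - v))\<^sup>2" by (intro power_mono) auto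
  then show ?thesis using assms by (auto simp: bump_def power2_eq_square abs_le_iff)
qed

theorem maximal_estimate_dim3:
  assumes dim: "DIM('y::euclidean_space) = 2" and p: "p \<ge> 2" and s: "s > 3/2 - 1/p"
  shows "maximal_estimate TYPE('y) p s"
proof -
  \<comment> \<open>\<open>\<theta>\<close> will be \<open>2/p\<close> reduced by the factor
    \<open>1 - \<delta>\<close>. This raises the required exponent by \<open>6 \<delta> / p\<close>,
    and the choice spends at most half of the available room \<open>2s - 3 + 2/p\<close>.\<close>
  define \<delta> where "\<delta> = min (1/2) (p * (2 * s - 3 + 2/p) / 12)"
  have \<delta>: "0 < \<delta>" "\<delta> < 1" "6 * \<delta> / p < 2 * s - 3 + 2/p"
  proof -
    have "2 * s - 3 + 2/p > 0" using s by (simp add: field_simps)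
    then have "p * (2 * s - 3 + 2/p) / 12 > 0" using p by simp
    moreover have "6 * \<delta> / p \<le> 6 * (p * (2 * s - 3 + 2/p) / 12) / p"
    proof -
      have "\<delta> \<le> p * (2 * s - 3 + 2/p) / 12" unfolding \<delta>_def by (rule min.cobounded2)
      then show ?thesis using p by (intro divide_right_mono mult_left_mono) auto
    qed
    moreover have "6 * (p * (2 * s - 3 + 2/p) / 12) / p < 2 * s - 3 + 2/p"
      using p \<open>2 * s - 3 + 2/p > 0\<close> by simp
    ultimately show "0 < \<delta>" "\<delta> < 1" "6 * \<delta> / p < 2 * s - 3 + 2/p" by (auto simp: \<delta>_def)
  qed
  define \<theta> where "\<theta> = 2 * (1 - \<delta>) / p"
  have \<theta>: "0 < \<theta>" "\<theta> < 1" "\<theta> * (p/2) < 1"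
    using \<delta> p by (auto simp: \<theta>_def field_simps)
  define I where "I = (LINT \<eta>::'y|lborel. (\<Prod>b\<in>Basis. bump (-1) 1 (\<eta> \<bullet> b)))"
  define C where "C = max (max 1 (LINT \<zeta>|lborel. norm (complex_of_real (cube_weight (\<zeta> :: real \<times> 'y)))))
      (max (80000 * I) (16 * 288\<^sup>2 * (2 / (1 - \<theta>))))"
  have C: "C > 0" "80000 * I \<le> C" "16 * 288\<^sup>2 * (2 / (1 - \<theta>)) \<le> C"
      "(LINT \<zeta>|lborel. norm (complex_of_real (cube_weight (\<zeta> :: real \<times> 'y)))) \<le> C"
    by (auto simp: C_def)
  let ?K = "\<lambda>x y T. evol (\<lambda>\<zeta> :: real \<times> 'y. of_real (cube_weight \<zeta>)) x (y, T)"
  have bnd: "norm (?K x y T) \<le> C" for x y T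
    using norm_evol_le C(4) by (rule order.trans)
  have tail: "norm (?K x y T) \<le> C / x\<^sup>2" if "14 * \<bar>T\<bar> \<le> \<bar>x\<bar>" "x \<noteq> 0" for x y T
    by (rule order.trans[OF cube_kernel_tail[OF dim that]]) (use C(2) in \<open>auto simp: I_def intro!: divide_right_mono\<close>)
  have dec: "norm (?K x y T) \<le> C * \<bar>T\<bar> powr (- \<theta>)" if "T \<noteq> 0" for x y T
    by (rule order.trans[OF cube_kernel_decay[OF dim \<theta>(1,2) that]]) (intro mult_right_mono C, simp)
  have cov: "(9/16) ^ 3 \<le> cube_weight \<zeta>" if "norm \<zeta> \<le> 1/2" for \<zeta> :: "real \<times> 'y"
  proof -
    have "\<bar>fst \<zeta>\<bar> \<le> 1/2" using that norm_fst_le[of "fst \<zeta>" "snd \<zeta>"] by simp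
    then have 1: "9/16 \<le> bump (-1) 1 (fst \<zeta>)" by (rule bump_lower)
    have "(\<Prod>b\<in>(Basis::'y set). 9/16) \<le> (\<Prod>b\<in>Basis. bump (-1) 1 (snd \<zeta> \<bullet> b))"
    proof (intro prod_mono conjI bump_lower)
      fix b :: 'y assume "b \<in> Basis"
      then show "\<bar>snd \<zeta> \<bullet> b\<bar> \<le> 1/2" using that norm_snd_le[of "snd \<zeta>" "fst \<zeta>"] Basis_le_norm[of b "snd \<zeta>"] by simp
    qed simp
    with 1 have "9/16 * (9/16)\<^sup>2 \<le> bump (-1) 1 (fst \<zeta>) * (\<Prod>b\<in>Basis. bump (-1) 1 (snd \<zeta> \<bullet> b))"
      by (intro mult_mono) (auto simp: dim)
    then show ?thesis by (simp add: cube_weight_def power2_eq_square power3_eq_cube)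
  qed
  show ?thesis
  \<comment> \<open>The cube weight serves both at low and at unit frequency, since its kernel
    decays although its support contains the origin.\<close>
  proof (rule maximal_estimate_of_unit_kernel[OF p _ \<theta>(1,3), where C=C and ?C0.0=14 and ?c0.0="(9/16)^3"
        and ?w0.0=cube_weight and w=cube_weight])
    show "s \<ge> 0" using s p by (smt (verit) divide_le_eq_1 frac_le)
    have "4/p - 3 * \<theta> = 6 * \<delta> / p - 2/p" unfolding \<theta>_def using p by (simp add: field_simps)
    then show "real DIM(real \<times> 'y) + 4/p - 3 * \<theta> < 2 * s" using \<delta>(3) dim by simp
  qed (use C(1) bnd tail dec cov in \<open>auto intro: integrable_cube_weight cube_weight_nonneg\<close>)
qed

subsection \<open>Two space dimensions\<close>

text \<open>Coordinates \<open>p\<close>, \<open>q\<close> with \<open>\<xi> = p + q\<close> and \<open>\<eta> = sqrt 3 (p - q)\<close>, in which the dispersion relation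
  becomes \<open>4(p\<^sup>3 + q\<^sup>3)\<close>.\<close>

definition chr1 :: "'y::euclidean_space \<Rightarrow> real \<times> 'y \<Rightarrow> real" where
  "chr1 b \<zeta> = (fst \<zeta> + (snd \<zeta> \<bullet> b) / sqrt 3) / 2"

definition chr2 :: "'y::euclidean_space \<Rightarrow> real \<times> 'y \<Rightarrow> real" where
  "chr2 b \<zeta> = (fst \<zeta> - (snd \<zeta> \<bullet> b) / sqrt 3) / 2"

lemma borel_measurable_chr [measurable]:
  "chr1 b \<in> borel_measurable borel" "chr2 b \<in> borel_measurable borel"
proof -
  have "continuous_on UNIV (chr1 b)" "continuous_on UNIV (chr2 b)"
    unfolding chr1_def chr2_def by (intro continuous_intros; simp)+
  then show "chr1 b \<in> borel_measurable borel" "chr2 b \<in> borel_measurable borel"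
    by (auto intro: borel_measurable_continuous_onI)
qed

lemma Basis_singleton_inner: "Basis = {b} \<Longrightarrow> b \<bullet> b = 1"
  by (metis inner_same_Basis singletonI)

lemma chr_param:
  assumes "Basis = {b}"
  shows "chr1 b (1 * (p + q), (sqrt 3 * (p - q)) *\<^sub>R b) = p" "chr2 b (1 * (p + q), (sqrt 3 * (p - q)) *\<^sub>R b) = q"
  by (simp_all add: chr1_def chr2_def Basis_singleton_inner[OF assms])

text \<open>In the coordinates \<open>p\<close>, \<open>q\<close> the linear and the cubic part of
  the phase both separate, so the kernel of a product profile is a product of one-dimensional
  integrals. General integrable profiles cover both the bumps used next and the Gaussian packets of
  the counterexample.\<close>

lemma evol_characteristic:
  fixes f g :: "real \<Rightarrow> complex" and y b :: "'y::euclidean_space"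
  assumes b: "Basis = {b}" and f: "integrable lborel f" and g: "integrable lborel g"
  shows "evol (\<lambda>\<zeta>. f (chr1 b \<zeta>) * g (chr2 b \<zeta>)) x (y, T) = of_real (2 * sqrt 3) *
     ((LINT v|lborel. cis ((x + sqrt 3 * (y \<bullet> b)) * v + 4 * T * v ^ 3) * f v) *
      (LINT v|lborel. cis ((x - sqrt 3 * (y \<bullet> b)) * v + 4 * T * v ^ 3) * g v))"
    and "integrable lborel (\<lambda>\<zeta>. f (chr1 b \<zeta>) * g (chr2 b \<zeta>))"
proof -
  have [measurable]: "f \<in> borel_measurable borel" "g \<in> borel_measurable borel" using f g by auto
  let ?L = "\<lambda>z. (1 * (fst z + snd z), (sqrt 3 * (fst z - snd z)) *\<^sub>R b)"
  have "b \<bullet> b = 1" by (rule Basis_singleton_inner[OF b])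
  then have "norm b = 1" by (simp add: norm_eq_sqrt_inner)
  let ?X = "x + sqrt 3 * (y \<bullet> b)" and ?Y = "x - sqrt 3 * (y \<bullet> b)"
  let ?F = "\<lambda>\<zeta>. cis ((x, y) \<bullet> \<zeta> + T * dispersion \<zeta>) * (f (chr1 b \<zeta>) * g (chr2 b \<zeta>))"
  have Fm: "?F \<in> borel_measurable borel" by measurable
  have phase: "(x, y) \<bullet> ?L z + T * dispersion (?L z) =
      (?X * fst z + 4 * T * fst z ^ 3) + (?Y * snd z + 4 * T * snd z ^ 3)" for z
  proof -
    have n: "(norm ((sqrt 3 * (fst z - snd z)) *\<^sub>R b))\<^sup>2 = 3 * (fst z - snd z)\<^sup>2"
      by (simp add: \<open>norm b = 1\<close> power_mult_distrib)
    have "dispersion (?L z) = 4 * fst z ^ 3 + 4 * snd z ^ 3"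
      unfolding dispersion_eq fst_conv snd_conv n by (simp add: power2_eq_square power3_eq_cube algebra_simps)
    moreover have "(x, y) \<bullet> ?L z = ?X * fst z + ?Y * snd z"
      by (simp add: inner_prod_def algebra_simps)
    ultimately show ?thesis by (simp add: distrib_left)
  qed
  have FL: "?F (?L z) = (cis (?X * fst z + 4 * T * fst z ^ 3) * f (fst z)) * (cis (?Y * snd z + 4 * T * snd z ^ 3) * g (snd z))" for z
    unfolding phase chr_param[OF b] by (simp only: cis_mult[symmetric] mult_ac)
  have fi: "integrable lborel (\<lambda>v. cis (?X * v + 4 * T * v ^ 3) * f v)" "integrable lborel (\<lambda>v. cis (?Y * v + 4 * T * v ^ 3) * g v)"
    by (intro integrable_cis_mult f g; measurable)+
  have "evol (\<lambda>\<zeta>. f (chr1 b \<zeta>) * g (chr2 b \<zeta>)) x (y, T) = of_real (2 * 1 * sqrt 3) * (LINT z|lborel. ?F (?L z))"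
    unfolding evol_def fst_conv snd_conv by (rule integral_sheared_plane(1)[OF b _ _ Fm]) auto
  also have "\<dots> = of_real (2 * sqrt 3) *
      ((LINT v|lborel. cis (?X * v + 4 * T * v ^ 3) * f v) * (LINT v|lborel. cis (?Y * v + 4 * T * v ^ 3) * g v))"
    unfolding FL integral_prod_real2(1)[OF fi] by simp
  finally show "evol (\<lambda>\<zeta>. f (chr1 b \<zeta>) * g (chr2 b \<zeta>)) x (y, T) = \<dots>" .
  have "integrable lborel (\<lambda>z. f (chr1 b (?L z)) * g (chr2 b (?L z)))"
    unfolding chr_param[OF b] by (rule integral_prod_real2(2)[OF f g])
  then show "integrable lborel (\<lambda>\<zeta>. f (chr1 b \<zeta>) * g (chr2 b \<zeta>))"
    by (rule integral_sheared_plane(2)[OF b, rotated 3]) auto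
qed

definition chr_weight :: "'y::euclidean_space \<Rightarrow> real \<Rightarrow> real \<Rightarrow> real \<Rightarrow> real \<Rightarrow> real \<times> 'y \<Rightarrow> real" where
  "chr_weight b a1 b1 a2 b2 \<zeta> = bump a1 b1 (chr1 b \<zeta>) * bump a2 b2 (chr2 b \<zeta>)"

lemma chr_weight_nonneg [simp]: "0 \<le> chr_weight b a1 b1 a2 b2 \<zeta>"
  by (simp add: chr_weight_def)

lemma evol_chr_weight:
  fixes y b :: "'y::euclidean_space"
  assumes b: "Basis = {b}"
  shows "evol (\<lambda>\<zeta>. of_real (chr_weight b a1 b1 a2 b2 \<zeta>)) x (y, T) = of_real (2 * sqrt 3) *
     (osc a1 b1 (x + sqrt 3 * (y \<bullet> b)) (4 * T) * osc a2 b2 (x - sqrt 3 * (y \<bullet> b)) (4 * T))"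
    and "integrable lborel (chr_weight b a1 b1 a2 b2)"
proof -
  have i: "integrable lborel (\<lambda>v. complex_of_real (bump a b v))" for a b
    by (simp add: integrable_bump)
  show "evol (\<lambda>\<zeta>. of_real (chr_weight b a1 b1 a2 b2 \<zeta>)) x (y, T) = of_real (2 * sqrt 3) *
     (osc a1 b1 (x + sqrt 3 * (y \<bullet> b)) (4 * T) * osc a2 b2 (x - sqrt 3 * (y \<bullet> b)) (4 * T))"
    using evol_characteristic(1)[OF b i i, of a1 b1 a2 b2 x y T] by (simp add: chr_weight_def osc_def)
  have "integrable lborel (\<lambda>\<zeta>. Re (complex_of_real (bump a1 b1 (chr1 b \<zeta>)) * complex_of_real (bump a2 b2 (chr2 b \<zeta>))))"
    by (intro integrable_Re evol_characteristic(2)[OF b i i])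
  then show "integrable lborel (chr_weight b a1 b1 a2 b2)" by (simp add: chr_weight_def[abs_def])
qed

lemma norm_evol_chr_weight_le:
  fixes y b :: "'y::euclidean_space"
  assumes b: "Basis = {b}"
    and "norm (osc a1 b1 (x + sqrt 3 * (y \<bullet> b)) (4 * T)) \<le> A" "norm (osc a2 b2 (x - sqrt 3 * (y \<bullet> b)) (4 * T)) \<le> B"
  shows "norm (evol (\<lambda>\<zeta>. of_real (chr_weight b a1 b1 a2 b2 \<zeta>)) x (y, T)) \<le> 4 * (A * B)"
proof -
  have "sqrt 3 \<le> 2" by (rule real_le_lsqrt) auto
  then have 4: "2 * sqrt 3 \<le> 4" by simp
  have "norm (osc a1 b1 (x + sqrt 3 * (y \<bullet> b)) (4 * T)) * norm (osc a2 b2 (x - sqrt 3 * (y \<bullet> b)) (4 * T)) \<le> A * B"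
    by (intro mult_mono assms order.trans[OF norm_ge_zero assms(2)] norm_ge_zero)
  then have "(2 * sqrt 3) * (norm (osc a1 b1 (x + sqrt 3 * (y \<bullet> b)) (4 * T)) * norm (osc a2 b2 (x - sqrt 3 * (y \<bullet> b)) (4 * T))) \<le> 4 * (A * B)"
    by (rule mult_mono[OF 4]) simp_all
  then show ?thesis unfolding evol_chr_weight(1)[OF b] by (simp add: norm_mult)
qed

lemma chr_weight_bound:
  fixes y b :: "'y::euclidean_space"
  assumes b: "Basis = {b}" and "-1 \<le> a1" "a1 \<le> b1" "b1 \<le> 1" "-1 \<le> a2" "a2 \<le> b2" "b2 \<le> 1"
  shows "norm (evol (\<lambda>\<zeta>. of_real (chr_weight b a1 b1 a2 b2 \<zeta>)) x (y, T)) \<le> 4096"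
  using norm_evol_chr_weight_le[OF b norm_osc_le norm_osc_le, of a1 b1 a2 b2 x y T] assms by simp

text \<open>The two positions \<open>x \<plusminus> sqrt 3 (y \<bullet> b)\<close> have average
  \<open>x\<close>, so one of them is at least \<open>|x|\<close> in size, whatever \<open>y\<close>
  is. \<open>osc_tail\<close> at time \<open>4T\<close> handles that factor, hence
  \<open>24 = 6 * 4\<close>; the other factor is bounded by 32.\<close>

lemma chr_weight_tail:
  fixes y b :: "'y::euclidean_space"
  assumes b: "Basis = {b}" and ab: "-1 \<le> a1" "a1 \<le> b1" "b1 \<le> 1" "-1 \<le> a2" "a2 \<le> b2" "b2 \<le> 1"
    and x: "24 * \<bar>T\<bar> \<le> \<bar>x\<bar>" "x \<noteq> 0"
  shows "norm (evol (\<lambda>\<zeta>. of_real (chr_weight b a1 b1 a2 b2 \<zeta>)) x (y, T)) \<le> 2560000 / x\<^sup>2"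
proof -
  let ?X = "x + sqrt 3 * (y \<bullet> b)" and ?Y = "x - sqrt 3 * (y \<bullet> b)"
  have tail: "norm (osc a c Z (4 * T)) \<le> 20000 / x\<^sup>2" if "-1 \<le> a" "a \<le> c" "c \<le> 1" "\<bar>x\<bar> \<le> \<bar>Z\<bar>" for a c Z
  proof -
    have "Z \<noteq> 0" using that x by auto
    have "norm (osc a c Z (4 * T)) \<le> 20000 / Z\<^sup>2"
      by (rule osc_tail) (use that x \<open>Z \<noteq> 0\<close> in auto)
    also have "\<dots> \<le> 20000 / x\<^sup>2"
      using that(4) x(2) \<open>Z \<noteq> 0\<close> abs_le_square_iff[of x Z] by (intro divide_left_mono mult_pos_pos) auto
    finally show ?thesis .
  qed
  have "\<bar>x\<bar> \<le> \<bar>?X\<bar> \<or> \<bar>x\<bar> \<le> \<bar>?Y\<bar>" by linarith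
  then show ?thesis
  proof
    assume "\<bar>x\<bar> \<le> \<bar>?X\<bar>"
    from norm_evol_chr_weight_le[OF b tail[OF ab(1-3) this] norm_osc_le[OF ab(4-6)]]
    show ?thesis by simp
  next
    assume "\<bar>x\<bar> \<le> \<bar>?Y\<bar>"
    from norm_evol_chr_weight_le[OF b norm_osc_le[OF ab(1-3)] tail[OF ab(4-6) this]]
    show ?thesis by simp
  qed
qed

lemma osc_decay_annulus:
  assumes "T \<noteq> 0" "(a = 1/16 \<and> c = 1) \<or> (a = -1 \<and> c = -(1/16))"
  shows "norm (osc a c X T) \<le> 576 / sqrt \<bar>T\<bar>"
  using assms(2)
proof
  assume "a = 1/16 \<and> c = 1"
  then show ?thesis using assms(1) by (intro osc_decay_half) auto
next
  assume *: "a = -1 \<and> c = -(1/16)"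
  have "norm (osc (1/16) 1 (- X) (- T)) \<le> 576 / sqrt \<bar>- T\<bar>"
    using assms(1) by (intro osc_decay_half) auto
  then show ?thesis using * osc_reflect[of 1 "1/16" X T] by simp
qed

text \<open>Here \<open>5/6 = 1/2 + 1/3\<close>. For \<open>|T| \<le> 1\<close> the uniform bound
  takes over, which makes every smaller \<open>\<theta>\<close> admissible at all
  \<open>T \<noteq> 0\<close>.\<close>

lemma powr_combine_decay:
  assumes "T \<noteq> 0" "\<theta> \<le> 5/6" "0 < \<theta>" "z \<le> 4096" "z \<le> 4 * ((576 / sqrt \<bar>4 * T\<bar>) * (608 * \<bar>4 * T\<bar> powr (-(1/3))))"
  shows "z \<le> 2560000 * \<bar>T\<bar> powr (- \<theta>)"
proof (cases "\<bar>T\<bar> \<le> 1")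
  case True
  then have "1 \<le> \<bar>T\<bar> powr (- \<theta>)" using powr_mono2'[of "- \<theta>" "\<bar>T\<bar>" 1] assms by simp
  then show ?thesis using assms(4) by linarith
next
  case False
  have "4 * ((576 / sqrt \<bar>4 * T\<bar>) * (608 * \<bar>4 * T\<bar> powr (-(1/3)))) = 1400832 * \<bar>4 * T\<bar> powr (- (5/6))"
  proof -
    have "1 / sqrt \<bar>4 * T\<bar> = \<bar>4 * T\<bar> powr (- (1/2))" by (simp add: powr_minus_divide powr_half_sqrt)
    moreover have "\<bar>4 * T\<bar> powr (- (1/2)) * \<bar>4 * T\<bar> powr (- (1/3)) = \<bar>4 * T\<bar> powr (- (5/6))"
      by (simp flip: powr_add)
    moreover have "4 * ((576 / r) * (608 * c)) = 1400832 * ((1 / r) * c)" for r c :: real by simp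
    ultimately show ?thesis by (simp only:)
  qed
  also have "\<bar>4 * T\<bar> powr (- (5/6)) \<le> \<bar>T\<bar> powr (- (5/6))"
    using False by (intro powr_mono2') auto
  also have "\<bar>T\<bar> powr (- (5/6)) \<le> \<bar>T\<bar> powr (- \<theta>)"
    using False assms by (intro powr_mono) auto
  finally have "z \<le> 1400832 * \<bar>T\<bar> powr (- \<theta>)" using assms(5) by simp
  moreover have "0 \<le> \<bar>T\<bar> powr (- \<theta>)" by simp
  ultimately show ?thesis by linarith
qed

lemma chr_weight_decay:
  fixes y b :: "'y::euclidean_space"
  assumes b: "Basis = {b}" and T: "T \<noteq> 0" and \<theta>: "\<theta> \<le> 5/6" "0 < \<theta>"
    and I: "(a = 1/16 \<and> c = 1) \<or> (a = -1 \<and> c = -(1/16))"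
  shows "norm (evol (\<lambda>\<zeta>. of_real (chr_weight b a c (-1) 1 \<zeta>)) x (y, T)) \<le> 2560000 * \<bar>T\<bar> powr (- \<theta>)"
    and "norm (evol (\<lambda>\<zeta>. of_real (chr_weight b (-1) 1 a c \<zeta>)) x (y, T)) \<le> 2560000 * \<bar>T\<bar> powr (- \<theta>)"
proof -
  have T4: "4 * T \<noteq> 0" using T by simp
  have ac: "-1 \<le> a" "a \<le> c" "c \<le> 1" using I by auto
  show "norm (evol (\<lambda>\<zeta>. of_real (chr_weight b a c (-1) 1 \<zeta>)) x (y, T)) \<le> 2560000 * \<bar>T\<bar> powr (- \<theta>)"
    using ac by (intro powr_combine_decay T \<theta> chr_weight_bound[OF b]
      norm_evol_chr_weight_le[OF b osc_decay_annulus[OF T4 I] osc_decay_full[OF T4]]) auto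
  have "norm (evol (\<lambda>\<zeta>. of_real (chr_weight b (-1) 1 a c \<zeta>)) x (y, T)) \<le>
      4 * ((608 * \<bar>4 * T\<bar> powr (-(1/3))) * (576 / sqrt \<bar>4 * T\<bar>))"
    by (rule norm_evol_chr_weight_le[OF b osc_decay_full[OF T4] osc_decay_annulus[OF T4 I]])
  then show "norm (evol (\<lambda>\<zeta>. of_real (chr_weight b (-1) 1 a c \<zeta>)) x (y, T)) \<le> 2560000 * \<bar>T\<bar> powr (- \<theta>)"
    using ac by (intro powr_combine_decay T \<theta> chr_weight_bound[OF b]) (auto simp: mult_ac)
qed

text \<open>In each summand one of \<open>p\<close>, \<open>q\<close> stays away from 0, which
  improves the decay of its factor from \<open>1/3\<close> to \<open>1/2\<close>. There are two
  summands per coordinate because a cutoff lives on an interval and the gap around 0 separates the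
  signs. Overlaps do no harm, as only a lower bound on the annulus is required.\<close>

definition annular_weight :: "'y::euclidean_space \<Rightarrow> real \<times> 'y \<Rightarrow> real" where
  "annular_weight b \<zeta> = (chr_weight b (1/16) 1 (-1) 1 \<zeta> + chr_weight b (-1) (-(1/16)) (-1) 1 \<zeta>) +
     (chr_weight b (-1) 1 (1/16) 1 \<zeta> + chr_weight b (-1) 1 (-1) (-(1/16)) \<zeta>)"

lemma evol_add:
  assumes "integrable lborel f" "integrable lborel g"
  shows "evol (\<lambda>\<zeta>. f \<zeta> + g \<zeta>) x z = evol f x z + evol g x z"
  unfolding evol_def using assms
  by (simp add: distrib_left integrable_cis_mult)

lemma integrable_annular_weight:
  "Basis = {b} \<Longrightarrow> integrable lborel (annular_weight b)"
  unfolding annular_weight_def[abs_def] by (intro Bochner_Integration.integrable_add evol_chr_weight)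

lemma norm_evol_annular_weight_le:
  fixes y b :: "'y::euclidean_space"
  assumes b: "Basis = {b}"
    and "norm (evol (\<lambda>\<zeta>. of_real (chr_weight b (1/16) 1 (-1) 1 \<zeta>)) x (y, T)) \<le> A"
    "norm (evol (\<lambda>\<zeta>. of_real (chr_weight b (-1) (-(1/16)) (-1) 1 \<zeta>)) x (y, T)) \<le> A"
    "norm (evol (\<lambda>\<zeta>. of_real (chr_weight b (-1) 1 (1/16) 1 \<zeta>)) x (y, T)) \<le> A"
    "norm (evol (\<lambda>\<zeta>. of_real (chr_weight b (-1) 1 (-1) (-(1/16)) \<zeta>)) x (y, T)) \<le> A"
  shows "norm (evol (\<lambda>\<zeta>. of_real (annular_weight b \<zeta>)) x (y, T)) \<le> 4 * A"
proof -
  have i: "integrable lborel (\<lambda>\<zeta>. complex_of_real (chr_weight b a1 b1 a2 b2 \<zeta>))" for a1 b1 a2 b2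
    using evol_chr_weight(2)[OF b] by simp
  have "norm (evol (\<lambda>\<zeta>. of_real (annular_weight b \<zeta>)) x (y, T)) \<le> (A + A) + (A + A)"
    unfolding annular_weight_def of_real_add
      evol_add[OF Bochner_Integration.integrable_add[OF i i] Bochner_Integration.integrable_add[OF i i]] evol_add[OF i i]
    by (intro norm_triangle_mono assms)
  then show ?thesis by simp
qed

lemma norm_square_chr:
  fixes b :: "'y::euclidean_space"
  assumes b: "Basis = {b}"
  shows "(norm \<zeta>)\<^sup>2 = 4 * (chr1 b \<zeta>)\<^sup>2 + 4 * (chr2 b \<zeta>)\<^sup>2 - 4 * chr1 b \<zeta> * chr2 b \<zeta>"
proof -
  have "snd \<zeta> = (snd \<zeta> \<bullet> b) *\<^sub>R b" using euclidean_representation[of "snd \<zeta>"] by (simp add: b)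
  then have n: "(norm (snd \<zeta>))\<^sup>2 = (snd \<zeta> \<bullet> b)\<^sup>2"
    unfolding power2_norm_eq_inner using euclidean_inner[of "snd \<zeta>" "snd \<zeta>"] by (simp add: b power2_eq_square)
  have "(norm \<zeta>)\<^sup>2 = (fst \<zeta>)\<^sup>2 + (snd \<zeta> \<bullet> b)\<^sup>2"
    using n by (simp add: norm_prod_def)
  also have "\<dots> = 4 * (chr1 b \<zeta>)\<^sup>2 + 4 * (chr2 b \<zeta>)\<^sup>2 - 4 * chr1 b \<zeta> * chr2 b \<zeta>"
    unfolding chr1_def chr2_def by (simp add: power2_eq_square field_simps)
  finally show ?thesis .
qed

text \<open>The threshold \<open>7/100\<close> leaves a margin above \<open>1/16\<close>, where the
  cutoff vanishes.\<close>

lemma bump_annulus_lower: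
  assumes "\<bar>v\<bar> \<le> 1/2" "7/100 \<le> \<bar>v\<bar>"
  shows "1/100000 \<le> bump (1/16) 1 v + bump (-1) (-(1/16)) v"
proof -
  have *: "1/100000 \<le> bump (1/16) 1 w" if "w \<le> 1/2" "7/100 \<le> w" for w
  proof -
    have "(75/10000) * (1/2) \<le> (w - 1/16) * (1 - w)" using that by (intro mult_mono) auto
    then have "((75/10000) * (1/2))\<^sup>2 \<le> ((w - 1/16) * (1 - w))\<^sup>2" by (intro power_mono) auto
    then show ?thesis using that by (simp add: bump_def power2_eq_square)
  qed
  have refl: "bump (-1) (-(1/16)) v = bump (1/16) 1 (- v)"
  proof -
    have "(v - -1) * (-(1/16) - v) = (- v - 1/16) * (1 - - v)" by (simp add: algebra_simps)
    moreover have "(-1 \<le> v \<and> v \<le> -(1/16)) = (1/16 \<le> - v \<and> - v \<le> 1)" by auto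
    ultimately show ?thesis unfolding bump_def by (simp only:)
  qed
  show ?thesis
  proof (cases "v \<ge> 0")
    case True
    then have "1/100000 \<le> bump (1/16) 1 v" using assms by (intro *) auto
    then show ?thesis using bump_nonneg[of "-1" "-(1/16)" v] by linarith
  next
    case False
    then have "1/100000 \<le> bump (1/16) 1 (- v)" using assms by (intro *) auto
    then show ?thesis using bump_nonneg[of "1/16" 1 v] unfolding refl by linarith
  qed
qed

text \<open>The form \<open>4P^2 + 4Q^2 - 4PQ\<close> equals \<open>(2Q - P)^2 + 3P^2\<close>, so it
  controls each coordinate separately.\<close>

lemma chr_range:
  fixes b :: "'y::euclidean_space"
  assumes b: "Basis = {b}" and "norm \<zeta> \<le> 1/2"
  shows "\<bar>chr1 b \<zeta>\<bar> \<le> 1/2" "\<bar>chr2 b \<zeta>\<bar> \<le> 1/2"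
proof -
  let ?P = "chr1 b \<zeta>" and ?Q = "chr2 b \<zeta>"
  have "(norm \<zeta>)\<^sup>2 \<le> (1/2)\<^sup>2" using assms(2) by (intro power_mono) auto
  then have n: "4 * ?P\<^sup>2 + 4 * ?Q\<^sup>2 - 4 * ?P * ?Q \<le> 1/4"
    unfolding norm_square_chr[OF b] by (simp add: power2_eq_square)
  have "0 \<le> (2 * ?Q - ?P)\<^sup>2" "0 \<le> (2 * ?P - ?Q)\<^sup>2" by simp_all
  then have "?P\<^sup>2 \<le> (1/2)\<^sup>2" "?Q\<^sup>2 \<le> (1/2)\<^sup>2"
    using n by (simp_all add: power2_eq_square algebra_simps)
  then show "\<bar>?P\<bar> \<le> 1/2" "\<bar>?Q\<bar> \<le> 1/2"
    using abs_le_square_iff[of ?P "1/2"] abs_le_square_iff[of ?Q "1/2"] by auto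
qed

text \<open>From \<open>|\<zeta>|^2 \<le> 6P^2 + 6Q^2\<close> and
  \<open>|\<zeta>| \<ge> 1/4\<close>, one of the two squares is at least \<open>1/192\<close>, which
  exceeds \<open>(7/100)^2\<close>. That coordinate is in the range of
  \<open>bump_annulus_lower\<close>, the other in that of \<open>bump_lower\<close>.\<close>

lemma annular_weight_lower:
  fixes b :: "'y::euclidean_space"
  assumes b: "Basis = {b}" and \<zeta>: "1/4 \<le> norm \<zeta>" "norm \<zeta> \<le> 1/2"
  shows "1/1000000 \<le> annular_weight b \<zeta>"
proof -
  let ?P = "chr1 b \<zeta>" and ?Q = "chr2 b \<zeta>"
  let ?A = "\<lambda>v. bump (1/16) 1 v + bump (-1) (-(1/16)) v"
  have r: "\<bar>?P\<bar> \<le> 1/2" "\<bar>?Q\<bar> \<le> 1/2" using chr_range[OF b \<zeta>(2)] by auto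
  have eq: "annular_weight b \<zeta> = ?A ?P * bump (-1) 1 ?Q + bump (-1) 1 ?P * ?A ?Q"
    by (simp add: annular_weight_def chr_weight_def algebra_simps)
  have "(1/4)\<^sup>2 \<le> (norm \<zeta>)\<^sup>2" using \<zeta>(1) by (intro power_mono) auto
  then have n: "1/16 \<le> 4 * ?P\<^sup>2 + 4 * ?Q\<^sup>2 - 4 * ?P * ?Q"
    unfolding norm_square_chr[OF b] by (simp add: power2_eq_square)
  have "0 \<le> (?P + ?Q)\<^sup>2" by simp
  then have "1/16 \<le> 6 * ?P\<^sup>2 + 6 * ?Q\<^sup>2" using n by (simp add: power2_eq_square algebra_simps)
  then have "(7/100)\<^sup>2 \<le> ?P\<^sup>2 \<or> (7/100)\<^sup>2 \<le> ?Q\<^sup>2" by (simp add: power2_eq_square) argo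
  then have "7/100 \<le> \<bar>?P\<bar> \<or> 7/100 \<le> \<bar>?Q\<bar>"
    using abs_le_square_iff[of "7/100" ?P] abs_le_square_iff[of "7/100" ?Q] by auto
  then show ?thesis
  proof
    assume "7/100 \<le> \<bar>?P\<bar>"
    then have "1/100000 * (9/16) \<le> ?A ?P * bump (-1) 1 ?Q"
      using bump_annulus_lower[OF r(1)] bump_lower[OF r(2)] by (intro mult_mono) auto
    moreover have "0 \<le> bump (-1) 1 ?P * ?A ?Q" by (intro mult_nonneg_nonneg add_nonneg_nonneg) auto
    ultimately show ?thesis unfolding eq by linarith
  next
    assume "7/100 \<le> \<bar>?Q\<bar>"
    then have "(9/16) * (1/100000) \<le> bump (-1) 1 ?P * ?A ?Q"
      using bump_annulus_lower[OF r(2)] bump_lower[OF r(1)] by (intro mult_mono) auto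
    moreover have "0 \<le> ?A ?P * bump (-1) 1 ?Q" by (intro mult_nonneg_nonneg add_nonneg_nonneg) auto
    ultimately show ?thesis unfolding eq by linarith
  qed
qed

text \<open>For \<open>p \<ge> 4\<close> the exponent \<open>\<theta>\<close> is just below \<open>2/p\<close>, so that \<open>|x|\<^sup>-\<^sup>\<theta>\<close> is barely in \<open>L\<^sup>p\<^sup>/\<^sup>2\<close> near \<open>0\<close>; for
  \<open>p < 4\<close> it is chosen to make \<open>2 + 4/p - 3\<theta>\<close> equal to \<open>3/2\<close>.\<close>

lemma dim2_theta:
  fixes p s :: real
  assumes "(p \<ge> 4 \<and> s > 1 - 1/p) \<or> (2 \<le> p \<and> p < 4 \<and> s > 3/4)"
  obtains \<theta> where "0 < \<theta>" "\<theta> \<le> 5/6" "\<theta> * (p/2) < 1" "2 + 4/p - 3 * \<theta> < 2 * s"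
  using assms
proof (elim disjE conjE)
  assume p: "p \<ge> 4" and s: "s > 1 - 1/p"
  define e where "e = 2 * s - 2 + 2/p"
  have e: "e > 0" using s by (simp add: e_def field_simps)
  define \<delta> where "\<delta> = min (1/2) (p * e / 12)"
  have \<delta>: "0 < \<delta>" "\<delta> < 1" "\<delta> \<le> p * e / 12" using e p by (auto simp: \<delta>_def)
  show thesis
  proof (rule that[of "2 * (1 - \<delta>) / p"])
    show "0 < 2 * (1 - \<delta>) / p" "2 * (1 - \<delta>) / p * (p/2) < 1" using \<delta> p by auto
    have "2 * (1 - \<delta>) / p \<le> 2 / 4" using \<delta> p by (intro frac_le) auto
    also have "\<dots> \<le> (5/6 :: real)" by simp
    finally show "2 * (1 - \<delta>) / p \<le> 5/6" .
    have "6 * \<delta> / p \<le> 6 * (p * e / 12) / p" using \<delta> p by (intro divide_right_mono mult_left_mono) auto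
    also have "\<dots> < e" using e p by simp
    finally have "6 * \<delta> / p < 2 * s - 2 + 2/p" by (simp add: e_def)
    moreover have "2 + 4/p - 3 * (2 * (1 - \<delta>) / p) = 2 - 2/p + 6 * \<delta> / p" using p by (simp add: field_simps)
    ultimately show "2 + 4/p - 3 * (2 * (1 - \<delta>) / p) < 2 * s" by simp
  qed
next
  assume p: "2 \<le> p" "p < 4" and s: "s > 3/4"
  show thesis
  \<comment> \<open>This value is \<open>5/6\<close> at \<open>p = 2\<close>, the strongest decay
    available; times \<open>p/2\<close> it is \<open>p/12 + 2/3\<close>, which is below 1 exactly
    for \<open>p < 4\<close>.\<close>
  proof (rule that[of "1/6 + 4 / (3 * p)"])
    have "4 / (3 * p) \<le> 4 / (3 * 2)" using p by (intro divide_left_mono) auto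
    then show "1/6 + 4 / (3 * p) \<le> 5/6" by simp
    show "0 < 1/6 + 4 / (3 * p)" using p by (intro add_pos_pos) auto
    show "(1/6 + 4 / (3 * p)) * (p/2) < 1" using p by (simp add: field_simps)
    show "2 + 4/p - 3 * (1/6 + 4 / (3 * p)) < 2 * s" using p s by (simp add: field_simps)
  qed
qed

theorem maximal_estimate_dim2:
  assumes dim: "DIM('y::euclidean_space) = 1"
    and ps: "(p \<ge> 4 \<and> s > 1 - 1/p) \<or> (2 \<le> p \<and> p < 4 \<and> s > 3/4)"
  shows "maximal_estimate TYPE('y) p s"
proof -
  obtain b :: 'y where b: "Basis = {b}" using dim card_1_singletonE by blast
  obtain \<theta> where \<theta>: "0 < \<theta>" "\<theta> \<le> 5/6" "\<theta> * (p/2) < 1" "2 + 4/p - 3 * \<theta> < 2 * s"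
    using dim2_theta[OF ps] .
  have p: "p \<ge> 2" using ps by auto
  have s: "s \<ge> 0"
  proof -
    have "1/p \<le> 1" using p by simp
    with ps show ?thesis by (elim disjE conjE) linarith+
  qed
  \<comment> \<open>The low-frequency weight contains the origin and enters without decay. The
    constant 12000000 exceeds \<open>4 * 2560000\<close>, the bound for the four annular
    summands.\<close>
  let ?J = "chr_weight b (-1) 1 (-1) 1"
  have J: "norm (evol (\<lambda>\<zeta>. of_real (?J \<zeta>)) x (y, T)) \<le> 12000000" for x T and y :: 'y
    by (rule order.trans[OF chr_weight_bound[OF b]]) auto
  have Jt: "norm (evol (\<lambda>\<zeta>. of_real (?J \<zeta>)) x (y, T)) \<le> 12000000 / x\<^sup>2" if "24 * \<bar>T\<bar> \<le> \<bar>x\<bar>" "x \<noteq> 0" for x T and y :: 'y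
    by (rule order.trans[OF chr_weight_tail[OF b]]) (use that in \<open>auto intro: divide_right_mono\<close>)
  have A: "norm (evol (\<lambda>\<zeta>. of_real (annular_weight b \<zeta>)) x (y, T)) \<le> 12000000" for x T and y :: 'y
    by (rule order.trans[OF norm_evol_annular_weight_le[OF b, where A=4096]]) (auto intro!: chr_weight_bound[OF b])
  have At: "norm (evol (\<lambda>\<zeta>. of_real (annular_weight b \<zeta>)) x (y, T)) \<le> 12000000 / x\<^sup>2" if "24 * \<bar>T\<bar> \<le> \<bar>x\<bar>" "x \<noteq> 0" for x T and y :: 'y
  proof -
    have "norm (evol (\<lambda>\<zeta>. of_real (annular_weight b \<zeta>)) x (y, T)) \<le> 4 * (2560000 / x\<^sup>2)"
      by (rule norm_evol_annular_weight_le[OF b]; rule chr_weight_tail[OF b]) (use that in auto)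
    also have "\<dots> \<le> 12000000 / x\<^sup>2" by (simp add: divide_right_mono)
    finally show ?thesis .
  qed
  have Ad: "norm (evol (\<lambda>\<zeta>. of_real (annular_weight b \<zeta>)) x (y, T)) \<le> 12000000 * \<bar>T\<bar> powr (- \<theta>)" if "T \<noteq> 0" for x T and y :: 'y
  proof -
    have "norm (evol (\<lambda>\<zeta>. of_real (annular_weight b \<zeta>)) x (y, T)) \<le> 4 * (2560000 * \<bar>T\<bar> powr (- \<theta>))"
      by (intro norm_evol_annular_weight_le[OF b] chr_weight_decay[OF b] that \<theta>) auto
    also have "\<dots> \<le> 12000000 * \<bar>T\<bar> powr (- \<theta>)" by simp
    finally show ?thesis .
  qed
  have Jl: "1/1000000 \<le> ?J \<zeta>" if "norm \<zeta> \<le> 1/2" for \<zeta>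
  proof -
    have "9/16 * (9/16) \<le> ?J \<zeta>"
      unfolding chr_weight_def using chr_range[OF b that] by (intro mult_mono bump_lower) auto
    then show ?thesis by simp
  qed
  have An: "0 \<le> annular_weight b \<zeta>" for \<zeta> by (simp add: annular_weight_def)
  show ?thesis
  proof (rule maximal_estimate_of_unit_kernel[OF p s \<theta>(1,3), where C=12000000 and ?C0.0=24 and ?c0.0="1/1000000"
        and ?w0.0="?J" and w="annular_weight b"])
    show "real DIM(real \<times> 'y) + 4/p - 3 * \<theta> < 2 * s" using \<theta>(4) dim by simp
    show "norm (evol (\<lambda>\<zeta>. of_real (annular_weight b \<zeta>)) x (y, T)) \<le> 12000000 * \<bar>T\<bar> powr (- \<theta>)" if "T \<noteq> 0" for x T and y :: 'y
      by (rule Ad[OF that])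
    show "1/1000000 \<le> annular_weight b \<zeta>" if "1/4 \<le> norm \<zeta>" "norm \<zeta> \<le> 1/2" for \<zeta>
      by (rule annular_weight_lower[OF b that])
  qed (use J Jt A At Jl An in \<open>auto intro: integrable_annular_weight[OF b] evol_chr_weight(2)[OF b]\<close>)
qed

subsection \<open>Gaussian Schwartz functions\<close>

text \<open>\<open>V\<close> lists linear functionals whose squares sum to the quadratic form, which
  permits anisotropic Gaussians; \<open>\<omega>\<close> modulates to a frequency. As
  \<open>V\<close> is a set, coinciding vectors would count once.\<close>

definition gauss :: "'a::euclidean_space set \<Rightarrow> 'a \<Rightarrow> 'a \<Rightarrow> complex" where
  "gauss V \<omega> z = exp (of_real (- (\<Sum>v\<in>V. (z \<bullet> v)\<^sup>2) / 2) + \<i> * of_real (z \<bullet> \<omega>))"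

lemma gauss_eq: "gauss V \<omega> z = of_real (exp (- (\<Sum>v\<in>V. (z \<bullet> v)\<^sup>2) / 2)) * cis (z \<bullet> \<omega>)"
  unfolding gauss_def exp_add cis_conv_exp by (simp only: exp_of_real)

text \<open>Polynomials times a fixed Gaussian, closed under everything a directional derivative
  produces. Smoothness and rapid decay follow by induction, with no formula for higher
  derivatives.\<close>

inductive_set poly_gauss :: "'a::euclidean_space set \<Rightarrow> 'a \<Rightarrow> ('a \<Rightarrow> complex) set" for V \<omega> where
  base: "gauss V \<omega> \<in> poly_gauss V \<omega>"
| inner: "f \<in> poly_gauss V \<omega> \<Longrightarrow> (\<lambda>z. of_real (z \<bullet> v) * f z) \<in> poly_gauss V \<omega>"
| scale: "f \<in> poly_gauss V \<omega> \<Longrightarrow> (\<lambda>z. c * f z) \<in> poly_gauss V \<omega>"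
| add: "f \<in> poly_gauss V \<omega> \<Longrightarrow> g \<in> poly_gauss V \<omega> \<Longrightarrow> (\<lambda>z. f z + g z) \<in> poly_gauss V \<omega>"

lemma poly_gauss_sum:
  assumes "finite A" "\<And>a. a \<in> A \<Longrightarrow> f a \<in> poly_gauss V \<omega>"
  shows "(\<lambda>z. \<Sum>a\<in>A. f a z) \<in> poly_gauss V \<omega>"
  using assms
proof (induction A rule: finite_induct)
  case empty
  show ?case using poly_gauss.scale[OF poly_gauss.base, of 0] by simp
next
  case (insert a A)
  then show ?case by (simp add: poly_gauss.add)
qed

lemma has_derivative_gauss:
  fixes V :: "'a::euclidean_space set"
  assumes "finite V"
  shows "(gauss V \<omega> has_derivative
    (\<lambda>h. (of_real (- (\<Sum>v\<in>V. (z \<bullet> v) * (h \<bullet> v))) + \<i> * of_real (h \<bullet> \<omega>)) * gauss V \<omega> z)) (at z)"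
proof -
  let ?p = "\<lambda>z. complex_of_real (- (\<Sum>v\<in>V. (z \<bullet> v)\<^sup>2) / 2) + \<i> * of_real (z \<bullet> \<omega>)"
  have r: "((\<lambda>z. - (\<Sum>v\<in>V. (z \<bullet> v)\<^sup>2) / 2) has_derivative (\<lambda>h. - (\<Sum>v\<in>V. (z \<bullet> v) * (h \<bullet> v)))) (at z)"
  proof -
    have "((\<lambda>z. - (\<Sum>v\<in>V. (z \<bullet> v)\<^sup>2) / 2) has_derivative (\<lambda>h. - (\<Sum>v\<in>V. 2 * (h \<bullet> v) * (z \<bullet> v)) / 2)) (at z)"
      by (auto intro!: derivative_eq_intros simp: mult_ac)
    then show ?thesis
      by (rule has_derivative_eq_rhs) (simp add: fun_eq_iff sum_divide_distrib mult.commute)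
  qed
  have "(?p has_derivative (\<lambda>h. of_real (- (\<Sum>v\<in>V. (z \<bullet> v) * (h \<bullet> v))) + \<i> * of_real (h \<bullet> \<omega>))) (at z)"
    by (intro has_derivative_add has_derivative_of_real r has_derivative_mult_right has_derivative_inner_left has_derivative_ident)
  from has_derivative_compose[OF this DERIV_exp[unfolded has_field_derivative_def]]
  show ?thesis unfolding gauss_def[abs_def] by (simp only: mult.commute)
qed

lemma poly_gauss_has_derivative:
  assumes V: "finite V" and "f \<in> poly_gauss V \<omega>"
  shows "\<exists>f'. (\<forall>z. (f has_derivative f' z) (at z)) \<and> (\<forall>h. (\<lambda>z. f' z h) \<in> poly_gauss V \<omega>)"
  using assms(2)
proof induction
  case base
  let ?f' = "\<lambda>z h. (of_real (- (\<Sum>v\<in>V. (z \<bullet> v) * (h \<bullet> v))) + \<i> * of_real (h \<bullet> \<omega>)) * gauss V \<omega> z"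
  have "(\<lambda>z. ?f' z h) \<in> poly_gauss V \<omega>" for h
  proof -
    have "(\<lambda>z. (\<Sum>v\<in>V. of_real (- (h \<bullet> v)) * (of_real (z \<bullet> v) * gauss V \<omega> z)) + (\<i> * of_real (h \<bullet> \<omega>)) * gauss V \<omega> z) \<in> poly_gauss V \<omega>"
      by (intro poly_gauss.intros poly_gauss_sum V)
    also have "(\<lambda>z. (\<Sum>v\<in>V. of_real (- (h \<bullet> v)) * (of_real (z \<bullet> v) * gauss V \<omega> z)) + (\<i> * of_real (h \<bullet> \<omega>)) * gauss V \<omega> z) = (\<lambda>z. ?f' z h)"
      by (simp add: fun_eq_iff sum_distrib_left sum_negf algebra_simps)
    finally show ?thesis .
  qed
  then show ?case using has_derivative_gauss[OF V] by (intro exI[of _ ?f']) simp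
next
  case (inner f v)
  then obtain f' where f': "\<And>z. (f has_derivative f' z) (at z)" "\<And>h. (\<lambda>z. f' z h) \<in> poly_gauss V \<omega>" by blast
  show ?case
  proof (intro exI[of _ "\<lambda>z h. of_real (z \<bullet> v) * f' z h + of_real (h \<bullet> v) * f z"] conjI allI)
    show "((\<lambda>z. of_real (z \<bullet> v) * f z) has_derivative (\<lambda>h. of_real (z \<bullet> v) * f' z h + of_real (h \<bullet> v) * f z)) (at z)" for z
      by (intro has_derivative_mult has_derivative_of_real has_derivative_inner_left has_derivative_ident f')
    show "(\<lambda>z. of_real (z \<bullet> v) * f' z h + of_real (h \<bullet> v) * f z) \<in> poly_gauss V \<omega>" for h
      by (intro poly_gauss.intros f' inner)
  qed
next
  case (scale f c)
  then obtain f' where f': "\<And>z. (f has_derivative f' z) (at z)" "\<And>h. (\<lambda>z. f' z h) \<in> poly_gauss V \<omega>" by blast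
  show ?case
    by (intro exI[of _ "\<lambda>z h. c * f' z h"] conjI allI has_derivative_mult_right poly_gauss.scale f')
next
  case (add f g)
  then obtain f' g' where f': "\<And>z. (f has_derivative f' z) (at z)" "\<And>h. (\<lambda>z. f' z h) \<in> poly_gauss V \<omega>"
    and g': "\<And>z. (g has_derivative g' z) (at z)" "\<And>h. (\<lambda>z. g' z h) \<in> poly_gauss V \<omega>" by blast
  show ?case
    by (intro exI[of _ "\<lambda>z h. f' z h + g' z h"] conjI allI has_derivative_add poly_gauss.add f' g')
qed

lemma iter_deriv_poly_gauss:
  assumes V: "finite V" and f: "f \<in> poly_gauss V \<omega>"
  shows "iter_deriv bs f \<in> poly_gauss V \<omega>"
proof (induction bs)
  case (Cons b bs)
  obtain f' where f': "\<And>z. (iter_deriv bs f has_derivative f' z) (at z)" "\<And>h. (\<lambda>z. f' z h) \<in> poly_gauss V \<omega>"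
    using poly_gauss_has_derivative[OF V Cons.IH] by blast
  have "frechet_derivative (iter_deriv bs f) (at z) = f' z" for z
    using frechet_derivative_at[OF f'(1)] by simp
  then show ?case using f'(2) by simp
qed (simp add: f)

text \<open>The power \<open>k\<close> is general because multiplication by a linear form consumes
  one more power of \<open>1 + |z|\<close>. In the base case \<open>1 + r \<le> exp r\<close>, and
  \<open>kr - cr^2/2\<close> has the maximum \<open>k^2 / (2c)\<close>.\<close>

lemma poly_gauss_decay:
  assumes "c > 0" and Q: "\<And>z. c * (norm z)\<^sup>2 \<le> (\<Sum>v\<in>V. (z \<bullet> v)\<^sup>2)" and "f \<in> poly_gauss V \<omega>"
  shows "\<exists>B. \<forall>z. (1 + norm z) ^ k * norm (f z) \<le> B"
  using assms(3)
proof (induction arbitrary: k)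
  case base
  show ?case
  proof (intro exI allI)
    fix z :: 'a
    let ?r = "norm z"
    have "(1 + ?r) ^ k \<le> exp ?r ^ k" by (intro power_mono exp_ge_add_one_self) auto
    also have "\<dots> = exp (k * ?r)" by (simp add: exp_of_nat_mult)
    finally have "(1 + ?r) ^ k * norm (gauss V \<omega> z) \<le> exp (k * ?r) * exp (- (\<Sum>v\<in>V. (z \<bullet> v)\<^sup>2) / 2)"
      unfolding gauss_eq by (simp add: norm_mult mult_right_mono)
    also have "\<dots> \<le> exp (k * ?r) * exp (- (c * ?r\<^sup>2) / 2)"
      using Q[of z] by (intro mult_left_mono) auto
    also have "\<dots> = exp (k * ?r - c * ?r\<^sup>2 / 2)" by (simp flip: exp_add)
    also have "\<dots> \<le> exp ((real k)\<^sup>2 / (2 * c))"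
    proof -
      have "0 \<le> (c * ?r - k)\<^sup>2 / (2 * c)" using \<open>c > 0\<close> by simp
      also have "\<dots> = (real k)\<^sup>2 / (2 * c) - (k * ?r - c * ?r\<^sup>2 / 2)"
        using \<open>c > 0\<close> by (simp add: power2_eq_square field_simps)
      finally show ?thesis by simp
    qed
    finally show "(1 + ?r) ^ k * norm (gauss V \<omega> z) \<le> exp ((real k)\<^sup>2 / (2 * c))" .
  qed
next
  case (inner f v)
  obtain B where B: "\<And>z. (1 + norm z) ^ Suc k * norm (f z) \<le> B" using inner.IH[of "Suc k"] by blast
  have "(1 + norm z) ^ k * norm (of_real (z \<bullet> v) * f z) \<le> norm v * B" for z
  proof -
    have "\<bar>z \<bullet> v\<bar> \<le> norm v * (1 + norm z)"
      using Cauchy_Schwarz_ineq2[of z v] by (simp add: distrib_left mult.commute add_increasing)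
    then have "(1 + norm z) ^ k * norm (of_real (z \<bullet> v) * f z) \<le> (1 + norm z) ^ k * (norm v * (1 + norm z) * norm (f z))"
      unfolding norm_mult norm_of_real by (intro mult_left_mono mult_right_mono) auto
    also have "\<dots> = norm v * ((1 + norm z) ^ Suc k * norm (f z))" by simp
    also have "\<dots> \<le> norm v * B" by (intro mult_left_mono B) auto
    finally show ?thesis .
  qed
  then show ?case by blast
next
  case (scale f a)
  obtain B where B: "\<And>z. (1 + norm z) ^ k * norm (f z) \<le> B" using scale.IH by blast
  have "(1 + norm z) ^ k * norm (a * f z) \<le> norm a * B" for z
    using mult_left_mono[OF B[of z] norm_ge_zero[of a]] by (simp add: norm_mult mult_ac)
  then show ?case by blast
next
  case (add f g)
  obtain B C where B: "\<And>z. (1 + norm z) ^ k * norm (f z) \<le> B" and C: "\<And>z. (1 + norm z) ^ k * norm (g z) \<le> C"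
    using add.IH by metis
  have "(1 + norm z) ^ k * norm (f z + g z) \<le> B + C" for z
  proof -
    have "(1 + norm z) ^ k * norm (f z + g z) \<le> (1 + norm z) ^ k * (norm (f z) + norm (g z))"
      by (intro mult_left_mono norm_triangle_ineq) auto
    then show ?thesis using B[of z] C[of z] by (simp add: distrib_left)
  qed
  then show ?case by blast
qed

lemma schwartz_gauss:
  assumes V: "finite V" and c: "c > 0" "\<And>z. c * (norm z)\<^sup>2 \<le> (\<Sum>v\<in>V. (z \<bullet> v)\<^sup>2)"
  shows "schwartz (gauss V \<omega>)"
  unfolding schwartz_def
proof (intro allI impI conjI)
  fix bs :: "'a list" and k :: nat and x
  have P: "iter_deriv bs (gauss V \<omega>) \<in> poly_gauss V \<omega>"
    by (intro iter_deriv_poly_gauss V poly_gauss.base)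
  show "iter_deriv bs (gauss V \<omega>) differentiable (at x)"
    using poly_gauss_has_derivative[OF V P] unfolding differentiable_def by blast
  show "\<exists>B. \<forall>x. (1 + norm x) ^ k * norm (iter_deriv bs (gauss V \<omega>) x) \<le> B"
    by (rule poly_gauss_decay[OF c P])
qed

text \<open>Read off from the characteristic function of the standard normal distribution, then
  dilated by \<open>a\<close>.\<close>

lemma gaussian_integral:
  assumes a: "a > 0"
  shows "integrable lborel (\<lambda>x. exp (- (a * x)\<^sup>2 / 2))"
    and "(LINT x|lborel. cis (t * x) * of_real (exp (- (a * x)\<^sup>2 / 2))) =
      of_real (sqrt (2 * pi) / a * exp (- (t / a)\<^sup>2 / 2))"
proof -
  have n: "exp (- x\<^sup>2 / 2) = sqrt (2 * pi) * std_normal_density x" for x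
    by (simp add: std_normal_density_def)
  have i1: "integrable lborel (\<lambda>x::real. exp (- x\<^sup>2 / 2))"
    unfolding n by (intro integrable_mult_right integrable_normal_density) simp
  have f1: "(LINT x|lborel. cis (t * x) * of_real (exp (- x\<^sup>2 / 2))) = of_real (sqrt (2 * pi) * exp (- t\<^sup>2 / 2))" for t
  proof -
    have "of_real (exp (- t\<^sup>2 / 2)) = char std_normal_distribution t"
      by (simp add: char_std_normal_distribution)
    also have "\<dots> = (LINT x|lborel. std_normal_density x *\<^sub>R cis (t * x))"
      unfolding char_def by (subst integral_density) (auto simp: cis_conv_exp)
    finally have "(LINT x|lborel. std_normal_density x *\<^sub>R cis (t * x)) = complex_of_real (exp (- t\<^sup>2 / 2))" ..
    moreover have "(LINT x|lborel. cis (t * x) * of_real (exp (- x\<^sup>2 / 2))) =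
        of_real (sqrt (2 * pi)) * (LINT x|lborel. std_normal_density x *\<^sub>R cis (t * x))"
      unfolding n by (simp add: scaleR_conv_of_real mult_ac flip: integral_mult_right_zero)
    ultimately show ?thesis by simp
  qed
  show "integrable lborel (\<lambda>x. exp (- (a * x)\<^sup>2 / 2))"
    using lborel_integrable_real_affine[OF i1, of a 0] a by simp
  have "(LINT x|lborel. cis (t / a * x) * complex_of_real (exp (- x\<^sup>2 / 2))) =
     \<bar>a\<bar> *\<^sub>R (LINT x|lborel. cis (t / a * (0 + a * x)) * complex_of_real (exp (- (0 + a * x)\<^sup>2 / 2)))"
    using a by (intro lborel_integral_real_affine) simp
  then have "of_real (sqrt (2 * pi) * exp (- (t / a)\<^sup>2 / 2)) =
    of_real a * (LINT x|lborel. cis (t * x) * complex_of_real (exp (- (a * x)\<^sup>2 / 2)))"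
    unfolding f1 using a by (simp add: scaleR_conv_of_real)
  then show "(LINT x|lborel. cis (t * x) * of_real (exp (- (a * x)\<^sup>2 / 2))) =
      of_real (sqrt (2 * pi) / a * exp (- (t / a)\<^sup>2 / 2))"
    using a by (simp add: field_simps)
qed

subsection \<open>Necessary conditions\<close>

lemma sobolev_norm_mono:
  assumes "s \<le> s'"
  shows "sobolev_norm s u \<le> sobolev_norm s' u"
proof -
  have root_mono: "ennreal_root 2 a \<le> ennreal_root 2 b" if "a \<le> b" for a b
    using that unfolding ennreal_root_def
    by (auto simp: top_unique less_top intro!: ennreal_leI powr_mono2 enn2real_mono)
  show ?thesis unfolding sobolev_norm_def
    using assms by (intro root_mono nn_integral_mono ennreal_leI mult_right_mono powr_mono) auto
qed

text \<open>The lower bounds on \<open>s\<close> are proved for nonnegative or positive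
  \<open>s\<close>; this moves a supposed estimate at a smaller \<open>s\<close> into that
  range.\<close>

lemma maximal_estimate_mono:
  assumes "s \<le> s'" "maximal_estimate TYPE('y::euclidean_space) p s"
  shows "maximal_estimate TYPE('y) p s'"
proof -
  obtain C where "C > 0" and C: "\<And>u :: real \<times> 'y \<Rightarrow> complex. schwartz u \<Longrightarrow>
     mixed_norm p (\<lambda>x y t. propagator t u (x, y)) \<le> ennreal C * sobolev_norm s u"
    using assms(2) unfolding maximal_estimate_def by blast
  show ?thesis unfolding maximal_estimate_def
    by (intro exI[of _ C] conjI allI impI order.trans[OF C mult_left_mono[OF sobolev_norm_mono[OF assms(1)]]] \<open>C > 0\<close>) auto
qed

lemma powr_growth_compare:
  assumes "a > 0" and le: "\<And>L::real. L \<ge> 1 \<Longrightarrow> a * L powr e1 \<le> b * L powr e2"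
  shows "e1 \<le> e2"
proof (rule ccontr)
  assume "\<not> e1 \<le> e2"
  \<comment> \<open>Chosen so that \<open>L powr (e1 - e2) = |b| / a + 1\<close>, which makes the
    left side exceed the right by at least \<open>a * L powr e2\<close>.\<close>
  define L where "L = (\<bar>b\<bar> / a + 1) powr (1 / (e1 - e2))"
  have L1: "L \<ge> 1" unfolding L_def using assms(1) \<open>\<not> e1 \<le> e2\<close> by (intro ge_one_powr_ge_zero) auto
  have "L powr e1 = L powr (e1 - e2) * L powr e2" by (simp flip: powr_add)
  also have "L powr (e1 - e2) = \<bar>b\<bar> / a + 1"
    using \<open>\<not> e1 \<le> e2\<close> assms(1) by (simp add: L_def powr_powr add_nonneg_pos)
  finally have "a * L powr e1 = (\<bar>b\<bar> + a) * L powr e2" using assms(1) by (simp add: field_simps)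
  then have "(\<bar>b\<bar> + a) * L powr e2 \<le> b * L powr e2" using le[OF L1] by simp
  then have "\<bar>b\<bar> + a \<le> b" using L1 by (simp add: mult_le_cancel_right)
  then show False using assms(1) by linarith
qed

lemma ennreal_root_lower:
  assumes "ennreal z \<le> a" "z \<ge> 0" "p > 0"
  shows "ennreal (z powr (1/p)) \<le> ennreal_root p a"
proof (cases "a = \<infinity>")
  case False
  then have "z \<le> enn2real a" using assms by (metis enn2real_ennreal enn2real_mono infinity_ennreal_def less_top)
  then show ?thesis using False assms unfolding ennreal_root_def by (auto intro!: ennreal_leI powr_mono2)
qed (simp add: ennreal_root_def)

lemma mixed_norm_lower:
  assumes "p > 0" "c \<ge> 0" "a \<le> b"
    and F: "\<And>x. x \<in> {a..b} \<Longrightarrow> \<exists>y. \<exists>t\<in>{0..1}. c \<le> norm (F x y t)"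
  shows "ennreal (c * (b - a) powr (1/p)) \<le> mixed_norm p F"
proof -
  have "ennreal (c powr p * (b - a)) = (\<integral>\<^sup>+x. ennreal (c powr p) * indicator {a..b} x \<partial>lborel)"
    using assms by (simp add: nn_integral_cmult_indicator ennreal_mult)
  also have "\<dots> \<le> (\<integral>\<^sup>+x. (SUP (y, t) \<in> UNIV \<times> {0..1}. ennreal (norm (F x y t) powr p)) \<partial>lborel)"
  proof (rule nn_integral_mono)
    fix x
    show "ennreal (c powr p) * indicator {a..b} x \<le> (SUP (y, t) \<in> UNIV \<times> {0..1}. ennreal (norm (F x y t) powr p))"
    proof (cases "x \<in> {a..b}")
      case True
      then obtain y t where t: "t \<in> {0..1}" "c \<le> norm (F x y t)" using F by blast
      have "ennreal (c powr p) \<le> ennreal (norm (F x y t) powr p)"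
        using t assms by (intro ennreal_leI powr_mono2) auto
      also have "\<dots> \<le> (SUP (y, t) \<in> UNIV \<times> {0..1}. ennreal (norm (F x y t) powr p))"
        using t by (intro SUP_upper2[where i="(y, t)"]) auto
      finally show ?thesis using True by simp
    qed simp
  qed
  finally have "ennreal ((c powr p * (b - a)) powr (1/p)) \<le> mixed_norm p F"
    unfolding mixed_norm_def using assms by (intro ennreal_root_lower) auto
  also have "(c powr p * (b - a)) powr (1/p) = c * (b - a) powr (1/p)"
    using assms by (simp add: powr_mult powr_powr)
  finally show ?thesis .
qed

lemma sobolev_norm_upper:
  assumes "(\<integral>\<^sup>+\<zeta>. ennreal ((1 + (norm \<zeta>)\<^sup>2) powr s * (norm (fourier u \<zeta>))\<^sup>2) \<partial>lborel) \<le> ennreal z" "z \<ge> 0"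
  shows "sobolev_norm s u \<le> ennreal (z powr (1/2))"
  unfolding sobolev_norm_def using assms by (intro ennreal_root_mono_real) auto

text \<open>Testing the estimate on a family with known power growth of both norms turns it into an
  inequality between exponents.\<close>

lemma maximal_estimate_compare:
  assumes me: "maximal_estimate TYPE('y::euclidean_space) p s" and a: "a > 0" and b: "b \<ge> 0"
    and fam: "\<And>L::real. L \<ge> 1 \<Longrightarrow> \<exists>u :: real \<times> 'y \<Rightarrow> complex. schwartz u \<and>
      ennreal (a * L powr e1) \<le> mixed_norm p (\<lambda>x y t. propagator t u (x, y)) \<and>
      sobolev_norm s u \<le> ennreal (b * L powr e2)"
  shows "e1 \<le> e2"
proof -
  obtain C where C0: "C > 0" and C: "\<And>u :: real \<times> 'y \<Rightarrow> complex. schwartz u \<Longrightarrow>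
     mixed_norm p (\<lambda>x y t. propagator t u (x, y)) \<le> ennreal C * sobolev_norm s u"
    using me unfolding maximal_estimate_def by blast
  show ?thesis
  proof (rule powr_growth_compare[OF a, where b="C * b"])
    fix L :: real assume "L \<ge> 1"
    then obtain u :: "real \<times> 'y \<Rightarrow> complex" where u: "schwartz u"
      "ennreal (a * L powr e1) \<le> mixed_norm p (\<lambda>x y t. propagator t u (x, y))"
      "sobolev_norm s u \<le> ennreal (b * L powr e2)" using fam by blast
    have "ennreal (a * L powr e1) \<le> ennreal C * ennreal (b * L powr e2)"
      using u(2) C[OF u(1)] mult_left_mono[OF u(3), of "ennreal C"] by (meson order_trans zero_le)
    also have "\<dots> = ennreal (C * b * L powr e2)" using C0 b by (simp add: ennreal_mult mult.assoc)
    finally show "a * L powr e1 \<le> C * b * L powr e2" using C0 b by (subst (asm) ennreal_le_iff) auto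
  qed
qed

section \<open>Concentrating Gaussians and the exponent \<open>d/2 - 1/p\<close>\<close>

lemma isotropic_gaussian_integral:
  fixes z :: "'a::euclidean_space"
  assumes a: "a > 0"
  shows "integrable lborel (\<lambda>\<zeta>::'a. exp (- (a * norm \<zeta>)\<^sup>2 / 2))"
    and "(LINT \<zeta>|lborel. cis (z \<bullet> \<zeta>) * of_real (exp (- (a * norm \<zeta>)\<^sup>2 / 2))) =
      of_real ((sqrt (2 * pi) / a) ^ DIM('a) * exp (- (norm z / a)\<^sup>2 / 2))"
proof -
  have ns: "(norm \<zeta>)\<^sup>2 = (\<Sum>b\<in>Basis. (\<zeta> \<bullet> b)\<^sup>2)" for \<zeta> :: 'a
    unfolding power2_norm_eq_inner euclidean_inner[of \<zeta> \<zeta>] by (simp add: power2_eq_square)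
  have ex: "exp (- (a * norm \<zeta>)\<^sup>2 / 2) = (\<Prod>b\<in>Basis. exp (- (a * (\<zeta> \<bullet> b))\<^sup>2 / 2))" for \<zeta> :: 'a and a
    by (simp add: power_mult_distrib ns sum_distrib_left sum_divide_distrib flip: exp_sum sum_negf)
  have ci: "cis (z \<bullet> \<zeta>) = (\<Prod>b\<in>Basis. cis ((z \<bullet> b) * (\<zeta> \<bullet> b)))" for \<zeta>
    unfolding euclidean_inner[of z \<zeta>] by (simp add: cis_sum)
  have i: "integrable lborel (\<lambda>v. cis (t * v) * complex_of_real (exp (- (a * v)\<^sup>2 / 2)))" for t
    using gaussian_integral(1)[OF a] by (intro integrable_cis_mult) auto
  have "(\<lambda>\<zeta>. cis (z \<bullet> \<zeta>) * of_real (exp (- (a * norm \<zeta>)\<^sup>2 / 2))) =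
      (\<lambda>\<zeta>. \<Prod>b\<in>Basis. (\<lambda>b v. cis ((z \<bullet> b) * v) * of_real (exp (- (a * v)\<^sup>2 / 2))) b (\<zeta> \<bullet> b))"
    by (simp only: ci ex prod.distrib of_real_prod)
  then have "(LINT \<zeta>|lborel. cis (z \<bullet> \<zeta>) * of_real (exp (- (a * norm \<zeta>)\<^sup>2 / 2))) =
    (\<Prod>b\<in>Basis. LINT v|lborel. (\<lambda>b v. cis ((z \<bullet> b) * v) * of_real (exp (- (a * v)\<^sup>2 / 2))) b v)"
    by (simp only:) (intro integral_lborel_prod_Basis i)
  also have "\<dots> = (\<Prod>b\<in>Basis. complex_of_real (sqrt (2 * pi) / a * exp (- ((z \<bullet> b) / a)\<^sup>2 / 2)))"
    by (simp only: gaussian_integral(2)[OF a])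
  also have "\<dots> = of_real ((sqrt (2 * pi) / a) ^ DIM('a) * exp (- (1 / a * norm z)\<^sup>2 / 2))"
  proof -
    have "(z \<bullet> b) / a = 1 / a * (z \<bullet> b)" for b by simp
    then show ?thesis by (simp only: ex of_real_prod[symmetric] prod.distrib prod_constant)
  qed
  finally show "(LINT \<zeta>|lborel. cis (z \<bullet> \<zeta>) * of_real (exp (- (a * norm \<zeta>)\<^sup>2 / 2))) =
      of_real ((sqrt (2 * pi) / a) ^ DIM('a) * exp (- (norm z / a)\<^sup>2 / 2))" by simp
  have "integrable lborel (\<lambda>\<zeta>::'a. Re (\<Prod>b\<in>Basis. (\<lambda>b v. complex_of_real (exp (- (a * v)\<^sup>2 / 2))) b (\<zeta> \<bullet> b)))"
    using gaussian_integral(1)[OF a] by (intro integrable_Re integral_lborel_prod_Basis) auto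
  then show "integrable lborel (\<lambda>\<zeta>::'a. exp (- (a * norm \<zeta>)\<^sup>2 / 2))"
    unfolding ex by (simp flip: of_real_prod)
qed

lemma normalisation: "(2 * pi) powr (- real n / 2) * sqrt (2 * pi) ^ n = 1"
proof -
  have "sqrt (2 * pi) ^ n = (2 * pi) powr (real n / 2)"
    by (simp add: powr_half_sqrt[symmetric] powr_powr flip: powr_realpow)
  then show ?thesis by (simp flip: powr_add)
qed

text \<open>Half of the Gaussian decay pays for the Sobolev weight. With
  \<open>\<rho> = (r/L)^2\<close>, \<open>1 + r^2 \<le> L^2 (1 + \<rho>)\<close>, and
  \<open>1 + \<rho>\<close> is at most a constant times \<open>exp (\<rho> / (2s))\<close>, whose
  power \<open>s\<close> is \<open>exp (\<rho> / 2)\<close>.\<close>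

lemma weight_gaussian_bound:
  assumes s: "s > 0" and L: "L \<ge> (1::real)"
  shows "(1 + r\<^sup>2) powr s * exp (- (1 / L * r)\<^sup>2) \<le> max 1 (2 * s) powr s * L powr (2 * s) * exp (- (1 / L * r)\<^sup>2 / 2)"
proof -
  define \<rho> where "\<rho> = (1 / L * r)\<^sup>2"
  have \<rho>0: "\<rho> \<ge> 0" by (simp add: \<rho>_def)
  define m where "m = max 1 (2 * s)"
  have m: "m \<ge> 1" "m \<ge> 2 * s" "m > 0" by (auto simp: m_def)
  have L2: "1 \<le> L\<^sup>2" using L by simp
  have r: "r\<^sup>2 = L\<^sup>2 * \<rho>" using L by (simp add: \<rho>_def power_mult_distrib power_divide)
  have "1 + r\<^sup>2 \<le> L\<^sup>2 * (1 + \<rho>)" unfolding r using L2 \<rho>0 by (simp add: distrib_left)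
  also have "1 + \<rho> \<le> m * (1 + \<rho> / (2 * s))"
  proof -
    have "\<rho> * (2 * s) \<le> \<rho> * m" using m \<rho>0 by (intro mult_left_mono) auto
    then have "\<rho> \<le> m * (\<rho> / (2 * s))" using s by (simp add: field_simps)
    then show ?thesis using m by (simp add: distrib_left)
  qed
  also have "1 + \<rho> / (2 * s) \<le> exp (\<rho> / (2 * s))" by (rule exp_ge_add_one_self)
  finally have "1 + r\<^sup>2 \<le> L\<^sup>2 * (m * exp (\<rho> / (2 * s)))" using m L by (simp add: mult_left_mono)
  then have "(1 + r\<^sup>2) powr s \<le> (L\<^sup>2 * (m * exp (\<rho> / (2 * s)))) powr s"
    using s by (intro powr_mono2) auto
  also have "\<dots> = m powr s * L powr (2 * s) * exp (\<rho> / 2)"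
  proof -
    have "(L\<^sup>2) powr s = L powr (2 * s)" using L powr_powr[of L 2 s] by (simp add: powr_numeral)
    moreover have "exp (\<rho> / (2 * s)) powr s = exp (\<rho> / 2)" using s by (simp add: powr_def)
    ultimately show ?thesis using m by (simp add: powr_mult)
  qed
  finally have "(1 + r\<^sup>2) powr s * exp (- \<rho>) \<le> m powr s * L powr (2 * s) * exp (\<rho> / 2) * exp (- \<rho>)"
    by (intro mult_right_mono) auto
  also have "\<dots> = m powr s * L powr (2 * s) * exp (- \<rho> / 2)"
    by (simp add: mult.assoc flip: exp_add)
  finally show ?thesis by (simp add: m_def \<rho>_def)
qed

lemma dilation_powers:
  assumes "L > (0::real)"
  shows "((1 / L) ^ d)\<^sup>2 * L ^ d * L powr (2 * s) = L powr (2 * (s - real d / 2))"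
proof -
  have "2 * (s - real d / 2) = - real d + 2 * s" by simp
  then have "L powr (2 * (s - real d / 2)) = 1 / L ^ d * L powr (2 * s)"
    using assms by (simp only: powr_add powr_minus_divide powr_realpow)
  moreover have "((1 / L) ^ d)\<^sup>2 * L ^ d = 1 / L ^ d"
    using assms by (simp add: power_divide power2_eq_square)
  ultimately show ?thesis by simp
qed

text \<open>The Gaussian has height at least \<open>exp (-1/2)\<close> for
  \<open>0 \<le> x \<le> 1/L\<close> and \<open>y = 0\<close>, so its mixed norm is at least of
  order \<open>L^(-1/p)\<close>. Its Fourier transform has height \<open>L^(-d)\<close> and width
  \<open>L\<close>, so its Sobolev norm is at most of order \<open>L^(s - d/2)\<close>.\<close>

theorem concentration_lower_bound:
  assumes me: "maximal_estimate TYPE('y::euclidean_space) p s" and p: "p \<ge> 2" and s: "s > 0"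
  shows "- (1/p) \<le> s - real DIM(real \<times> 'y) / 2"
proof -
  let ?d = "DIM(real \<times> 'y)"
  define K where "K = max 1 (2 * s) powr s * sqrt (2 * pi) ^ ?d"
  have K0: "K \<ge> 0" by (simp add: K_def)
  show ?thesis
  proof (rule maximal_estimate_compare[OF me, where a="exp (- 1/2)" and b="sqrt K"])
    fix L :: real assume L: "L \<ge> 1"
    define V where "V = (\<lambda>b. L *\<^sub>R b) ` (Basis :: (real \<times> 'y) set)"
    define u where "u = gauss V (0 :: real \<times> 'y)"
    have "finite V" by (simp add: V_def)
    have Q: "(\<Sum>v\<in>V. (z \<bullet> v)\<^sup>2) = (L * norm z)\<^sup>2" for z
    proof -
      have "(\<Sum>v\<in>V. (z \<bullet> v)\<^sup>2) = (\<Sum>b\<in>Basis. (z \<bullet> (L *\<^sub>R b))\<^sup>2)"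
        unfolding V_def using L by (subst sum.reindex) (auto simp: inj_on_def)
      also have "\<dots> = L\<^sup>2 * (norm z)\<^sup>2"
        unfolding power2_norm_eq_inner euclidean_inner[of z z]
        by (simp add: power2_eq_square sum_distrib_left mult_ac)
      finally show ?thesis by (simp add: power_mult_distrib)
    qed
    have u: "u z = of_real (exp (- (L * norm z)\<^sup>2 / 2))" for z by (simp add: u_def gauss_eq Q)
    have "schwartz u" unfolding u_def
      by (rule schwartz_gauss[OF \<open>finite V\<close>, of "L\<^sup>2"]) (use L in \<open>auto simp: Q power_mult_distrib\<close>)
    have nrm: "complex_of_real ((2 * pi) powr (- real ?d / 2)) * of_real (sqrt (2 * pi) ^ ?d * x) = of_real x" for x
      using normalisation[of ?d] by (simp only: of_real_mult[symmetric] mult.assoc[symmetric] mult_1_left)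
    have fu: "fourier u \<zeta> = of_real ((1 / L) ^ ?d * exp (- (1 / L * norm \<zeta>)\<^sup>2 / 2))" for \<zeta>
    proof -
      have "(LINT z|lborel. cis (- (z \<bullet> \<zeta>)) * u z) =
        of_real (sqrt (2 * pi) ^ ?d * ((1 / L) ^ ?d * exp (- (1 / L * norm \<zeta>)\<^sup>2 / 2)))"
        using isotropic_gaussian_integral(2)[of L "- \<zeta>"] L
        by (simp add: u inner_commute power_divide)
      then show ?thesis unfolding fourier_def by (simp only: nrm)
    qed
    have U0: "propagator 0 u z = u z" for z
    proof -
      have "(LINT \<zeta>|lborel. cis (z \<bullet> \<zeta>) * fourier u \<zeta>) =
        of_real ((1 / L) ^ ?d) * (LINT \<zeta>|lborel. cis (z \<bullet> \<zeta>) * of_real (exp (- (1 / L * norm \<zeta>)\<^sup>2 / 2)))"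
        unfolding fu of_real_mult mult.left_commute[of "cis _"] by (rule integral_mult_right_zero)
      also have "\<dots> = of_real (sqrt (2 * pi) ^ ?d * exp (- (L * norm z)\<^sup>2 / 2))"
        using isotropic_gaussian_integral(2)[of "1 / L" z] L
        by (simp add: power_divide power_mult_distrib mult.commute)
      finally show ?thesis
        unfolding propagator_def inv_fourier_def u by (simp only: nrm mult_zero_left cis_zero mult_1_left)
    qed
    have "ennreal (exp (- 1/2) * (1 / L - 0) powr (1/p)) \<le> mixed_norm p (\<lambda>x y t. propagator t u (x, y))"
    proof (rule mixed_norm_lower)
      fix x assume x: "x \<in> {0..1 / L}"
      have "L * x \<le> L * (1 / L)" using x L by (intro mult_left_mono) auto
      then have "(L * x)\<^sup>2 \<le> 1\<^sup>2" using x L by (intro power_mono) auto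
      then have "exp (- 1/2) \<le> norm (propagator 0 u (x, 0))"
        by (simp add: U0 u norm_prod_def power_mult_distrib)
      then show "\<exists>y. \<exists>t\<in>{0..1}. exp (- 1/2) \<le> norm (propagator t u (x, y))"
        by (intro exI[of _ 0] bexI[of _ 0]) auto
    qed (use p L in auto)
    moreover have "(1 / L - 0) powr (1/p) = L powr (- (1/p))" using L by (simp add: powr_minus_divide powr_divide)
    ultimately have lower: "ennreal (exp (- 1/2) * L powr (- (1/p))) \<le> mixed_norm p (\<lambda>x y t. propagator t u (x, y))"
      by simp
    have "(\<integral>\<^sup>+\<zeta>. ennreal ((1 + (norm \<zeta>)\<^sup>2) powr s * (norm (fourier u \<zeta>))\<^sup>2) \<partial>lborel) \<le>
      (\<integral>\<^sup>+\<zeta>. ennreal (((1 / L) ^ ?d)\<^sup>2 * max 1 (2 * s) powr s * L powr (2 * s) * exp (- (1 / L * norm (\<zeta> :: real \<times> 'y))\<^sup>2 / 2)) \<partial>lborel)"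
    proof (intro nn_integral_mono ennreal_leI)
      fix \<zeta> :: "real \<times> 'y"
      have "(norm (fourier u \<zeta>))\<^sup>2 = ((1 / L) ^ ?d)\<^sup>2 * exp (- (1 / L * norm \<zeta>)\<^sup>2)"
      proof -
        have "(exp (- (1 / L * norm \<zeta>)\<^sup>2 / 2))\<^sup>2 = exp (- (1 / L * norm \<zeta>)\<^sup>2)"
          by (simp flip: exp_double)
        then show ?thesis unfolding fu norm_of_real power2_abs power_mult_distrib by (simp only:)
      qed
      then have "(1 + (norm \<zeta>)\<^sup>2) powr s * (norm (fourier u \<zeta>))\<^sup>2 =
         ((1 / L) ^ ?d)\<^sup>2 * ((1 + (norm \<zeta>)\<^sup>2) powr s * exp (- (1 / L * norm \<zeta>)\<^sup>2))" by simp
      also have "\<dots> \<le> ((1 / L) ^ ?d)\<^sup>2 * (max 1 (2 * s) powr s * L powr (2 * s) * exp (- (1 / L * norm \<zeta>)\<^sup>2 / 2))"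
        by (intro mult_left_mono weight_gaussian_bound s L) auto
      finally show "(1 + (norm \<zeta>)\<^sup>2) powr s * (norm (fourier u \<zeta>))\<^sup>2 \<le>
        ((1 / L) ^ ?d)\<^sup>2 * max 1 (2 * s) powr s * L powr (2 * s) * exp (- (1 / L * norm \<zeta>)\<^sup>2 / 2)"
        by (simp only: mult.assoc)
    qed
    also have "\<dots> = ennreal (LINT \<zeta>|(lborel :: (real \<times> 'y) measure). ((1 / L) ^ ?d)\<^sup>2 * max 1 (2 * s) powr s * L powr (2 * s) * exp (- (1 / L * norm \<zeta>)\<^sup>2 / 2))"
      using L by (intro nn_integral_eq_integral integrable_mult_right isotropic_gaussian_integral) auto
    also have "(LINT \<zeta>|(lborel :: (real \<times> 'y) measure). ((1 / L) ^ ?d)\<^sup>2 * max 1 (2 * s) powr s * L powr (2 * s) * exp (- (1 / L * norm \<zeta>)\<^sup>2 / 2)) =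
      K * L powr (2 * (s - real ?d / 2))"
    proof -
      have "complex_of_real (LINT \<zeta>|(lborel :: (real \<times> 'y) measure). exp (- (1 / L * norm \<zeta>)\<^sup>2 / 2)) =
        of_real ((sqrt (2 * pi) / (1 / L)) ^ ?d)"
        using isotropic_gaussian_integral(2)[of "1 / L" "0 :: real \<times> 'y"] L by simp
      then have I: "(LINT \<zeta>|(lborel :: (real \<times> 'y) measure). exp (- (1 / L * norm \<zeta>)\<^sup>2 / 2)) = sqrt (2 * pi) ^ ?d * L ^ ?d"
        by (simp only: of_real_eq_iff) (simp add: power_mult_distrib)
      have "((1 / L) ^ ?d)\<^sup>2 * L ^ ?d * L powr (2 * s) = L powr (2 * (s - real ?d / 2))"
        using L by (intro dilation_powers) simp
      from this[symmetric] show ?thesis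
        unfolding integral_mult_right_zero I K_def by (simp only: mult_ac)
    qed
    finally have "sobolev_norm s u \<le> ennreal ((K * L powr (2 * (s - real ?d / 2))) powr (1/2))"
      using K0 by (intro sobolev_norm_upper) auto
    also have "(K * L powr (2 * (s - real ?d / 2))) powr (1/2) = sqrt K * L powr (s - real ?d / 2)"
    proof -
      have "(K * L powr (2 * e)) powr (1/2) = sqrt K * L powr e" for e
        using K0 L by (simp add: powr_mult powr_powr powr_half_sqrt)
      then show ?thesis .
    qed
    finally show "\<exists>u :: real \<times> 'y \<Rightarrow> complex. schwartz u \<and>
      ennreal (exp (- 1/2) * L powr (- (1/p))) \<le> mixed_norm p (\<lambda>x y t. propagator t u (x, y)) \<and>
      sobolev_norm s u \<le> ennreal (sqrt K * L powr (s - real ?d / 2))"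
      using \<open>schwartz u\<close> lower by blast
  qed (use K0 in auto)
qed

section \<open>Wave packets in two dimensions and the exponent \<open>3/4\<close>\<close>

text \<open>Normal form of the packet integrals after centring and rescaling. The factor in
  \<open>1 * r\<close> matches \<open>gaussian_integral\<close> with \<open>a = 1\<close>.\<close>

definition fresnel :: "real \<Rightarrow> real \<Rightarrow> complex" where
  "fresnel a c = (LINT r|lborel. cis (a * r\<^sup>2 + c * r ^ 3) * of_real (exp (- (1 * r)\<^sup>2 / 2)))"

text \<open>At \<open>(0, 0)\<close> the value is \<open>sqrt (2 * pi) > 1\<close>, and by dominated
  convergence the integral is continuous in its coefficients.\<close>

lemma fresnel_lower:
  obtains \<rho> where "\<rho> > 0" "\<And>a c. \<bar>a\<bar> \<le> \<rho> \<Longrightarrow> \<bar>c\<bar> \<le> \<rho> \<Longrightarrow> 1 \<le> norm (fresnel a c)"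
proof -
  have cont: "continuous_on UNIV (\<lambda>p. fresnel (fst p) (snd p))"
  proof (rule continuous_on_sequentiallyI)
    fix u :: "nat \<Rightarrow> real \<times> real" and l
    assume u: "u \<longlonglongrightarrow> l"
    show "(\<lambda>n. fresnel (fst (u n)) (snd (u n))) \<longlonglongrightarrow> fresnel (fst l) (snd l)"
      unfolding fresnel_def
    proof (rule integral_dominated_convergence[where w="\<lambda>r. exp (- (1 * r)\<^sup>2 / 2)"])
      show "integrable lborel (\<lambda>r::real. exp (- (1 * r)\<^sup>2 / 2))" by (rule gaussian_integral) simp
      show "AE r in lborel. (\<lambda>n. cis (fst (u n) * r\<^sup>2 + snd (u n) * r ^ 3) * complex_of_real (exp (- (1 * r)\<^sup>2 / 2)))
        \<longlonglongrightarrow> cis (fst l * r\<^sup>2 + snd l * r ^ 3) * complex_of_real (exp (- (1 * r)\<^sup>2 / 2))"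
      proof (rule AE_I2)
        fix r :: real
        have "continuous_on UNIV (\<lambda>p. cis (fst p * r\<^sup>2 + snd p * r ^ 3) * complex_of_real (exp (- (1 * r)\<^sup>2 / 2)))"
          by (intro continuous_intros)
        from continuous_on_tendsto_compose[OF this u]
        show "(\<lambda>n. cis (fst (u n) * r\<^sup>2 + snd (u n) * r ^ 3) * complex_of_real (exp (- (1 * r)\<^sup>2 / 2)))
          \<longlonglongrightarrow> cis (fst l * r\<^sup>2 + snd l * r ^ 3) * complex_of_real (exp (- (1 * r)\<^sup>2 / 2))" by simp
      qed
    qed (auto simp: norm_mult)
  qed
  have "fresnel 0 0 = of_real (sqrt (2 * pi))"
    using gaussian_integral(2)[of 1 0] by (simp add: fresnel_def)
  moreover have "1 < sqrt (2 * pi)" using pi_gt3 by (intro real_less_rsqrt) auto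
  ultimately have "1 < norm (fresnel (fst (0, 0)) (snd (0, 0)))" by simp
  moreover have "open {p. 1 < norm (fresnel (fst p) (snd p))}"
    using cont by (intro open_Collect_less continuous_intros)
  ultimately obtain e where e: "e > 0" "ball (0, 0) e \<subseteq> {p. 1 < norm (fresnel (fst p) (snd p))}"
    by (metis (mono_tags, lifting) mem_Collect_eq openE)
  show thesis
  proof (rule that[of "e / 3"])
    fix a c assume "\<bar>a\<bar> \<le> e / 3" "\<bar>c\<bar> \<le> e / 3"
    then have "norm (a, c) < e" using norm_Pair_le[of a c] e(1) by simp
    moreover have "dist (0, 0) (a, c) = norm (a, c)" by (metis dist_0_norm zero_prod_def)
    ultimately have "(a, c) \<in> ball (0, 0) e" by (simp only: mem_ball)
    then show "1 \<le> norm (fresnel a c)" using e(2) by force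
  qed (use e in simp)
qed

lemma nn_integral_cmult_cmult:
  assumes "H \<in> borel_measurable M"
  shows "(\<integral>\<^sup>+r. k * (c * H r) \<partial>M) = k * (c * (\<integral>\<^sup>+r. H r \<partial>M))"
  unfolding mult.assoc[symmetric] by (rule nn_integral_cmult[OF assms])

lemma nn_integral_cmult_cmult_multc:
  assumes "H \<in> borel_measurable M"
  shows "(\<integral>\<^sup>+r. d * (k * (H r * c)) \<partial>M) = d * (k * ((\<integral>\<^sup>+r. H r \<partial>M) * c))"
proof -
  have "(\<integral>\<^sup>+r. d * (k * (H r * c)) \<partial>M) = (\<integral>\<^sup>+r. (d * k * c) * H r \<partial>M)"
    by (intro nn_integral_cong) (simp only: mult_ac)
  also have "\<dots> = (d * k * c) * (\<integral>\<^sup>+r. H r \<partial>M)" by (rule nn_integral_cmult[OF assms])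
  finally show ?thesis by (simp only: mult_ac)
qed

lemma one_plus_square_le: "(1 + r\<^sup>2) * exp (- r\<^sup>2) \<le> 2 * exp (- (1 * r)\<^sup>2 / 2)" for r :: real
proof -
  have "1 + r\<^sup>2 \<le> 2 * (1 + r\<^sup>2 / 2)" by simp
  also have "\<dots> \<le> 2 * exp (r\<^sup>2 / 2)" by (rule mult_left_mono[OF exp_ge_add_one_self]) simp
  finally have "(1 + r\<^sup>2) * exp (- r\<^sup>2) \<le> 2 * exp (r\<^sup>2 / 2) * exp (- r\<^sup>2)" by (intro mult_right_mono) auto
  also have "\<dots> = 2 * exp (- (1 * r)\<^sup>2 / 2)" by (simp add: mult.assoc flip: exp_add)
  finally show ?thesis .
qed

text \<open>
  The width \<open>\<delta> = L\<^sup>-\<^sup>1\<^sup>/\<^sup>2\<close> of the packet in the second coordinate is the largest one for which the quadratic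
  term of the phase, of size \<open>L \<delta>\<^sup>2\<close>, stays bounded up to time \<open>1\<close>.
\<close>

locale packet =
  fixes b :: "'y::euclidean_space" and L :: real
  assumes b: "Basis = {b}" and L: "L \<ge> 1"
begin

definition \<delta> :: real where "\<delta> = L powr (- 1 / 2)"

lemma \<delta>: "\<delta> > 0" "\<delta> \<le> 1" "L * \<delta>\<^sup>2 = 1" "1 / \<delta> = L powr (1/2)"
proof -
  show "\<delta> > 0" using L by (simp add: \<delta>_def)
  show "\<delta> \<le> 1" using L powr_mono2'[of "- 1 / 2" 1 L] by (simp add: \<delta>_def)
  have "\<delta>\<^sup>2 = L powr (- 1)" unfolding \<delta>_def power2_eq_square by (simp flip: powr_add)
  then show "L * \<delta>\<^sup>2 = 1" using L by (simp add: powr_minus_divide)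
  show "1 / \<delta> = L powr (1/2)" unfolding \<delta>_def by (simp add: powr_minus_divide)
qed

text \<open>Vectors dual to the frequency coordinates: \<open>z \<bullet> \<zeta> = p (z \<bullet>
  v1) + q (z \<bullet> v2)\<close>. A Gaussian of width 1 in \<open>z \<bullet> v1\<close> and
  \<open>1/\<delta>\<close> in \<open>z \<bullet> v2\<close>, modulated by \<open>L\<close> in the
  latter, is localised at \<open>p = 0\<close> with width 1 and at \<open>q = L\<close> with width
  \<open>\<delta>\<close>.\<close>

definition v1 :: "real \<times> 'y" where "v1 = (1, sqrt 3 *\<^sub>R b)"
definition v2 :: "real \<times> 'y" where "v2 = (1, - sqrt 3 *\<^sub>R b)"
definition u :: "real \<times> 'y \<Rightarrow> complex" where "u = gauss {v1, \<delta> *\<^sub>R v2} (L *\<^sub>R v2)"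

lemma bb: "b \<bullet> b = 1"
  by (rule Basis_singleton_inner[OF b])

lemma v_inner: "z \<bullet> v1 = fst z + sqrt 3 * (snd z \<bullet> b)" "z \<bullet> v2 = fst z - sqrt 3 * (snd z \<bullet> b)"
  by (simp_all add: v1_def v2_def inner_prod_def)

text \<open>\<open>gauss\<close> sums over a set, so both squares appear only if the vectors
  differ.\<close>

lemma v_distinct: "v1 \<noteq> \<delta> *\<^sub>R v2"
proof
  assume "v1 = \<delta> *\<^sub>R v2"
  then have "v1 \<bullet> (0, b) = (\<delta> *\<^sub>R v2) \<bullet> (0, b)" by simp
  then have "sqrt 3 = - (\<delta> * sqrt 3)" using bb by (simp add: v1_def v2_def)
  moreover have "0 < \<delta> * sqrt 3" using \<delta>(1) by simp
  ultimately show False using real_sqrt_gt_zero[of 3] by linarith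
qed

lemma quadratic_form: "(\<Sum>v\<in>{v1, \<delta> *\<^sub>R v2}. (z \<bullet> v)\<^sup>2) = (1 * (z \<bullet> v1))\<^sup>2 + (\<delta> * (z \<bullet> v2))\<^sup>2"
  using v_distinct by (simp add: power_mult_distrib)

lemma u_eq: "u z = of_real (exp (- (1 * (z \<bullet> v1))\<^sup>2 / 2)) * (cis (L * (z \<bullet> v2)) * of_real (exp (- (\<delta> * (z \<bullet> v2))\<^sup>2 / 2)))"
proof -
  have "exp (- (A + B) / 2) = exp (- A / 2) * exp (- B / 2)" for A B :: real
    by (simp add: add_divide_distrib flip: exp_add)
  then show ?thesis
    unfolding u_def gauss_eq quadratic_form by (simp only: of_real_mult inner_scaleR_right mult_ac)
qed

lemma schwartz_u: "schwartz u"
  unfolding u_def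
proof (rule schwartz_gauss)
  show "2 * \<delta>\<^sup>2 > 0" using \<delta>(1) by simp
  fix z :: "real \<times> 'y"
  let ?v = "snd z \<bullet> b"
  have "snd z = ?v *\<^sub>R b" using euclidean_representation[of "snd z"] by (simp add: b)
  then have "norm (snd z) = \<bar>?v\<bar>"
    using bb by (metis norm_scaleR norm_eq_1 mult.right_neutral)
  then have n: "(norm z)\<^sup>2 = (fst z)\<^sup>2 + ?v\<^sup>2" by (simp add: norm_prod_def)
  have "(z \<bullet> v1)\<^sup>2 + (z \<bullet> v2)\<^sup>2 = 2 * (fst z)\<^sup>2 + 6 * ?v\<^sup>2"
    unfolding v_inner by (simp add: power2_eq_square algebra_simps)
  then have "2 * (norm z)\<^sup>2 \<le> (z \<bullet> v1)\<^sup>2 + (z \<bullet> v2)\<^sup>2" unfolding n by simp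
  then have "2 * \<delta>\<^sup>2 * (norm z)\<^sup>2 \<le> \<delta>\<^sup>2 * ((z \<bullet> v1)\<^sup>2 + (z \<bullet> v2)\<^sup>2)"
    using mult_left_mono[of "2 * (norm z)\<^sup>2" "(z \<bullet> v1)\<^sup>2 + (z \<bullet> v2)\<^sup>2" "\<delta>\<^sup>2"] by (simp add: mult.left_commute)
  also have "\<dots> \<le> (1 * (z \<bullet> v1))\<^sup>2 + (\<delta> * (z \<bullet> v2))\<^sup>2"
  proof -
    have "\<delta>\<^sup>2 \<le> 1" using \<delta> by (simp add: power_le_one)
    then have "\<delta>\<^sup>2 * (z \<bullet> v1)\<^sup>2 \<le> 1 * (z \<bullet> v1)\<^sup>2" by (intro mult_right_mono) auto
    then show ?thesis by (simp add: distrib_left power_mult_distrib)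
  qed
  finally show "2 * \<delta>\<^sup>2 * (norm z)\<^sup>2 \<le> (\<Sum>v\<in>{v1, \<delta> *\<^sub>R v2}. (z \<bullet> v)\<^sup>2)"
    unfolding quadratic_form .
qed simp

definition f :: "real \<Rightarrow> complex" where "f p = of_real (exp (- (1 * p)\<^sup>2 / 2))"
definition g :: "real \<Rightarrow> complex" where "g q = of_real (exp (- ((q - L) / \<delta>)\<^sup>2 / 2))"

lemma fourier_u: "fourier u \<zeta> = of_real (1 / (2 * sqrt 3 * \<delta>)) * (f (chr1 b \<zeta>) * g (chr2 b \<zeta>))"
proof -
  let ?p = "chr1 b \<zeta>" and ?q = "chr2 b \<zeta>"
  \<comment> \<open>The inverse of \<open>z \<mapsto> (z \<bullet> v1, z \<bullet> v2)\<close>; in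
    these coordinates the integral splits into two Gaussian ones.\<close>
  let ?L = "\<lambda>z. ((1/2) * (fst z + snd z), ((1 / (2 * sqrt 3)) * (fst z - snd z)) *\<^sub>R b)"
  have L1: "?L z \<bullet> v1 = fst z" and L2: "?L z \<bullet> v2 = snd z" for z
    unfolding v_inner using bb by (simp_all add: field_simps)
  have "fst \<zeta> = ?p + ?q" "snd \<zeta> \<bullet> b = sqrt 3 * (?p - ?q)"
    by (simp_all add: chr1_def chr2_def field_simps)
  then have zz: "z \<bullet> \<zeta> = ?p * (z \<bullet> v1) + ?q * (z \<bullet> v2)" for z
  proof -
    have "snd \<zeta> = (snd \<zeta> \<bullet> b) *\<^sub>R b" using euclidean_representation[of "snd \<zeta>"] by (simp add: b)
    then have "snd z \<bullet> snd \<zeta> = (snd \<zeta> \<bullet> b) * (snd z \<bullet> b)" by (metis inner_scaleR_right)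
    then have "z \<bullet> \<zeta> = fst z * (?p + ?q) + sqrt 3 * (?p - ?q) * (snd z \<bullet> b)"
      using \<open>fst \<zeta> = _\<close> \<open>snd \<zeta> \<bullet> b = _\<close> by (simp add: inner_prod_def)
    then show ?thesis unfolding v_inner by (simp add: algebra_simps)
  qed
  let ?F = "\<lambda>A. cis (- ?p * A) * complex_of_real (exp (- (1 * A)\<^sup>2 / 2))"
  let ?G = "\<lambda>B. cis ((L - ?q) * B) * complex_of_real (exp (- (\<delta> * B)\<^sup>2 / 2))"
  have um: "u \<in> borel_measurable borel" by (rule schwartz_borel_measurable[OF schwartz_u])
  have int: "integrable lborel ?F" "integrable lborel ?G"
    using gaussian_integral(1)[of 1] gaussian_integral(1)[OF \<delta>(1)]
    by (auto intro!: integrable_cis_mult)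
  have FG: "cis (- (?L z \<bullet> \<zeta>)) * u (?L z) = ?F (fst z) * ?G (snd z)" for z
  proof -
    have "cis (- (?p * fst z + ?q * snd z)) * cis (L * snd z) = cis (- ?p * fst z) * cis ((L - ?q) * snd z)"
      by (simp add: cis_mult algebra_simps)
    moreover have "x * (e1 * (y * e2)) = (c * e1) * (d * e2)" if "x * y = c * d" for x y c d e1 e2 :: complex
      using that by algebra
    ultimately show ?thesis unfolding zz u_eq L1 L2 by blast
  qed
  have m: "(\<lambda>z. cis (- (z \<bullet> \<zeta>)) * u z) \<in> borel_measurable borel" using um by measurable
  have "(LINT z|lborel. cis (- (z \<bullet> \<zeta>)) * u z) =
      of_real (2 * (1/2) * (1 / (2 * sqrt 3))) * (LINT z|lborel. cis (- (?L z \<bullet> \<zeta>)) * u (?L z))"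
    by (rule integral_sheared_plane(1)[OF b _ _ m]) auto
  also have "\<dots> = of_real (1 / (2 * sqrt 3)) * ((LINT A|lborel. ?F A) * (LINT B|lborel. ?G B))"
    unfolding FG integral_prod_real2(1)[OF int] by simp
  also have "(LINT A|lborel. ?F A) = of_real (sqrt (2 * pi) / 1 * exp (- (- ?p / 1)\<^sup>2 / 2))"
    by (rule gaussian_integral(2)) simp
  also have "(LINT B|lborel. ?G B) = of_real (sqrt (2 * pi) / \<delta> * exp (- ((L - ?q) / \<delta>)\<^sup>2 / 2))"
    by (rule gaussian_integral(2)[OF \<delta>(1)])
  finally have I0: "(LINT z|lborel. cis (- (z \<bullet> \<zeta>)) * u z) = of_real (1 / (2 * sqrt 3)) *
      (of_real (sqrt (2 * pi) / 1 * exp (- (- ?p / 1)\<^sup>2 / 2)) *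
       of_real (sqrt (2 * pi) / \<delta> * exp (- ((L - ?q) / \<delta>)\<^sup>2 / 2)))" .
  have I: "(LINT z|lborel. cis (- (z \<bullet> \<zeta>)) * u z) = of_real ((2 * pi) * (1 / (2 * sqrt 3 * \<delta>) *
      (exp (- (1 * ?p)\<^sup>2 / 2) * exp (- ((?q - L) / \<delta>)\<^sup>2 / 2))))"
  proof -
    have e: "((L - ?q) / \<delta>)\<^sup>2 = ((?q - L) / \<delta>)\<^sup>2" "(- ?p / 1)\<^sup>2 = (1 * ?p)\<^sup>2"
      by (simp_all add: power2_commute power_divide)
    have "1 / (2 * R) * ((S / 1 * x) * (S / \<delta> * y)) = (S * S) * (1 / (2 * R * \<delta>) * (x * y))" for R S x y :: real
      by simp
    moreover have "sqrt (2 * pi) * sqrt (2 * pi) = 2 * pi" by simp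
    ultimately show ?thesis unfolding I0 e of_real_mult[symmetric] by (simp only:)
  qed
  have "real DIM(real \<times> 'y) = 2" by (simp add: b)
  then have "(2 * pi) powr (- real DIM(real \<times> 'y) / 2) * (2 * pi) = 1"
    by (simp only:) (simp add: powr_minus_divide)
  then show ?thesis unfolding fourier_def I f_def g_def
    by (simp only: of_real_mult[symmetric] mult.assoc[symmetric] mult_1_left)
qed

lemma f_g_integrable: "integrable lborel f" "integrable lborel g"
proof -
  show "integrable lborel f"
    unfolding f_def using gaussian_integral(1)[of 1] by (intro integrable_of_real) simp
  have "integrable lborel (\<lambda>q. exp (- (1 / \<delta> * q)\<^sup>2 / 2))"
    by (rule gaussian_integral) (use \<delta>(1) in simp)
  then have "integrable lborel (\<lambda>q. exp (- (1 / \<delta> * (- L + 1 * q))\<^sup>2 / 2))"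
    by (rule lborel_integrable_real_affine) simp
  then have "integrable lborel (\<lambda>q. complex_of_real (exp (- (1 / \<delta> * (- L + 1 * q))\<^sup>2 / 2)))"
    by (rule integrable_of_real)
  then show "integrable lborel g" unfolding g_def by simp
qed

text \<open>The choice \<open>y = - x / sqrt 3\<close> makes the position 0 in the first factor and
  \<open>2x\<close> in the second. The second phase \<open>2xv + 4tv^3\<close> is stationary at the
  packet frequency \<open>v = L\<close> when \<open>x = -6tL^2\<close>. Expanding there with
  \<open>v = L + \<delta> r\<close> leaves the quadratic coefficient
  \<open>12t L \<delta>^2 = 12t\<close> and the cubic one \<open>4t \<delta>^3\<close>, both at most
  \<open>\<rho>\<close>.\<close>

lemma propagator_u_focus:
  assumes \<rho>: "\<rho> > 0" "\<And>a c. \<bar>a\<bar> \<le> \<rho> \<Longrightarrow> \<bar>c\<bar> \<le> \<rho> \<Longrightarrow> 1 \<le> norm (fresnel a c)"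
    and t: "0 \<le> t" "12 * t \<le> \<rho>" and x: "x = - 6 * t * L\<^sup>2"
  shows "1 / (2 * pi) \<le> norm (propagator t u (x, (- x / sqrt 3) *\<^sub>R b))"
proof -
  let ?y = "(- x / sqrt 3) *\<^sub>R b"
  have X: "x + sqrt 3 * (?y \<bullet> b) = 0" and Y: "x - sqrt 3 * (?y \<bullet> b) = 2 * x"
    using bb by simp_all
  have A: "(LINT v|lborel. cis (0 * v + 4 * t * v ^ 3) * f v) = fresnel 0 (4 * t)"
    by (simp add: f_def fresnel_def)
  have B: "norm (LINT v|lborel. cis (2 * x * v + 4 * t * v ^ 3) * g v) = \<delta> * norm (fresnel (12 * t) (4 * t * \<delta> ^ 3))"
  proof -
    have ph: "2 * x * (L + \<delta> * r) + 4 * t * (L + \<delta> * r) ^ 3 =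
      (2 * x * L + 4 * t * L ^ 3) + (12 * t * r\<^sup>2 + 4 * t * \<delta> ^ 3 * r ^ 3)" for r
    proof -
      have "12 * t * r\<^sup>2 = 12 * t * (L * \<delta>\<^sup>2) * r\<^sup>2" using \<delta>(3) by simp
      then show ?thesis unfolding x by (simp add: power2_eq_square power3_eq_cube algebra_simps)
    qed
    have "(LINT v|lborel. cis (2 * x * v + 4 * t * v ^ 3) * g v) = \<bar>\<delta>\<bar> *\<^sub>R
       (LINT r|lborel. cis (2 * x * (L + \<delta> * r) + 4 * t * (L + \<delta> * r) ^ 3) * g (L + \<delta> * r))"
      using \<delta>(1) by (intro lborel_integral_real_affine) simp
    also have "\<dots> = \<bar>\<delta>\<bar> *\<^sub>R (LINT r|lborel. cis (2 * x * L + 4 * t * L ^ 3) *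
        (cis (12 * t * r\<^sup>2 + 4 * t * \<delta> ^ 3 * r ^ 3) * of_real (exp (- (1 * r)\<^sup>2 / 2))))"
    proof -
      have "g (L + \<delta> * r) = of_real (exp (- (1 * r)\<^sup>2 / 2))" for r using \<delta>(1) by (simp add: g_def)
      then show ?thesis unfolding ph by (simp only: cis_mult[symmetric] mult.assoc)
    qed
    also have "\<dots> = \<bar>\<delta>\<bar> *\<^sub>R (cis (2 * x * L + 4 * t * L ^ 3) * fresnel (12 * t) (4 * t * \<delta> ^ 3))"
      unfolding fresnel_def integral_mult_right_zero ..
    finally show ?thesis using \<delta>(1) by (simp add: norm_mult)
  qed
  have "4 * t * \<delta> ^ 3 \<le> 4 * t * 1" using \<delta> t by (intro mult_left_mono power_le_one) auto
  then have one: "1 \<le> norm (fresnel 0 (4 * t))" "1 \<le> norm (fresnel (12 * t) (4 * t * \<delta> ^ 3))"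
    using t \<rho>(1) \<delta>(1) by (auto intro!: \<rho>(2) simp: abs_mult)
  have "evol (fourier u) x (?y, t) = of_real (1 / (2 * sqrt 3 * \<delta>)) * evol (\<lambda>\<zeta>. f (chr1 b \<zeta>) * g (chr2 b \<zeta>)) x (?y, t)"
    unfolding evol_def fourier_u by (simp add: mult.left_commute)
  also have "evol (\<lambda>\<zeta>. f (chr1 b \<zeta>) * g (chr2 b \<zeta>)) x (?y, t) = of_real (2 * sqrt 3) *
      (fresnel 0 (4 * t) * (LINT v|lborel. cis (2 * x * v + 4 * t * v ^ 3) * g v))"
    unfolding evol_characteristic(1)[OF b f_g_integrable] X Y A ..
  finally have "norm (evol (fourier u) x (?y, t)) =
      1 / (2 * sqrt 3 * \<delta>) * ((2 * sqrt 3) * (norm (fresnel 0 (4 * t)) * (\<delta> * norm (fresnel (12 * t) (4 * t * \<delta> ^ 3)))))"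
    using B \<delta>(1) by (simp add: norm_mult norm_divide)
  also have "\<dots> = norm (fresnel 0 (4 * t)) * norm (fresnel (12 * t) (4 * t * \<delta> ^ 3))"
    using \<delta>(1) by simp
  finally have ev: "1 \<le> norm (evol (fourier u) x (?y, t))"
    using mult_mono[OF one] by simp
  have "real DIM(real \<times> 'y) = 2" by (simp add: b)
  then have "(2 * pi) powr (- real DIM(real \<times> 'y) / 2) = 1 / (2 * pi)"
    by (simp only:) (simp add: powr_minus_divide)
  then have "norm (propagator t u (x, ?y)) = 1 / (2 * pi) * norm (evol (fourier u) x (?y, t))"
    unfolding propagator_eq_evol by (simp only: norm_mult norm_of_real) simp
  then show ?thesis using ev mult_left_mono[OF ev, of "1 / (2 * pi)"] by simp
qed

text \<open>As \<open>t\<close> runs through \<open>[0, \<rho>/12]\<close>, the focus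
  \<open>x = -6tL^2\<close> sweeps an interval of length \<open>\<rho> L^2 / 2\<close>; the square
  root of this length gives the power \<open>L\<close>.\<close>

lemma mixed_norm_u:
  assumes \<rho>: "0 < \<rho>" "\<rho> \<le> 1" "\<And>a c. \<bar>a\<bar> \<le> \<rho> \<Longrightarrow> \<bar>c\<bar> \<le> \<rho> \<Longrightarrow> 1 \<le> norm (fresnel a c)"
  shows "ennreal (1 / (2 * pi) * (\<rho> / 2) powr (1/2) * L powr 1) \<le> mixed_norm 2 (\<lambda>x y t. propagator t u (x, y))"
proof -
  have "ennreal (1 / (2 * pi) * (0 - (- (\<rho> / 2 * L\<^sup>2))) powr (1/2)) \<le> mixed_norm 2 (\<lambda>x y t. propagator t u (x, y))"
  proof (rule mixed_norm_lower)
    fix x assume x: "x \<in> {- (\<rho> / 2 * L\<^sup>2)..0}"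
    define t where "t = - x / (6 * L\<^sup>2)"
    have L2: "L\<^sup>2 > 0" using L by simp
    have t: "0 \<le> t" "12 * t \<le> \<rho>" "x = - 6 * t * L\<^sup>2"
      using x L2 by (auto simp: t_def field_simps divide_nonpos_pos)
    from propagator_u_focus[OF \<rho>(1,3) t]
    show "\<exists>y. \<exists>t\<in>{0..1}. 1 / (2 * pi) \<le> norm (propagator t u (x, y))"
      using t \<rho>(2) by (intro exI bexI[of _ t]) auto
  qed (use \<rho> in auto)
  also have "(0 - (- (\<rho> / 2 * L\<^sup>2))) powr (1/2) = (\<rho> / 2) powr (1/2) * L powr 1"
  proof -
    have "(L\<^sup>2) powr (1/2) = L powr 1" using L by (simp add: powr_half_sqrt)
    then have "(\<rho> / 2 * L\<^sup>2) powr (1/2) = (\<rho> / 2) powr (1/2) * L powr 1"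
      using \<rho>(1) by (simp only: powr_mult)
    then show ?thesis by simp
  qed
  finally show ?thesis by (simp only: mult.assoc)
qed

text \<open>The base of the power is \<open>1 + |\<zeta>|^2\<close> at
  \<open>q = L + \<delta> r\<close>. It is at most \<open>13 L^2\<close> times a polynomial factor
  that the Gaussians absorb; \<open>s \<le> 1\<close> keeps the \<open>s\<close>-th powers of 13 and
  of that factor below the first powers.\<close>

lemma weight_bound:
  assumes s: "0 \<le> s" "s \<le> 1"
  shows "(1 + (4 * p\<^sup>2 + 4 * (L + \<delta> * r)\<^sup>2 - 4 * p * (L + \<delta> * r))) powr s \<le> 13 * L powr (2 * s) * ((1 + p\<^sup>2) * (1 + r\<^sup>2))"
proof -
  let ?q = "L + \<delta> * r"
  have "0 \<le> (p + ?q)\<^sup>2" by simp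
  then have 1: "4 * p\<^sup>2 + 4 * ?q\<^sup>2 - 4 * p * ?q \<le> 6 * p\<^sup>2 + 6 * ?q\<^sup>2" by (simp add: power2_eq_square algebra_simps)
  have "0 \<le> (L - \<delta> * r)\<^sup>2" by simp
  then have "?q\<^sup>2 \<le> 2 * L\<^sup>2 + 2 * (\<delta> * r)\<^sup>2" by (simp add: power2_eq_square algebra_simps)
  moreover have "(\<delta> * r)\<^sup>2 \<le> 1 * r\<^sup>2"
    unfolding power_mult_distrib using \<delta> by (intro mult_right_mono power_le_one) auto
  ultimately have "1 + (4 * p\<^sup>2 + 4 * ?q\<^sup>2 - 4 * p * ?q) \<le> 1 + 12 * L\<^sup>2 + 6 * p\<^sup>2 + 12 * r\<^sup>2" using 1 by linarith
  also have "\<dots> \<le> 13 * L\<^sup>2 * ((1 + p\<^sup>2) * (1 + r\<^sup>2))"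
  proof -
    have "1 \<le> L\<^sup>2" using L by simp
    then have "p\<^sup>2 \<le> L\<^sup>2 * p\<^sup>2" "r\<^sup>2 \<le> L\<^sup>2 * r\<^sup>2" "0 \<le> L\<^sup>2 * (p\<^sup>2 * r\<^sup>2)"
      using mult_right_mono[of 1 "L\<^sup>2"] by auto
    moreover have "13 * L\<^sup>2 * ((1 + p\<^sup>2) * (1 + r\<^sup>2)) = 13 * L\<^sup>2 + 13 * (L\<^sup>2 * p\<^sup>2) + 13 * (L\<^sup>2 * r\<^sup>2) + 13 * (L\<^sup>2 * (p\<^sup>2 * r\<^sup>2))"
      by (simp add: algebra_simps)
    ultimately show ?thesis using \<open>1 \<le> L\<^sup>2\<close> zero_le_power2[of p] zero_le_power2[of r] by linarith
  qed
  finally have le: "1 + (4 * p\<^sup>2 + 4 * ?q\<^sup>2 - 4 * p * ?q) \<le> 13 * L\<^sup>2 * ((1 + p\<^sup>2) * (1 + r\<^sup>2))" .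
  have nn: "0 \<le> 1 + (4 * p\<^sup>2 + 4 * ?q\<^sup>2 - 4 * p * ?q)"
  proof -
    have "0 \<le> (p - 2 * ?q)\<^sup>2 + 3 * p\<^sup>2" by simp
    also have "\<dots> = 4 * p\<^sup>2 + 4 * ?q\<^sup>2 - 4 * p * ?q" by (simp add: power2_eq_square algebra_simps)
    finally show ?thesis by linarith
  qed
  have ge1: "1 \<le> (1 + p\<^sup>2) * (1 + r\<^sup>2)" using mult_mono[of 1 "1 + p\<^sup>2" 1 "1 + r\<^sup>2"] by simp
  have "(1 + (4 * p\<^sup>2 + 4 * ?q\<^sup>2 - 4 * p * ?q)) powr s \<le> (13 * L\<^sup>2 * ((1 + p\<^sup>2) * (1 + r\<^sup>2))) powr s"
    using s le nn by (intro powr_mono2) auto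
  also have "\<dots> = 13 powr s * L powr (2 * s) * ((1 + p\<^sup>2) * (1 + r\<^sup>2)) powr s"
  proof -
    have "(L\<^sup>2) powr s = L powr (2 * s)" using L powr_powr[of L 2 s] by (simp add: powr_numeral)
    then show ?thesis using L by (simp only: powr_mult)
  qed
  also have "\<dots> \<le> 13 powr 1 * L powr (2 * s) * ((1 + p\<^sup>2) * (1 + r\<^sup>2)) powr 1"
    using s ge1 L by (intro mult_mono powr_mono) auto
  also have "\<dots> = 13 * L powr (2 * s) * ((1 + p\<^sup>2) * (1 + r\<^sup>2))" using ge1 by simp
  finally show ?thesis .
qed

text \<open>\<open>fourier u\<close> has size about \<open>1/\<delta>\<close> on a region of area
  about \<open>\<delta>\<close> at frequencies of size \<open>L\<close>, so the squared norm is of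
  order \<open>L^(2s) / \<delta> = L^(2s + 1/2)\<close>.\<close>

lemma sobolev_norm_u:
  assumes s: "0 \<le> s" "s \<le> 1"
  shows "sobolev_norm s u \<le> ennreal (sqrt (52 * pi) * L powr (s + 1/4))"
proof -
  let ?G = "\<lambda>r::real. ennreal (exp (- (1 * r)\<^sup>2 / 2))"
  have G: "(\<integral>\<^sup>+r. ?G r \<partial>lborel) = ennreal (sqrt (2 * pi))"
  proof -
    have "complex_of_real (LINT r|lborel. exp (- (1 * r)\<^sup>2 / 2)) = of_real (sqrt (2 * pi))"
      using gaussian_integral(2)[of 1 0] by simp
    then have "(LINT r|lborel. exp (- (1 * r)\<^sup>2 / 2)) = sqrt (2 * pi)" by (simp only: of_real_eq_iff)
    moreover have "(\<integral>\<^sup>+r. ?G r \<partial>lborel) = ennreal (LINT r|lborel. exp (- (1 * r)\<^sup>2 / 2))"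
      by (rule nn_integral_eq_integral[OF gaussian_integral(1)]) auto
    ultimately show ?thesis by simp
  qed
  let ?w = "\<lambda>\<zeta> :: real \<times> 'y. ennreal ((1 + (norm \<zeta>)\<^sup>2) powr s * (norm (fourier u \<zeta>))\<^sup>2)"
  let ?L = "\<lambda>z. (1 * (fst z + snd z), (sqrt 3 * (fst z - snd z)) *\<^sub>R b)"
  define K where "K = 1 / (12 * \<delta>\<^sup>2) * (13 * L powr (2 * s)) * 4"
  have K0: "K \<ge> 0" by (simp add: K_def)
  have fm[measurable]: "fourier u \<in> borel_measurable borel"
    by (intro borel_measurable_fourier schwartz_borel_measurable schwartz_u)
  have wm: "?w \<in> borel_measurable borel" by measurable
  have pt: "?w (?L (p, L + \<delta> * r)) \<le> ennreal K * (?G p * ?G r)" for p r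
  proof -
    have n: "(norm (?L (p, L + \<delta> * r)))\<^sup>2 = 4 * p\<^sup>2 + 4 * (L + \<delta> * r)\<^sup>2 - 4 * p * (L + \<delta> * r)"
      unfolding norm_square_chr[OF b] fst_conv snd_conv chr_param[OF b] ..
    have fr: "(norm (fourier u (?L (p, L + \<delta> * r))))\<^sup>2 = 1 / (12 * \<delta>\<^sup>2) * (exp (- p\<^sup>2) * exp (- r\<^sup>2))"
    proof -
      have "(exp (- (1 * z)\<^sup>2 / 2))\<^sup>2 = exp (- z\<^sup>2)" for z :: real by (simp flip: exp_double)
      moreover have "(L + \<delta> * r - L) / \<delta> = 1 * r" using \<delta>(1) by simp
      ultimately show ?thesis
        unfolding fourier_u fst_conv snd_conv chr_param[OF b] f_def g_def norm_mult norm_of_real power_mult_distrib power2_abs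
        by (simp add: power_divide power_mult_distrib)
    qed
    have "(1 + (norm (?L (p, L + \<delta> * r)))\<^sup>2) powr s * (norm (fourier u (?L (p, L + \<delta> * r))))\<^sup>2 \<le>
      13 * L powr (2 * s) * ((1 + p\<^sup>2) * (1 + r\<^sup>2)) * (1 / (12 * \<delta>\<^sup>2) * (exp (- p\<^sup>2) * exp (- r\<^sup>2)))"
      unfolding n fr by (intro mult_right_mono weight_bound s) auto
    also have "\<dots> = 1 / (12 * \<delta>\<^sup>2) * (13 * L powr (2 * s)) * (((1 + p\<^sup>2) * exp (- p\<^sup>2)) * ((1 + r\<^sup>2) * exp (- r\<^sup>2)))"
      by (simp only: mult_ac)
    also have "\<dots> \<le> 1 / (12 * \<delta>\<^sup>2) * (13 * L powr (2 * s)) * ((2 * exp (- (1 * p)\<^sup>2 / 2)) * (2 * exp (- (1 * r)\<^sup>2 / 2)))"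
      by (intro mult_left_mono mult_mono one_plus_square_le) auto
    also have "\<dots> = K * (exp (- (1 * p)\<^sup>2 / 2) * exp (- (1 * r)\<^sup>2 / 2))" by (simp add: K_def)
    finally show ?thesis using K0 by (simp add: ennreal_leI flip: ennreal_mult)
  qed
  have Lm: "(\<lambda>z. ?w (?L z)) \<in> borel_measurable borel"
    by (rule measurable_compose[OF _ wm]) (intro borel_measurable_continuous_onI continuous_intros)
  then have Lm2: "(\<lambda>q. ?w (?L (p, q))) \<in> borel_measurable borel" for p
    by (rule measurable_compose[rotated]) simp
  have shear: "(\<integral>\<^sup>+\<zeta>. ?w \<zeta> \<partial>lborel) = ennreal (2 * 1 * sqrt 3) * (\<integral>\<^sup>+z. ?w (?L z) \<partial>lborel)"
    by (rule nn_integral_sheared_plane[OF b _ _ wm]) auto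
  have "(\<integral>\<^sup>+z. ?w (?L z) \<partial>lborel) = (\<integral>\<^sup>+p. \<integral>\<^sup>+q. ?w (?L (p, q)) \<partial>lborel \<partial>lborel)"
    using lborel.nn_integral_fst[of "\<lambda>z. ?w (?L z)" lborel] Lm by (simp add: lborel_prod)
  also have "\<dots> = (\<integral>\<^sup>+p. ennreal \<delta> * (\<integral>\<^sup>+r. ?w (?L (p, L + \<delta> * r)) \<partial>lborel) \<partial>lborel)"
  proof (intro nn_integral_cong)
    fix p
    show "(\<integral>\<^sup>+q. ?w (?L (p, q)) \<partial>lborel) = ennreal \<delta> * (\<integral>\<^sup>+r. ?w (?L (p, L + \<delta> * r)) \<partial>lborel)"
      using nn_integral_real_affine[OF Lm2, of \<delta> p L] \<delta>(1) by simp
  qed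
  also have "\<dots> \<le> (\<integral>\<^sup>+p. ennreal \<delta> * (\<integral>\<^sup>+r. ennreal K * (?G p * ?G r) \<partial>lborel) \<partial>lborel)"
    by (intro nn_integral_mono mult_left_mono pt) simp
  also have "\<dots> = ennreal \<delta> * (ennreal K * (ennreal (sqrt (2 * pi)) * ennreal (sqrt (2 * pi))))"
  proof -
    have Gm: "?G \<in> borel_measurable lborel" by simp
    show ?thesis unfolding nn_integral_cmult_cmult[OF Gm] G nn_integral_cmult_cmult_multc[OF Gm] ..
  qed
  finally have "(\<integral>\<^sup>+z. ?w (?L z) \<partial>lborel) \<le> ennreal (\<delta> * (K * (2 * pi)))"
    using \<delta>(1) K0 by (simp flip: ennreal_mult)
  then have "(\<integral>\<^sup>+\<zeta>. ?w \<zeta> \<partial>lborel) \<le> ennreal (2 * 1 * sqrt 3) * ennreal (\<delta> * (K * (2 * pi)))"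
    unfolding shear by (rule mult_left_mono) simp
  also have "\<dots> = ennreal (2 * sqrt 3 * (\<delta> * (K * (2 * pi))))"
    using \<delta>(1) K0 by (simp flip: ennreal_mult)
  also have "\<dots> \<le> ennreal (52 * pi * L powr (2 * (s + 1/4)))"
  proof (rule ennreal_leI)
    have "sqrt 3 \<le> 3" by (rule real_le_lsqrt) auto
    have "2 * (s + 1/4) = 2 * s + 1/2" by simp
    then have e: "L powr (2 * (s + 1/4)) = L powr (2 * s) * (1 / \<delta>)" by (simp only: powr_add \<delta>(4))
    have "2 * sqrt 3 * (\<delta> * (K * (2 * pi))) = sqrt 3 / 3 * (52 * pi * (L powr (2 * s) * (1 / \<delta>)))"
      using \<delta>(1) by (simp add: K_def power2_eq_square)
    also have "\<dots> \<le> 1 * (52 * pi * (L powr (2 * s) * (1 / \<delta>)))"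
      using \<open>sqrt 3 \<le> 3\<close> \<delta>(1) by (intro mult_right_mono) auto
    finally show "2 * sqrt 3 * (\<delta> * (K * (2 * pi))) \<le> 52 * pi * L powr (2 * (s + 1/4))"
      unfolding e by simp
  qed
  finally have "sobolev_norm s u \<le> ennreal ((52 * pi * L powr (2 * (s + 1/4))) powr (1/2))"
    by (intro sobolev_norm_upper) auto
  also have "(52 * pi * L powr (2 * e)) powr (1/2) = sqrt (52 * pi) * L powr e" for e
    using L by (simp add: powr_mult powr_powr powr_half_sqrt real_sqrt_mult)
  finally show ?thesis .
qed

end

text \<open>The mixed norm grows at least like \<open>L\<close>, the Sobolev norm at most like
  \<open>L^(s + 1/4)\<close>.\<close>

theorem wave_packet_lower_bound:
  assumes dim: "DIM('y::euclidean_space) = 1" and me: "maximal_estimate TYPE('y) 2 s" and s: "0 \<le> s" "s \<le> 1"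
  shows "3/4 \<le> s"
proof -
  obtain b :: 'y where b: "Basis = {b}" using dim card_1_singletonE by blast
  obtain \<rho>0 where \<rho>0: "\<rho>0 > 0" "\<And>a c. \<bar>a\<bar> \<le> \<rho>0 \<Longrightarrow> \<bar>c\<bar> \<le> \<rho>0 \<Longrightarrow> 1 \<le> norm (fresnel a c)"
    using fresnel_lower by blast
  define \<rho> where "\<rho> = min 1 \<rho>0"
  have \<rho>: "0 < \<rho>" "\<rho> \<le> 1" "\<And>a c. \<bar>a\<bar> \<le> \<rho> \<Longrightarrow> \<bar>c\<bar> \<le> \<rho> \<Longrightarrow> 1 \<le> norm (fresnel a c)"
    using \<rho>0 by (auto simp: \<rho>_def)
  have "1 \<le> s + 1/4"
  proof (rule maximal_estimate_compare[OF me])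
    show "1 / (2 * pi) * (\<rho> / 2) powr (1/2) > 0" using \<rho>(1) by simp
    show "sqrt (52 * pi) \<ge> 0" by simp
    fix L :: real assume "L \<ge> 1"
    then interpret packet b L by unfold_locales (use b in auto)
    show "\<exists>u :: real \<times> 'y \<Rightarrow> complex. schwartz u \<and>
      ennreal (1 / (2 * pi) * (\<rho> / 2) powr (1/2) * L powr 1) \<le> mixed_norm 2 (\<lambda>x y t. propagator t u (x, y)) \<and>
      sobolev_norm s u \<le> ennreal (sqrt (52 * pi) * L powr (s + 1/4))"
      using schwartz_u mixed_norm_u[OF \<rho>] sobolev_norm_u[OF s] by blast
  qed
  then show ?thesis by simp
qed

lemma positive_between:
  fixes s e :: real
  assumes "s < e" "0 < e"
  obtains s' where "s \<le> s'" "0 < s'" "s' < e"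
  using assms dense[of "max s 0" e] by (auto intro: less_imp_le)

text \<open>As \<open>1/p \<le> 1/2\<close> and \<open>d \<ge> 2\<close>, the threshold is positive.
  So even for negative \<open>s\<close> there is a positive \<open>s' \<ge> s\<close> strictly below
  it, to which \<open>concentration_lower_bound\<close> applies.\<close>

lemma not_maximal_estimate_below_concentration:
  assumes p: "2 \<le> p" and s: "s < real DIM(real \<times> 'y::euclidean_space) / 2 - 1/p"
  shows "\<not> maximal_estimate TYPE('y) p s"
proof
  assume me: "maximal_estimate TYPE('y) p s"
  have "1/p \<le> 1/2" using p by (simp add: field_simps)
  moreover have "0 < real DIM('y)" by (simp only: of_nat_0_less_iff DIM_positive)
  moreover have "real DIM(real \<times> 'y) = 1 + real DIM('y)" by simp
  ultimately have "0 < real DIM(real \<times> 'y) / 2 - 1/p" by linarith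
  then obtain s' where s': "s \<le> s'" "0 < s'" "s' < real DIM(real \<times> 'y) / 2 - 1/p"
    using positive_between[OF s] by blast
  show False
    using concentration_lower_bound[OF maximal_estimate_mono[OF s'(1) me] p s'(2)] s'(3) by simp
qed

lemma not_maximal_estimate_below_packet:
  assumes dim: "DIM('y::euclidean_space) = 1" and s: "s < 3/4"
  shows "\<not> maximal_estimate TYPE('y) 2 s"
proof
  assume me: "maximal_estimate TYPE('y) 2 s"
  obtain s' where s': "s \<le> s'" "0 < s'" "s' < 3/4" using positive_between[OF s] by auto
  show False
    using wave_packet_lower_bound[OF dim maximal_estimate_mono[OF s'(1) me]] s' by simp
qed

theorem theorem1p2:
  shows
    "((\<forall>p s :: real. p \<ge> 2 \<and> s > 3/2 - 1/p \<longrightarrow> maximal_estimate TYPE(real ^ 2) p s) \<and>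
      (\<forall>p s :: real. p \<ge> 2 \<and> s < 3/2 - 1/p \<longrightarrow> \<not> maximal_estimate TYPE(real ^ 2) p s)) \<and>
     ((\<forall>p s :: real. (p \<ge> 4 \<and> s > 1 - 1/p) \<or> (2 \<le> p \<and> p < 4 \<and> s > 3/4)
          \<longrightarrow> maximal_estimate TYPE(real ^ 1) p s) \<and>
      (\<forall>p s :: real. p \<ge> 4 \<and> s < 1 - 1/p \<longrightarrow> \<not> maximal_estimate TYPE(real ^ 1) p s) \<and>
      (\<forall>s :: real. s < 3/4 \<longrightarrow> \<not> maximal_estimate TYPE(real ^ 1) 2 s))"
proof -
  have D1: "DIM(real ^ 1) = 1" and D2: "DIM(real ^ 2) = 2" by simp_all
  show ?thesis
  proof (intro conjI allI impI)
    fix p s :: real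
    assume "p \<ge> 2 \<and> s > 3/2 - 1/p"
    then show "maximal_estimate TYPE(real ^ 2) p s" using maximal_estimate_dim3[OF D2] by blast
  next
    fix p s :: real
    assume "p \<ge> 2 \<and> s < 3/2 - 1/p"
    then show "\<not> maximal_estimate TYPE(real ^ 2) p s"
      by (intro not_maximal_estimate_below_concentration) simp_all
  next
    fix p s :: real
    assume "(p \<ge> 4 \<and> s > 1 - 1/p) \<or> (2 \<le> p \<and> p < 4 \<and> s > 3/4)"
    then show "maximal_estimate TYPE(real ^ 1) p s" by (rule maximal_estimate_dim2[OF D1])
  next
    fix p s :: real
    assume "p \<ge> 4 \<and> s < 1 - 1/p"
    then show "\<not> maximal_estimate TYPE(real ^ 1) p s"
      by (intro not_maximal_estimate_below_concentration) simp_all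
  next
    fix s :: real
    assume "s < 3/4"
    then show "\<not> maximal_estimate TYPE(real ^ 1) 2 s" by (rule not_maximal_estimate_below_packet[OF D1])
  qed
qed

end
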